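(* Let $X$ be an $\alpha$-stable Lévy process on $[0,t]$ which almost surely has no interval on which it is monotone. For $k\ge2$, the distribution of the length $\ell_k(X)$ of the $k$-th longest branch (bar) is characterized by its Mellin transform, which is given by $$\mathbb{E}[\ell_k^p(X)]=\frac1{k!}\left.\frac{\partial^k}{\partial z^k}\right|_{z=0}G_\alpha(z;p),$$ where $$G_\alpha(z;p)=\frac{t^{p/\alpha}}{\Gamma(p/\alpha)}\;\mathcal{M}\!\left[\frac{z}{(z\,\mathbb{E}[e^{-\varepsilon U}])^{-1}-1}\right]\!\left(\frac p\alpha\right).$$
   Context: $\mathcal{M}[f](s)=\int_0^\infty\varepsilon^{s-1}f(\varepsilon)\,d\varepsilon$ is the Mellin transform in the variable $\varepsilon$; the identity is for $p$ such that the quantities involved are defined. $X$ is $\alpha$-stable if $(X_{c^\alpha s})_{s\ge0}$ and $(cX_s)_{s\ge0}$ have the same law for every $c>0$. For $\varepsilon>0$ put $S_0^\varepsilon=T_0^\varepsilon=0$ and $T_{i+1}^\varepsilon=\inf\{u\ge S_i^\varepsilon:\sup_{[S_i^\varepsilon,u]}X-X_u>\varepsilon\}$, $S_{i+1}^\varepsilon=\inf\{u\ge T_{i+1}^\varepsilon:X_u-\inf_{[T_{i+1}^\varepsilon,u]}X>\varepsilon\}$. $R_t=\sup_{[0,t]}X-\inf_{[0,t]}X$ and $N_t^\varepsilon=\mathbf{1}_{\{R_t\ge\varepsilon\}}+\max\{k\ge0:S_k^\varepsilon\le t\}$ is the number of bars of length $\ge\varepsilon$ in the $H_0$ superlevel-set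 barcode of $X|_{[0,t]}$ (infinite bar given length $R_t$). $\ell_k(X)$ is the length of the $k$-th longest bar: $\ell_k\ge\varepsilon\iff N_t^\varepsilon\ge k$. $U=S+T$ where $S,T$ are independent with the laws of $\inf\{u:X_u-\inf_{[0,u]}X>1\}$ and $\inf\{u:\sup_{[0,u]}X-X_u>1\}$. *)

theory Defs
  imports "HOL-Probability.Probability"
begin

section \<open>Stable Levy processes\<close>

definition cadlag :: "(real \<Rightarrow> real) \<Rightarrow> bool" where
  "cadlag x \<longleftrightarrow>
     (\<forall>s\<ge>0. (x \<longlongrightarrow> x s) (at_right s)) \<and>
     (\<forall>s>0. \<exists>l. (x \<longlongrightarrow> l) (at_left s))"

text \<open>
  Processes are indexed by \<^typ>\<open>real\<close>, but only times \<open>s \<ge> 0\<close> are ever used. All paths (not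
  just almost all) are cadlag, as for the canonical version of a Levy process; this keeps path
  functionals measurable without completing \<open>M\<close>. Stochastic continuity is then automatic.
\<close>

definition levy_process :: "'a measure \<Rightarrow> (real \<Rightarrow> 'a \<Rightarrow> real) \<Rightarrow> bool" where
  "levy_process M X \<longleftrightarrow>
     prob_space M \<and>
     (\<forall>s\<ge>0. X s \<in> borel_measurable M) \<and>
     (AE \<omega> in M. X 0 \<omega> = 0) \<and>
     (\<forall>n. \<forall>\<tau> :: nat \<Rightarrow> real. 0 \<le> \<tau> 0 \<and> mono \<tau> \<longrightarrow>
        prob_space.indep_vars M (\<lambda>_. borel) (\<lambda>i \<omega>. X (\<tau> (Suc i)) \<omega> - X (\<tau> i) \<omega>) {..<n}) \<and>
     (\<forall>s\<ge>0. \<forall>h\<ge>0. distr M borel (\<lambda>\<omega>. X (s + h) \<omega> - X s \<omega>) = distr M borel (X h)) \<and>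
     (\<forall>\<omega>\<in>space M. cadlag (\<lambda>s. X s \<omega>))"

definition stable_process :: "real \<Rightarrow> 'a measure \<Rightarrow> (real \<Rightarrow> 'a \<Rightarrow> real) \<Rightarrow> bool" where
  "stable_process \<alpha> M X \<longleftrightarrow>
     (\<forall>c>0. distr M (Pi\<^sub>M {0..} (\<lambda>_. borel)) (\<lambda>\<omega>. \<lambda>s\<in>{0..}. X (c powr \<alpha> * s) \<omega>) =
            distr M (Pi\<^sub>M {0..} (\<lambda>_. borel)) (\<lambda>\<omega>. \<lambda>s\<in>{0..}. c * X s \<omega>))"

definition monotone_on_some_interval :: "real \<Rightarrow> (real \<Rightarrow> real) \<Rightarrow> bool" where
  "monotone_on_some_interval t x \<longleftrightarrow>
     (\<exists>a b. 0 \<le> a \<and> a < b \<and> b \<le> t \<and> (mono_on {a..b} x \<or> antimono_on {a..b} x))"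


section \<open>Bars of a path\<close>

text \<open>
  Times are extended reals, so that the infimum of the empty set is \<open>\<infinity>\<close>. In both definitions
  \<open>s\<close> is the time from which the running extremum is taken.
\<close>

definition drawdown_time :: "(real \<Rightarrow> real) \<Rightarrow> real \<Rightarrow> ereal \<Rightarrow> ereal" where
  "drawdown_time x \<epsilon> s =
     Inf {ereal u | u. s \<le> ereal u \<and> (SUP v\<in>{v. s \<le> ereal v \<and> v \<le> u}. x v) - x u > \<epsilon>}"

definition drawup_time :: "(real \<Rightarrow> real) \<Rightarrow> real \<Rightarrow> ereal \<Rightarrow> ereal" where
  "drawup_time x \<epsilon> s =
     Inf {ereal u | u. s \<le> ereal u \<and> x u - (INF v\<in>{v. s \<le> ereal v \<and> v \<le> u}. x v) > \<epsilon>}"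

fun S_time :: "(real \<Rightarrow> real) \<Rightarrow> real \<Rightarrow> nat \<Rightarrow> ereal"
  and T_time :: "(real \<Rightarrow> real) \<Rightarrow> real \<Rightarrow> nat \<Rightarrow> ereal" where
  "S_time x \<epsilon> 0 = 0"
| "T_time x \<epsilon> 0 = 0"
| "T_time x \<epsilon> (Suc i) = drawdown_time x \<epsilon> (S_time x \<epsilon> i)"
| "S_time x \<epsilon> (Suc i) = drawup_time x \<epsilon> (T_time x \<epsilon> (Suc i))"

definition path_range :: "(real \<Rightarrow> real) \<Rightarrow> real \<Rightarrow> real" where
  "path_range x t = (SUP s\<in>{0..t}. x s) - (INF s\<in>{0..t}. x s)"

text \<open>For a cadlag path and \<open>\<epsilon> > 0\<close> the set under \<open>Max\<close> is finite, and it contains \<open>0\<close> when \<open>t \<ge> 0\<close>.\<close>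

definition bar_count :: "(real \<Rightarrow> real) \<Rightarrow> real \<Rightarrow> real \<Rightarrow> nat" where
  "bar_count x t \<epsilon> = (if path_range x t \<ge> \<epsilon> then 1 else 0) + Max {k. S_time x \<epsilon> k \<le> ereal t}"

text \<open>
  The length of the \<open>k\<close>-th longest bar is the generalised inverse of the bar count, and \<open>0\<close> if
  there are fewer than \<open>k\<close> bars. The relation ``length at least \<open>\<epsilon>\<close> iff \<open>bar_count\<close> at least
  \<open>k\<close>'' then holds for all \<open>\<epsilon> > 0\<close> except possibly at \<open>\<epsilon>\<close> equal to the length itself: because of
  the strict inequalities in the crossing times it cannot be required there (a continuous path
  typically attains an oscillation of exactly that length without exceeding it).
\<close>

definition bar_length :: "(real \<Rightarrow> real) \<Rightarrow> real \<Rightarrow> nat \<Rightarrow> real" where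
  "bar_length x t k = Sup (insert 0 {\<epsilon>. \<epsilon> > 0 \<and> k \<le> bar_count x t \<epsilon>})"


section \<open>Transforms\<close>

definition mellin_integrable :: "(real \<Rightarrow> complex) \<Rightarrow> complex \<Rightarrow> bool" where
  "mellin_integrable f s \<longleftrightarrow>
     set_integrable lborel {0<..} (\<lambda>\<epsilon>. complex_of_real \<epsilon> powr (s - 1) * f \<epsilon>)"

definition mellin :: "(real \<Rightarrow> complex) \<Rightarrow> complex \<Rightarrow> complex" where
  "mellin f s = (LINT \<epsilon>:{0<..}|lborel. complex_of_real \<epsilon> powr (s - 1) * f \<epsilon>)"

definition laplace :: "'b measure \<Rightarrow> ('b \<Rightarrow> ereal) \<Rightarrow> real \<Rightarrow> real" where
  "laplace N U \<epsilon> = (LINT \<omega>|N. (if U \<omega> = \<infinity> then 0 else exp (- \<epsilon> * real_of_ereal (U \<omega>))))"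

text \<open>
  In the following, \<open>\<phi>\<close> stands for the Laplace transform of \<open>U\<close>. At \<open>z = 0\<close> the convention
  \<open>inverse 0 = 0\<close> gives the integrand its removable value \<open>0\<close>.
\<close>

definition G_integrand :: "(real \<Rightarrow> real) \<Rightarrow> complex \<Rightarrow> real \<Rightarrow> complex" where
  "G_integrand \<phi> z \<epsilon> = z / (inverse (z * complex_of_real (\<phi> \<epsilon>)) - 1)"

definition G :: "real \<Rightarrow> real \<Rightarrow> (real \<Rightarrow> real) \<Rightarrow> complex \<Rightarrow> complex \<Rightarrow> complex" where
  "G \<alpha> t \<phi> z p =
     complex_of_real t powr (p / of_real \<alpha>) / Gamma (p / of_real \<alpha>) *
     mellin (G_integrand \<phi> z) (p / of_real \<alpha>)"

text \<open>
  The exponents \<open>p\<close> for which \<open>G\<close> is given by convergent integrals for all \<open>z\<close> near \<open>0\<close>.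
  Convergence for some \<open>z \<noteq> 0\<close> near \<open>0\<close> forces \<open>Re p > 0\<close>, since \<open>\<phi>\<close> tends to \<open>1\<close> at \<open>0\<close>; so
  the Gamma factor is harmless there.
\<close>

definition G_defined :: "real \<Rightarrow> (real \<Rightarrow> real) \<Rightarrow> complex \<Rightarrow> bool" where
  "G_defined \<alpha> \<phi> p \<longleftrightarrow>
     (\<forall>\<^sub>F z in nhds 0. mellin_integrable (G_integrand \<phi> z) (p / of_real \<alpha>))"

end

theory Submission
  imports Defs "HOL-Complex_Analysis.Complex_Analysis"
begin

text \<open>
  For \<open>k \<ge> 2\<close> the \<open>k\<close>-th bar is longer than \<open>\<epsilon>\<close> iff \<open>S_time\<close> number \<open>k - 1\<close> at some level above
  \<open>\<epsilon>\<close> is at most \<open>t\<close>. Self-similarity reduces every level to level \<open>1\<close>, so the length of the bar has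
  the law of \<open>(t / \<tau>) powr (1 / \<alpha>)\<close>, where \<open>\<tau>\<close> is that crossing time at level \<open>1\<close>. The Laplace
  transform of \<open>\<tau>\<close> is the power \<open>k - 1\<close> of the transform \<open>\<phi>\<close> of \<open>U\<close>. This is the strong Markov property,
  obtained from its elementary form for the random walks that observe \<open>X\<close> along a grid: restricting the
  crossing times to the grid gives times that decrease to the true ones as the mesh tends to \<open>0\<close>.
  Fubini and the Gamma integral turn the moments of \<open>\<tau>\<close> into the Mellin transform of \<open>\<phi> ^ (k - 1)\<close>,
  and the integrand of \<open>G\<close> is the geometric series \<open>\<Sum>k\<ge>2. z ^ k * \<phi> ^ (k - 1)\<close>.

  The moments determine the law because they are available on a whole vertical line, where they are
  the characteristic function of a tilted logarithm. This needs \<open>\<phi>\<close> to decay polynomially: if no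
  drawdown happens before time \<open>u\<close>, then none happens in each of \<open>n\<close> independent blocks of length
  \<open>u / n\<close>, so the probability of a drawdown within \<open>u / n\<close> is \<open>O(1 / n)\<close>. Finally \<open>\<phi> > 0\<close>, since
  otherwise drawdowns (or drawups) of size \<open>1\<close>, hence of any size, would almost surely never happen and
  \<open>X\<close> would be monotone.
\<close>

section \<open>Crossing times of cadlag paths\<close>

text \<open>The independence in \<open>levy_process\<close> concerns increments over deterministic
  times only, so restarting at a random time is the main obstacle. The detour through grids works
  because of the strict inequalities in the crossing times: a crossing before \<open>q\<close> means
  that two times \<open>v \<le> u < q\<close> exhibit the oscillation, and by right continuity such
  a pair can be moved slightly to the right, onto a fine grid. The same description yields
  measurability, scaling and monotonicity in the level. A drawup of \<open>x\<close> is a drawdown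
  of \<open>- x\<close>, so one family of times with a sign per step covers \<open>S\<close>,
  \<open>T\<close> and the alternating times.

  The vertical line is \<open>Re p = \<alpha> / 4\<close>: the decay obtained is
  \<open>\<phi> r \<le> C / sqrt r\<close>, which makes the Mellin integral converge for
  \<open>0 < Re (p / \<alpha>) < 1 / 2\<close>, and \<open>1 / 4\<close> is the midpoint. Since
  \<open>0 powr p = 0\<close>, moments do not see an atom at 0; it is recovered from the total mass
  1.\<close>

lemma drawup_time_eq_drawdown_time:
  "drawup_time x \<epsilon> s = drawdown_time (\<lambda>v. - x v) \<epsilon> s"
proof -
  have "(INF v\<in>A. x v) = - (SUP v\<in>A. - x v)" for A
    by (simp add: Inf_real_def image_image)
  then show ?thesis
    by (simp add: drawup_time_def drawdown_time_def add.commute)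
qed

section \<open>Boundedness of cadlag paths and stability under rescaling\<close>

lemma cadlag_locally_bounded:
  assumes "cadlag x" "0 \<le> s"
  shows "\<exists>d>0. \<exists>B. \<forall>v. 0 \<le> v \<longrightarrow> \<bar>v - s\<bar> < d \<longrightarrow> \<bar>x v\<bar> \<le> B"
proof -
  have "(x \<longlongrightarrow> x s) (at_right s)"
    using assms unfolding cadlag_def by blast
  then have "\<forall>\<^sub>F v in at_right s. dist (x v) (x s) < 1"
    by (rule tendstoD) simp
  then obtain b where b: "s < b" "\<And>v. s < v \<Longrightarrow> v < b \<Longrightarrow> dist (x v) (x s) < 1"
    unfolding eventually_at_right_field by blast
  have left: "\<exists>a l. a < s \<and> (\<forall>v. 0 \<le> v \<longrightarrow> a < v \<longrightarrow> v < s \<longrightarrow> dist (x v) l < 1)"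
  proof (cases "s = 0")
    case True
    then show ?thesis by (intro exI[of _ "-1"]) auto
  next
    case False
    then obtain l where "(x \<longlongrightarrow> l) (at_left s)"
      using assms unfolding cadlag_def by force
    then have "\<forall>\<^sub>F v in at_left s. dist (x v) l < 1"
      by (rule tendstoD) simp
    then show ?thesis unfolding eventually_at_left_field by blast
  qed
  then obtain a l where a: "a < s" "\<And>v. 0 \<le> v \<Longrightarrow> a < v \<Longrightarrow> v < s \<Longrightarrow> dist (x v) l < 1"
    by blast
  have "\<bar>x v\<bar> \<le> \<bar>x s\<bar> + \<bar>l\<bar> + 1" if "0 \<le> v" "\<bar>v - s\<bar> < min (s - a) (b - s)" for v
    using a(2)[of v] b(2)[of v] that by (cases v s rule: linorder_cases) (auto simp: dist_real_def)
  then show ?thesis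
    using a(1) b(1) by (intro exI[of _ "min (s - a) (b - s)"]) auto
qed

lemma cadlag_bounded:
  assumes "cadlag x"
  shows "\<exists>B. \<forall>v\<in>{0..b}. \<bar>x v\<bar> \<le> B"
proof (cases "0 \<le> b")
  case True
  have "\<exists>B. \<forall>v\<in>{0..b}. 0 \<le> v \<longrightarrow> \<bar>x v\<bar> \<le> B"
    using True
  \<comment> \<open>The bisection principle asks about small intervals around \<open>s\<close> that
    may reach below 0, where nothing is known of \<open>x\<close>; hence the guard
    \<open>0 \<le> v\<close>.\<close>
  proof (rule Bolzano[where P = "\<lambda>a b. \<exists>B. \<forall>v\<in>{a..b}. 0 \<le> v \<longrightarrow> \<bar>x v\<bar> \<le> B"])
    fix a b c :: real
    assume "\<exists>B. \<forall>v\<in>{a..b}. 0 \<le> v \<longrightarrow> \<bar>x v\<bar> \<le> B" "\<exists>B. \<forall>v\<in>{b..c}. 0 \<le> v \<longrightarrow> \<bar>x v\<bar> \<le> B"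
    then obtain B C where "\<forall>v\<in>{a..b}. 0 \<le> v \<longrightarrow> \<bar>x v\<bar> \<le> B" "\<forall>v\<in>{b..c}. 0 \<le> v \<longrightarrow> \<bar>x v\<bar> \<le> C"
      by blast
    then show "\<exists>B. \<forall>v\<in>{a..c}. 0 \<le> v \<longrightarrow> \<bar>x v\<bar> \<le> B"
      by (intro exI[of _ "max B C"]) (force simp: le_max_iff_disj)
  next
    fix s :: real assume "0 \<le> s" "s \<le> b"
    then obtain d B where "d > 0" "\<forall>v. 0 \<le> v \<longrightarrow> \<bar>v - s\<bar> < d \<longrightarrow> \<bar>x v\<bar> \<le> B"
      using cadlag_locally_bounded[OF assms] by blast
    then show "\<exists>d>0. \<forall>a b. a \<le> s \<and> s \<le> b \<and> b - a < d \<longrightarrow> (\<exists>B. \<forall>v\<in>{a..b}. 0 \<le> v \<longrightarrow> \<bar>x v\<bar> \<le> B)"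
      by (intro exI[of _ d]) (auto intro!: exI[of _ B])
  qed
  then show ?thesis by auto
qed auto

lemma cadlag_cmult: "cadlag x \<Longrightarrow> cadlag (\<lambda>s. c * x s)"
  unfolding cadlag_def by (blast intro: tendsto_mult_left)

lemma cadlag_rescale:
  assumes x: "cadlag x" and a: "0 < a"
  shows "cadlag (\<lambda>s. x (a * s))"
  unfolding cadlag_def
proof (intro conjI allI impI)
  fix s :: real assume "0 \<le> s"
  have "filterlim (\<lambda>s. a * s) (at_right (a * s)) (at_right s)"
    unfolding filterlim_at
    using a by (auto intro!: tendsto_intros eventually_at_rightI[of s "s + 1"])
  moreover have "(x \<longlongrightarrow> x (a * s)) (at_right (a * s))"
    using x \<open>0 \<le> s\<close> a unfolding cadlag_def by simp
  ultimately show "((\<lambda>s. x (a * s)) \<longlongrightarrow> x (a * s)) (at_right s)"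
    by (rule filterlim_compose[rotated])
next
  fix s :: real assume "0 < s"
  have "filterlim (\<lambda>s. a * s) (at_left (a * s)) (at_left s)"
    unfolding filterlim_at
    using a by (auto intro!: tendsto_intros eventually_at_leftI[of "s - 1" s])
  moreover have "0 < a * s" using a \<open>0 < s\<close> by simp
  then obtain l where "(x \<longlongrightarrow> l) (at_left (a * s))"
    using x unfolding cadlag_def by blast
  ultimately show "\<exists>l. ((\<lambda>s. x (a * s)) \<longlongrightarrow> l) (at_left s)"
    by (blast intro: filterlim_compose)
qed

text \<open>A supremum strictly exceeds a number iff some element does, so the strict inequalities
  of the definition let both \<open>SUP\<close> and \<open>Inf\<close> dissolve into a choice of two
  times. The path must be bounded on compact intervals because a real \<open>SUP\<close> is
  meaningful only for bounded sets.\<close>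

lemma drawdown_time_less_iff:
  assumes x: "cadlag x" and s: "0 \<le> s"
  shows "drawdown_time x \<epsilon> s < ereal q \<longleftrightarrow>
    (\<exists>v u. s \<le> ereal v \<and> v \<le> u \<and> u < q \<and> \<epsilon> < x v - x u)" (is "_ \<longleftrightarrow> ?R")
proof -
  have *: "\<epsilon> < (SUP v\<in>{v. s \<le> ereal v \<and> v \<le> u}. x v) - x u \<longleftrightarrow>
      (\<exists>v. s \<le> ereal v \<and> v \<le> u \<and> \<epsilon> < x v - x u)" if "s \<le> ereal u" for u
  proof -
    obtain B where B: "\<forall>v\<in>{0..u}. \<bar>x v\<bar> \<le> B"
      using cadlag_bounded[OF x] by blast
    have "x v \<le> B" if "s \<le> ereal v" "v \<le> u" for v
    proof -
      have "0 \<le> v" using order_trans[OF s that(1)] by simp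
      then show ?thesis using B that by (auto simp: abs_le_iff)
    qed
    then have "bdd_above (x ` {v. s \<le> ereal v \<and> v \<le> u})"
      by (intro bdd_aboveI[of _ B]) auto
    moreover have "{v. s \<le> ereal v \<and> v \<le> u} \<noteq> {}" using that by auto
    ultimately have "\<epsilon> + x u < (SUP v\<in>{v. s \<le> ereal v \<and> v \<le> u}. x v) \<longleftrightarrow>
        (\<exists>v\<in>{v. s \<le> ereal v \<and> v \<le> u}. \<epsilon> + x u < x v)"
      by (rule less_cSUP_iff[rotated])
    then show ?thesis by (auto simp: less_diff_eq)
  qed
  have "drawdown_time x \<epsilon> s < ereal q \<longleftrightarrow> (\<exists>u. s \<le> ereal u \<and> 
      \<epsilon> < (SUP v\<in>{v. s \<le> ereal v \<and> v \<le> u}. x v) - x u \<and> u < q)"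
    unfolding drawdown_time_def Inf_less_iff by auto
  also have "\<dots> \<longleftrightarrow> ?R"
  proof
    assume ?R
    then obtain v u where "s \<le> ereal v" "v \<le> u" "u < q" "\<epsilon> < x v - x u"
      by blast
    moreover from this have "s \<le> ereal u"
      by (meson ereal_less_eq(3) order_trans)
    ultimately show "\<exists>u. s \<le> ereal u \<and> \<epsilon> < (SUP v\<in>{v. s \<le> ereal v \<and> v \<le> u}. x v) - x u \<and> u < q"
      using * by blast
  qed (use * in blast)
  finally show ?thesis .
qed

lemma drawdown_time_nonneg: "0 \<le> s \<Longrightarrow> s \<le> drawdown_time x \<epsilon> s"
  unfolding drawdown_time_def by (auto intro: Inf_greatest)

lemma ereal_less_imp_le:
  fixes a b :: ereal
  assumes "\<And>q. b < ereal q \<Longrightarrow> a < ereal q"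
  shows "a \<le> b"
proof (rule ccontr)
  assume "\<not> a \<le> b"
  then obtain q where "b < ereal q" "ereal q < a"
    using ereal_dense2 by (auto simp: not_le)
  then show False using assms[of q] by simp
qed

lemma drawdown_time_le:
  assumes "cadlag x" "0 \<le> s" "s \<le> ereal v" "v \<le> u" "\<epsilon> < x v - x u"
  shows "drawdown_time x \<epsilon> s \<le> ereal u"
  by (rule ereal_less_imp_le) (use assms in \<open>auto simp: drawdown_time_less_iff\<close>)

lemma drawdown_time_mono:
  assumes "cadlag x" "0 \<le> s" "s \<le> s'" "\<epsilon> \<le> \<epsilon>'"
  shows "drawdown_time x \<epsilon> s \<le> drawdown_time x \<epsilon>' s'"
proof (rule ereal_less_imp_le)
  fix q assume q: "drawdown_time x \<epsilon>' s' < ereal q"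
  have "0 \<le> s'" using assms by simp
  then obtain v u where "s' \<le> ereal v" "v \<le> u" "u < q" "\<epsilon>' < x v - x u"
    using q unfolding drawdown_time_less_iff[OF assms(1) \<open>0 \<le> s'\<close>] by blast
  moreover from this have "s \<le> ereal v" "\<epsilon> < x v - x u"
    using assms by (auto intro: order_trans)
  ultimately show "drawdown_time x \<epsilon> s < ereal q"
    unfolding drawdown_time_less_iff[OF assms(1,2)] by blast
qed

lemma cadlag_right_nbhd:
  assumes "cadlag x" "0 \<le> s" "0 < e"
  shows "\<exists>d>0. \<forall>v. s \<le> v \<and> v < s + d \<longrightarrow> \<bar>x v - x s\<bar> < e"
proof -
  have "(x \<longlongrightarrow> x s) (at_right s)"
    using assms unfolding cadlag_def by blast
  then have "\<forall>\<^sub>F v in at_right s. dist (x v) (x s) < e"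
    using \<open>0 < e\<close> by (rule tendstoD)
  then obtain b where b: "s < b" "\<And>v. s < v \<Longrightarrow> v < b \<Longrightarrow> dist (x v) (x s) < e"
    unfolding eventually_at_right_field by blast
  have "\<bar>x v - x s\<bar> < e" if "s \<le> v" "v < b" for v
    using that b(2)[of v] \<open>0 < e\<close> by (cases "v = s") (auto simp: dist_real_def)
  then show ?thesis
    using b(1) by (intro exI[of _ "b - s"]) auto
qed

text \<open>Right continuity keeps the path within \<open>\<epsilon> / 2\<close> of
  \<open>x s\<close> for a while, so no drop above \<open>\<epsilon>\<close> occurs there. Hence
  finite stages increase strictly.\<close>

lemma drawdown_time_greater:
  assumes "cadlag x" "0 \<le> s" "0 < \<epsilon>"
  shows "ereal s < drawdown_time x \<epsilon> (ereal s)"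
proof -
  obtain d where d: "d > 0" "\<And>v. s \<le> v \<Longrightarrow> v < s + d \<Longrightarrow> \<bar>x v - x s\<bar> < \<epsilon> / 2"
    using cadlag_right_nbhd[OF assms(1,2), of "\<epsilon> / 2"] \<open>0 < \<epsilon>\<close> by auto
  have "\<not> drawdown_time x \<epsilon> (ereal s) < ereal (s + d)"
  proof
    assume "drawdown_time x \<epsilon> (ereal s) < ereal (s + d)"
    then obtain v u where "s \<le> v" "v \<le> u" "u < s + d" "\<epsilon> < x v - x u"
      using assms by (auto simp: drawdown_time_less_iff)
    then show False
      using d(2)[of v] d(2)[of u] by (auto simp: abs_real_def split: if_splits)
  qed
  then have "ereal (s + d) \<le> drawdown_time x \<epsilon> (ereal s)" by simp
  moreover have "ereal s < ereal (s + d)" using d by simp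
  ultimately show ?thesis by (rule less_le_trans[rotated])
qed

text \<open>
  The sign of \<open>c n\<close> decides whether stage \<open>n + 1\<close> waits for a drawdown or for a drawup. The
  discrete analogue is meant for \<open>w i = x (h * i)\<close> with a small mesh \<open>h\<close>.
\<close>

primrec stage :: "(nat \<Rightarrow> real) \<Rightarrow> (real \<Rightarrow> real) \<Rightarrow> real \<Rightarrow> nat \<Rightarrow> ereal" where
  "stage c x \<epsilon> 0 = 0"
| "stage c x \<epsilon> (Suc n) = drawdown_time (\<lambda>s. c n * x s) \<epsilon> (stage c x \<epsilon> n)"

primrec grid_stage :: "(nat \<Rightarrow> real) \<Rightarrow> (nat \<Rightarrow> real) \<Rightarrow> real \<Rightarrow> nat \<Rightarrow> nat \<Rightarrow> bool" where
  "grid_stage c w \<epsilon> 0 m = True"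
| "grid_stage c w \<epsilon> (Suc n) m =
     (\<exists>v u. v \<le> u \<and> u \<le> m \<and> grid_stage c w \<epsilon> n v \<and> \<epsilon> < c n * (w v - w u))"

lemma S_T_time_eq_stage:
  "S_time x \<epsilon> i = stage (\<lambda>n. (- 1) ^ n) x \<epsilon> (2 * i)"
  "T_time x \<epsilon> (Suc i) = stage (\<lambda>n. (- 1) ^ n) x \<epsilon> (Suc (2 * i))"
  by (induction i) (auto simp: drawup_time_eq_drawdown_time)

lemma drawdown_time_eq_stage: "drawdown_time x \<epsilon> 0 = stage (\<lambda>_. 1) x \<epsilon> (Suc 0)"
  and drawup_time_eq_stage: "drawup_time x \<epsilon> 0 = stage (\<lambda>_. - 1) x \<epsilon> (Suc 0)"
  by (simp_all add: drawup_time_eq_drawdown_time)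

lemma stage_nonneg: "0 \<le> stage c x \<epsilon> n"
  by (induction n) (auto intro: order_trans drawdown_time_nonneg)

lemma stage_mono: "m \<le> n \<Longrightarrow> stage c x \<epsilon> m \<le> stage c x \<epsilon> n"
  by (rule lift_Suc_mono_le[of "stage c x \<epsilon>"]) (auto intro: drawdown_time_nonneg stage_nonneg)

lemma stage_mono_level:
  "cadlag x \<Longrightarrow> \<epsilon> \<le> \<epsilon>' \<Longrightarrow> stage c x \<epsilon> n \<le> stage c x \<epsilon>' n"
  by (induction n) (auto intro!: drawdown_time_mono cadlag_cmult stage_nonneg)

lemma stage_less_Suc:
  assumes "cadlag x" "0 < \<epsilon>" "stage c x \<epsilon> n < \<infinity>"
  shows "stage c x \<epsilon> n < stage c x \<epsilon> (Suc n)"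
proof -
  obtain s where s: "stage c x \<epsilon> n = ereal s" "0 \<le> s"
    using assms(3) stage_nonneg[of c x \<epsilon> n] by (cases "stage c x \<epsilon> n") auto
  show ?thesis
    using drawdown_time_greater[OF cadlag_cmult[OF assms(1)] s(2) assms(2)] s(1) by simp
qed

lemma stage_Suc_less_iff:
  assumes "cadlag x"
  shows "stage c x \<epsilon> (Suc n) < ereal q \<longleftrightarrow>
    (\<exists>v u. stage c x \<epsilon> n \<le> ereal v \<and> v \<le> u \<and> u < q \<and> \<epsilon> < c n * (x v - x u))"
  using drawdown_time_less_iff[OF cadlag_cmult[OF assms] stage_nonneg]
  by (simp add: right_diff_distrib)

text \<open>A pair of grid points that exhibits a crossing is also a pair of times, so the grid can
  only delay a stage.\<close>

lemma stage_le_grid: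
  assumes "cadlag x" "0 < h"
  shows "grid_stage c (\<lambda>i. x (h * real i)) \<epsilon> n m \<Longrightarrow> stage c x \<epsilon> n \<le> ereal (h * real m)"
proof (induction n arbitrary: m)
  case 0
  then show ?case using assms by simp
next
  case (Suc n)
  then obtain v u where vu: "v \<le> u" "u \<le> m" "grid_stage c (\<lambda>i. x (h * real i)) \<epsilon> n v"
    "\<epsilon> < c n * (x (h * real v) - x (h * real u))"
    by auto
  have "stage c x \<epsilon> (Suc n) \<le> ereal (h * real u)"
    unfolding stage.simps
    by (rule drawdown_time_le[OF cadlag_cmult[OF assms(1)] stage_nonneg Suc.IH[OF vu(3)]])
      (use vu assms in \<open>auto simp: right_diff_distrib\<close>)
  also have "\<dots> \<le> ereal (h * real m)" using vu assms by simp
  finally show ?case .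
qed

lemma grid_stage_mono:
  "grid_stage c w \<epsilon> n m \<Longrightarrow> m \<le> m' \<Longrightarrow> grid_stage c w \<epsilon> n m'"
  by (cases n) (auto intro: order_trans)

lemma grid_point_right:
  fixes a :: real
  assumes "0 < h" "0 \<le> a"
  shows "\<exists>i::nat. a < h * real i \<and> h * real i \<le> a + h"
proof -
  have "0 \<le> \<lfloor>a / h\<rfloor>" using assms by simp
  then have "real (nat \<lfloor>a / h\<rfloor> + 1) = real_of_int \<lfloor>a / h\<rfloor> + 1" by simp
  moreover have "a / h < real_of_int \<lfloor>a / h\<rfloor> + 1" "real_of_int \<lfloor>a / h\<rfloor> \<le> a / h" by linarith+
  ultimately have "a / h < real (nat \<lfloor>a / h\<rfloor> + 1)" "real (nat \<lfloor>a / h\<rfloor> + 1) \<le> a / h + 1" by linarith+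
  then show ?thesis
    using assms by (intro exI[of _ "nat \<lfloor>a / h\<rfloor> + 1"]) (simp add: field_simps)
qed

text \<open>The delay caused by the grid vanishes with the mesh. Witnesses \<open>v < u\<close> of a
  strict oscillation are replaced by grid points just to their right, where right continuity
  preserves the inequality. The grid point for \<open>v\<close> must also come after the grid
  version of stage \<open>n\<close>, so the induction runs over all \<open>q\<close> and is applied
  at a time slightly above \<open>v\<close>.\<close>

lemma stage_less_grid:
  assumes x: "cadlag x" and \<epsilon>: "0 < \<epsilon>" and h: "\<And>N. 0 < h N" "h \<longlonglongrightarrow> 0"
  shows "stage c x \<epsilon> n < ereal q \<Longrightarrow>
    \<forall>\<^sub>F N in sequentially. \<exists>m. h N * real m < q \<and> grid_stage c (\<lambda>i. x (h N * real i)) \<epsilon> n m"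
proof (induction n arbitrary: q)
  case 0
  then show ?case by (intro always_eventually allI exI[of _ 0]) simp
next
  case (Suc n)
  let ?y = "\<lambda>s. c n * x s"
  from Suc.prems obtain v u where
    vu: "stage c x \<epsilon> n \<le> ereal v" "v \<le> u" "u < q" "\<epsilon> < ?y v - ?y u"
    unfolding stage_Suc_less_iff[OF x] by (auto simp: right_diff_distrib)
  have "v < u" using vu \<epsilon> by (cases "v = u") auto
  have "0 \<le> v" using order_trans[OF stage_nonneg vu(1)] by simp
  \<comment> \<open>Half of the slack in the strict inequality: the values at \<open>v\<close> and
    at \<open>u\<close> may each change by less than \<open>e\<close>.\<close>
  define e where "e = (?y v - ?y u - \<epsilon>) / 2"
  have "0 < e" using vu by (simp add: e_def)
  obtain d where d: "d > 0" "\<And>r. v \<le> r \<Longrightarrow> r < v + d \<Longrightarrow> \<bar>?y r - ?y v\<bar> < e"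
    using cadlag_right_nbhd[OF cadlag_cmult[OF x] \<open>0 \<le> v\<close> \<open>0 < e\<close>] by blast
  obtain d' where d': "d' > 0" "\<And>r. u \<le> r \<Longrightarrow> r < u + d' \<Longrightarrow> \<bar>?y r - ?y u\<bar> < e"
    using cadlag_right_nbhd[OF cadlag_cmult[OF x] _ \<open>0 < e\<close>] \<open>0 \<le> v\<close> vu by (meson order_trans)
  \<comment> \<open>\<open>d\<close> and \<open>d'\<close> keep the moved points where
    \<open>x\<close> is close to its values at \<open>v\<close> and \<open>u\<close>;
    \<open>u - v\<close> keeps the two points in order, and \<open>q - u\<close> keeps the second
    one before \<open>q\<close>.\<close>
  define \<delta> where "\<delta> = Min {d, d', u - v, q - u}"
  have \<delta>: "0 < \<delta>" "\<delta> \<le> d" "\<delta> \<le> d'" "\<delta> \<le> u - v" "\<delta> \<le> q - u"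
    using d d' \<open>v < u\<close> vu by (auto simp: \<delta>_def)
  have "stage c x \<epsilon> n < ereal (v + \<delta>)"
    using vu(1) \<delta>(1) by (auto intro: le_less_trans)
  from Suc.IH[OF this] have
    "\<forall>\<^sub>F N in sequentially. \<exists>m. h N * real m < v + \<delta> \<and> grid_stage c (\<lambda>i. x (h N * real i)) \<epsilon> n m" .
  moreover have "\<forall>\<^sub>F N in sequentially. h N < \<delta>"
    using order_tendstoD(2)[OF h(2) \<delta>(1)] .
  ultimately show ?case
  proof eventually_elim
    case (elim N)
    then obtain m where m: "h N * real m < v + \<delta>" "grid_stage c (\<lambda>i. x (h N * real i)) \<epsilon> n m" by blast
    obtain i where i: "v < h N * real i" "h N * real i \<le> v + h N"
      using grid_point_right[OF h(1) \<open>0 \<le> v\<close>] by blast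
    obtain j where j: "u < h N * real j" "h N * real j \<le> u + h N"
      using grid_point_right[OF h(1), of u] \<open>0 \<le> v\<close> vu(2) by auto
    \<comment> \<open>The grid time \<open>m\<close> that completes stage \<open>n\<close> may lie
      left of \<open>v\<close>, and the grid point \<open>i\<close> may precede \<open>m\<close>.
      The larger of the two is right of \<open>v\<close>, still below \<open>v + \<delta>\<close>,
      and not before the completion of stage \<open>n\<close>.\<close>
    define i' where "i' = max i m"
    have "h N * real i \<le> h N * real i'"
      using h(1)[of N] by (simp add: i'_def)
    then have i': "v < h N * real i'" "h N * real i' < v + \<delta>"
      using i(1) i(2) m(1) elim(2) by (linarith, cases "i \<le> m") (auto simp: i'_def max_def)
    have "h N * real i' < h N * real j" using i' j \<delta> by linarith
    then have "i' \<le> j" using h(1)[of N] by simp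
    have "grid_stage c (\<lambda>i. x (h N * real i)) \<epsilon> n i'"
      using m(2) by (rule grid_stage_mono) (simp add: i'_def)
    have "\<bar>?y (h N * real i') - ?y v\<bar> < e" "\<bar>?y (h N * real j) - ?y u\<bar> < e"
      using i' j \<delta> elim by (auto intro!: d(2) d'(2))
    moreover have "2 * e = ?y v - ?y u - \<epsilon>" by (simp add: e_def)
    ultimately have "\<epsilon> < ?y (h N * real i') - ?y (h N * real j)" by linarith
    then have "\<epsilon> < c n * (x (h N * real i') - x (h N * real j))"
      by (simp add: right_diff_distrib)
    moreover have "h N * real j < q" using j \<delta> elim by linarith
    ultimately show ?case using \<open>i' \<le> j\<close> \<open>grid_stage _ _ _ n i'\<close> by auto
  qed
qed

text \<open>Stages that all stay below \<open>t\<close> would increase strictly to a finite limit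
  \<open>L\<close>, with oscillations above \<open>\<epsilon>\<close> arbitrarily close to
  \<open>L\<close> from the left. This contradicts the left limit of the path at
  \<open>L\<close>.\<close>

lemma stage_unbounded:
  assumes x: "cadlag x" and \<epsilon>: "0 < \<epsilon>" and c: "\<And>n. \<bar>c n\<bar> \<le> 1"
  shows "\<exists>n. ereal t < stage c x \<epsilon> n"
proof (rule ccontr)
  assume "\<not> ?thesis"
  then have le: "stage c x \<epsilon> n \<le> ereal t" for n by (simp add: not_less)
  define r where "r n = real_of_ereal (stage c x \<epsilon> n)" for n
  have r: "stage c x \<epsilon> n = ereal (r n)" for n
    using le[of n] stage_nonneg[of c x \<epsilon> n] unfolding r_def by (cases "stage c x \<epsilon> n") auto
  have r_less: "r n < r (Suc n)" for n
    using stage_less_Suc[OF x \<epsilon>, of c n] by (simp add: r del: stage.simps)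
  have bdd: "bdd_above (range r)"
    using le by (intro bdd_aboveI[of _ t]) (auto simp: r)
  define L where "L = (SUP n. r n)"
  have r_less_L: "r n < L" for n
    using r_less[of n] cSUP_upper[OF _ bdd, of "Suc n"] by (simp add: L_def)
  have "0 \<le> r 0" using stage_nonneg[of c x \<epsilon> 0] r[of 0] by simp
  then have "0 < L" using r_less_L[of 0] by simp
  then obtain l where "(x \<longlongrightarrow> l) (at_left L)"
    using x unfolding cadlag_def by blast
  then have "\<forall>\<^sub>F v in at_left L. dist (x v) l < \<epsilon> / 2"
    by (rule tendstoD) (use \<epsilon> in simp)
  then obtain a where a: "a < L" "\<And>v. a < v \<Longrightarrow> v < L \<Longrightarrow> dist (x v) l < \<epsilon> / 2"
    unfolding eventually_at_left_field by blast
  obtain n where n: "a < r n"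
    using a(1) bdd unfolding L_def by (auto simp: less_cSUP_iff)
  have "stage c x \<epsilon> (Suc n) < ereal L" using r_less_L r by (simp del: stage.simps)
  then obtain v u where vu: "r n \<le> v" "v \<le> u" "u < L" "\<epsilon> < c n * (x v - x u)"
    unfolding stage_Suc_less_iff[OF x] by (auto simp: r)
  have "\<epsilon> < \<bar>c n\<bar> * \<bar>x v - x u\<bar>" using vu(4) by (simp add: abs_mult[symmetric])
  also have "\<dots> \<le> 1 * \<bar>x v - x u\<bar>" by (intro mult_right_mono c) auto
  finally have "\<epsilon> < \<bar>x v - x u\<bar>" by simp
  moreover have "dist (x v) l < \<epsilon> / 2" "dist (x u) l < \<epsilon> / 2"
    using vu n a(2)[of v] a(2)[of u] by linarith+
  ultimately show False unfolding dist_real_def by linarith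
qed

section \<open>Bar counts and bar lengths through alternating stages\<close>

abbreviation alternating :: "nat \<Rightarrow> real" where "alternating \<equiv> \<lambda>n. (- 1) ^ n"

lemma stage_alternating_le_imp:
  assumes x: "cadlag x" and n: "stage alternating x \<epsilon> (Suc n) < ereal q"
  shows "\<exists>v u. 0 \<le> v \<and> v \<le> u \<and> u < q \<and> \<epsilon> < \<bar>x v - x u\<bar>"
proof -
  from n obtain v u where vu: "stage alternating x \<epsilon> n \<le> ereal v" "v \<le> u" "u < q"
    "\<epsilon> < (- 1) ^ n * (x v - x u)"
    unfolding stage_Suc_less_iff[OF x] by blast
  have "0 \<le> v" using order_trans[OF stage_nonneg vu(1)] by simp
  moreover have "(- 1) ^ n * (x v - x u) \<le> \<bar>x v - x u\<bar>"
    by (cases "even n") auto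
  ultimately show ?thesis using vu by (intro exI[of _ v] exI[of _ u]) auto
qed

lemma path_range_ge:
  assumes x: "cadlag x" and vu: "0 \<le> v" "v \<le> t" "0 \<le> u" "u \<le> t"
  shows "\<bar>x v - x u\<bar> \<le> path_range x t"
proof -
  obtain B where B: "\<forall>v\<in>{0..t}. \<bar>x v\<bar> \<le> B"
    using cadlag_bounded[OF x] by blast
  have "bdd_above (x ` {0..t})" "bdd_below (x ` {0..t})"
    using B by (auto intro!: bdd_aboveI[of _ B] bdd_belowI[of _ "- B"] simp: abs_le_iff)
  then have "x r \<le> (SUP s\<in>{0..t}. x s)" "(INF s\<in>{0..t}. x s) \<le> x r" if "0 \<le> r" "r \<le> t" for r
    using that by (auto intro: cSUP_upper cINF_lower)
  from this[of v] this[of u] show ?thesis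
    using vu unfolding path_range_def by auto
qed

text \<open>Completing the first drawup by time \<open>t\<close> forces the range up to
  \<open>t\<close> to be at least \<open>\<epsilon>\<close>, so the summand for the infinite bar is
  1 as soon as the maximum is at least 1. This accounts for the shift from \<open>k\<close> bars to
  \<open>S_time\<close> number \<open>k - 1\<close>.\<close>

lemma le_bar_count_iff:
  assumes x: "cadlag x" and \<epsilon>: "0 < \<epsilon>" and t: "0 \<le> t" and k: "2 \<le> k"
  shows "k \<le> bar_count x t \<epsilon> \<longleftrightarrow> stage alternating x \<epsilon> (2 * (k - 1)) \<le> ereal t"
proof -
  let ?A = "{k. S_time x \<epsilon> k \<le> ereal t}"
  obtain n where n: "ereal t < stage alternating x \<epsilon> n"
    using stage_unbounded[OF x \<epsilon>, of alternating t] by (auto simp: power_abs)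
  have down: "i \<in> ?A" if "j \<in> ?A" "i \<le> j" for i j
    using that stage_mono[of "2 * i" "2 * j" alternating x \<epsilon>] by (auto simp: S_T_time_eq_stage)
  have "i < n" if "i \<in> ?A" for i
    using that n stage_mono[of n "2 * i" alternating x \<epsilon>]
    by (cases "n \<le> 2 * i") (auto simp: S_T_time_eq_stage)
  then have fin: "finite ?A" using finite_subset[of ?A "{..<n}"] by auto
  have "0 \<in> ?A" using t by (simp add: zero_ereal_def)
  then have Max: "Max ?A \<in> ?A" by (intro Max_in[OF fin]) blast
  have Max_iff: "i \<le> Max ?A \<longleftrightarrow> i \<in> ?A" for i
    using Max_ge[OF fin] down[OF Max] by blast
  have "path_range x t \<ge> \<epsilon>" if "1 \<in> ?A"
  proof -
    have S1: "stage alternating x \<epsilon> (Suc (Suc 0)) \<le> ereal t"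
      using that by (simp add: S_T_time_eq_stage numeral_2_eq_2 del: stage.simps)
    then have "stage alternating x \<epsilon> (Suc 0) < \<infinity>"
      using stage_mono[of "Suc 0" "Suc (Suc 0)" alternating x \<epsilon>] by (auto simp del: stage.simps)
    \<comment> \<open>The drawdown is completed strictly before the drawup that follows it; this
      supplies the strict inequality under which witnesses are available.\<close>
    from stage_less_Suc[OF x \<epsilon> this] S1 have "stage alternating x \<epsilon> (Suc 0) < ereal t"
      by (rule less_le_trans)
    then obtain v u where "0 \<le> v" "v \<le> u" "u < t" "\<epsilon> < \<bar>x v - x u\<bar>"
      using stage_alternating_le_imp[OF x] by blast
    then show ?thesis using path_range_ge[OF x, of v t u] by auto
  qed
  then have "k \<le> bar_count x t \<epsilon> \<longleftrightarrow> k - 1 \<le> Max ?A"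
    using k Max_iff[of 1] unfolding bar_count_def by auto
  then show ?thesis unfolding Max_iff by (simp add: S_T_time_eq_stage)
qed

lemma
  assumes x: "cadlag x" and t: "0 \<le> t" and k: "2 \<le> k"
  shows bar_length_nonneg: "0 \<le> bar_length x t k"
    and less_bar_length_iff: "\<And>e. 0 \<le> e \<Longrightarrow> e < bar_length x t k \<longleftrightarrow>
      (\<exists>\<epsilon>>e. stage alternating x \<epsilon> (2 * (k - 1)) \<le> ereal t)"
proof -
  let ?A = "insert 0 {\<epsilon>. \<epsilon> > 0 \<and> k \<le> bar_count x t \<epsilon>}"
  \<comment> \<open>The witnesses of a crossing come from a strict inequality, whereas the stage is
    only known to be at most \<open>t\<close>. They are therefore found before \<open>t + 1\<close>,
    and the bound is taken on that larger interval.\<close>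
  obtain B where B: "\<forall>v\<in>{0..t + 1}. \<bar>x v\<bar> \<le> B"
    using cadlag_bounded[OF x] by blast
  have "\<epsilon> \<le> 2 * B" if "\<epsilon> \<in> ?A" for \<epsilon>
  proof (cases "\<epsilon> = 0")
    case True
    then show ?thesis using B t by force
  next
    case False
    then have "0 < \<epsilon>" "k \<le> bar_count x t \<epsilon>" using that by auto
    then have "stage alternating x \<epsilon> (Suc (2 * (k - 1) - 1)) \<le> ereal t"
      using le_bar_count_iff[OF x _ t k, of \<epsilon>] k by (simp del: stage.simps)
    also have "ereal t < ereal (t + 1)" by simp
    finally obtain v u where "0 \<le> v" "v \<le> u" "u < t + 1" "\<epsilon> < \<bar>x v - x u\<bar>"
      using stage_alternating_le_imp[OF x] by blast
    moreover from this have "\<bar>x v\<bar> \<le> B" "\<bar>x u\<bar> \<le> B" using B by auto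
    ultimately show ?thesis by linarith
  qed
  then have bdd: "bdd_above ?A" by (rule bdd_aboveI)
  show "0 \<le> bar_length x t k"
    unfolding bar_length_def by (rule cSup_upper[OF _ bdd]) simp
  fix e :: real assume "0 \<le> e"
  have "e < bar_length x t k \<longleftrightarrow> (\<exists>\<epsilon>\<in>?A. e < \<epsilon>)"
    unfolding bar_length_def by (rule less_cSup_iff[OF _ bdd]) simp
  also have "\<dots> \<longleftrightarrow> (\<exists>\<epsilon>>e. stage alternating x \<epsilon> (2 * (k - 1)) \<le> ereal t)"
    using \<open>0 \<le> e\<close> le_bar_count_iff[OF x _ t k] by (auto simp del: stage.simps) (meson le_less_trans)+
  finally show "e < bar_length x t k \<longleftrightarrow> \<dots>" .
qed

section \<open>Strong Markov property via random walks\<close>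

lemma grid_stage_measurable [measurable]:
  assumes [measurable]: "\<And>i. (\<lambda>x. w x i) \<in> borel_measurable K"
  shows "Measurable.pred K (\<lambda>x. grid_stage c (w x) \<epsilon> n m)"
  by (induction n arbitrary: m) (auto intro!: measurable)

text \<open>Adaptedness in discrete form: it places the event of a completed stage in the past of
  the walk.\<close>

lemma grid_stage_cong:
  "(\<And>i. i \<le> m \<Longrightarrow> w i = w' i) \<Longrightarrow> grid_stage c w \<epsilon> n m = grid_stage c w' \<epsilon> n m"
proof (induction n arbitrary: m)
  case (Suc n)
  have "(v \<le> u \<and> u \<le> m \<and> grid_stage c w \<epsilon> n v \<and> \<epsilon> < c n * (w v - w u)) =
      (v \<le> u \<and> u \<le> m \<and> grid_stage c w' \<epsilon> n v \<and> \<epsilon> < c n * (w' v - w' u))" for u v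
    using Suc.IH[of v] Suc.prems[of u] Suc.prems[of v] Suc.prems by (cases "v \<le> u \<and> u \<le> m") auto
  then show ?case by simp
qed simp

text \<open>Only differences of values enter. This removes \<open>X 0\<close> and lets the walk
  restart from whatever level it has reached.\<close>

lemma grid_stage_translate: "grid_stage c (\<lambda>i. w i + a) \<epsilon> n m = grid_stage c w \<epsilon> n m"
  by (induction n arbitrary: m) auto

section \<open>First grid times of a stage and their renewal structure\<close>

definition first_grid_stage :: "(nat \<Rightarrow> real) \<Rightarrow> (nat \<Rightarrow> real) \<Rightarrow> real \<Rightarrow> nat \<Rightarrow> nat \<Rightarrow> bool" where
  "first_grid_stage c w \<epsilon> n m \<longleftrightarrow> grid_stage c w \<epsilon> n m \<and> (\<forall>i<m. \<not> grid_stage c w \<epsilon> n i)"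

lemma first_grid_stage_measurable [measurable]:
  assumes [measurable]: "\<And>i. (\<lambda>x. w x i) \<in> borel_measurable K"
  shows "Measurable.pred K (\<lambda>x. first_grid_stage c (w x) \<epsilon> n m)"
  unfolding first_grid_stage_def by measurable

lemma first_grid_stage_cong:
  assumes "\<And>i. i \<le> m \<Longrightarrow> w i = w' i"
  shows "first_grid_stage c w \<epsilon> n m = first_grid_stage c w' \<epsilon> n m"
proof -
  have "grid_stage c w \<epsilon> n i = grid_stage c w' \<epsilon> n i" if "i \<le> m" for i
    using that assms by (intro grid_stage_cong) auto
  then show ?thesis unfolding first_grid_stage_def by auto
qed

lemma first_grid_stage_translate:
  "first_grid_stage c (\<lambda>i. w i + a) \<epsilon> n m = first_grid_stage c w \<epsilon> n m"
  unfolding first_grid_stage_def grid_stage_translate ..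

lemma first_grid_stage_unique:
  "first_grid_stage c w \<epsilon> n m \<Longrightarrow> first_grid_stage c w \<epsilon> n m' \<Longrightarrow> m = m'"
  unfolding first_grid_stage_def by (metis linorder_neqE_nat)

lemma grid_stage_imp_first:
  "grid_stage c w \<epsilon> n m \<Longrightarrow> \<exists>i\<le>m. first_grid_stage c w \<epsilon> n i"
  unfolding first_grid_stage_def
  by (rule exI[of _ "LEAST i. grid_stage c w \<epsilon> n i"])
    (auto intro: LeastI Least_le dest: not_less_Least)

text \<open>Completion of a stage is monotone in time, so a first time \<open>m\<close> says that
  stage \<open>n\<close> is complete exactly from \<open>m\<close> on. The next stage is then a
  first stage of the sequence seen from \<open>m\<close>.\<close>

lemma grid_stage_Suc_iff_shift:
  assumes "first_grid_stage c w \<epsilon> n m"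
  shows "grid_stage c w \<epsilon> (Suc n) l \<longleftrightarrow>
    m \<le> l \<and> grid_stage (\<lambda>_. c n) (\<lambda>i. w (m + i)) \<epsilon> (Suc 0) (l - m)"
proof -
  have iff: "grid_stage c w \<epsilon> n v \<longleftrightarrow> m \<le> v" for v
    using assms grid_stage_mono[of c w \<epsilon> n m v] unfolding first_grid_stage_def
    by (cases "m \<le> v") auto
  show ?thesis
  proof
    assume "grid_stage c w \<epsilon> (Suc n) l"
    then obtain v u where "m \<le> v" "v \<le> u" "u \<le> l" "\<epsilon> < c n * (w v - w u)"
      by (auto simp: iff)
    then have "v - m \<le> u - m" "u - m \<le> l - m" "\<epsilon> < c n * (w (m + (v - m)) - w (m + (u - m)))"
      "m \<le> l" by auto
    then show "m \<le> l \<and> grid_stage (\<lambda>_. c n) (\<lambda>i. w (m + i)) \<epsilon> (Suc 0) (l - m)"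
      unfolding grid_stage.simps by blast
  next
    assume "m \<le> l \<and> grid_stage (\<lambda>_. c n) (\<lambda>i. w (m + i)) \<epsilon> (Suc 0) (l - m)"
    then obtain v u where "m \<le> l" "v \<le> u" "u \<le> l - m" "\<epsilon> < c n * (w (m + v) - w (m + u))"
      by auto
    then show "grid_stage c w \<epsilon> (Suc n) l"
      unfolding grid_stage.simps iff by (intro exI[of _ "m + v"] exI[of _ "m + u"]) auto
  qed
qed

text \<open>The deterministic half of the strong Markov property: a decomposition according to the
  first time of the preceding stage.\<close>

lemma first_grid_stage_Suc:
  "first_grid_stage c w \<epsilon> (Suc n) l \<longleftrightarrow> (\<exists>m\<le>l. first_grid_stage c w \<epsilon> n m \<and>
     first_grid_stage (\<lambda>_. c n) (\<lambda>i. w (m + i)) \<epsilon> (Suc 0) (l - m))"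
proof -
  have *: "first_grid_stage c w \<epsilon> (Suc n) l \<longleftrightarrow>
      m \<le> l \<and> first_grid_stage (\<lambda>_. c n) (\<lambda>i. w (m + i)) \<epsilon> (Suc 0) (l - m)"
    if m: "first_grid_stage c w \<epsilon> n m" for m
  proof -
    have "(\<forall>i<l. \<not> (m \<le> i \<and> P (i - m))) \<longleftrightarrow> (\<forall>i<l - m. \<not> P i)" if "m \<le> l" for P
    proof (intro iffI allI impI)
      fix i assume "\<forall>i<l. \<not> (m \<le> i \<and> P (i - m))" "i < l - m"
      then show "\<not> P i" by (auto dest!: spec[of _ "m + i"])
    next
      fix i assume "\<forall>i<l - m. \<not> P i" "i < l"
      then show "\<not> (m \<le> i \<and> P (i - m))" by (auto dest!: spec[of _ "i - m"])
    qed
    then show ?thesis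
      unfolding first_grid_stage_def grid_stage_Suc_iff_shift[OF m] by blast
  qed
  have "\<exists>m. first_grid_stage c w \<epsilon> n m" if "first_grid_stage c w \<epsilon> (Suc n) l"
    using that grid_stage_imp_first unfolding first_grid_stage_def[of c w \<epsilon> "Suc n"] by fastforce
  then show ?thesis using * by blast
qed

definition walk :: "(nat \<Rightarrow> real) \<Rightarrow> nat \<Rightarrow> real" where
  "walk d i = (\<Sum>l<i. d l)"

lemma walk_measurable [measurable]:
  "(\<lambda>d. walk d i) \<in> borel_measurable (PiM UNIV (\<lambda>_. borel))"
  unfolding walk_def by measurable

lemma walk_add: "walk d (m + i) = walk (\<lambda>i. d (m + i)) i + walk d m"
  unfolding walk_def by (induction i) (auto simp: add_ac)

definition kill_exp :: "real \<Rightarrow> ereal \<Rightarrow> real" where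
  "kill_exp \<epsilon> \<tau> = (if \<tau> = \<infinity> then 0 else exp (- \<epsilon> * real_of_ereal \<tau>))"

lemma laplace_eq: "laplace N U \<epsilon> = (LINT \<omega>|N. kill_exp \<epsilon> (U \<omega>))"
  unfolding laplace_def kill_exp_def ..

lemma kill_exp_measurable [measurable]: "kill_exp \<epsilon> \<in> borel_measurable borel"
  unfolding kill_exp_def by measurable

lemma grid_size: "0 < 1 / real (Suc N)" "(\<lambda>N. 1 / real (Suc N)) \<longlonglongrightarrow> 0"
  using LIMSEQ_inverse_real_of_nat by (auto simp: inverse_eq_divide)

text \<open>A crossing before \<open>q\<close> is decided by countably many grid values. This gives
  measurability on \<open>M\<close> and, later, an event of the product space to which
  self-similarity can be applied.\<close>

lemma stage_less_iff_grid:
  assumes "cadlag x" "0 < \<epsilon>" and h: "\<And>N. 0 < h N" "h \<longlonglongrightarrow> 0"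
  shows "stage c x \<epsilon> n < ereal q \<longleftrightarrow>
    (\<exists>N m. h N * real m < q \<and> grid_stage c (\<lambda>i. x (h N * real i)) \<epsilon> n m)"
proof
  assume "stage c x \<epsilon> n < ereal q"
  from stage_less_grid[OF assms(1) assms(2) h this]
  show "\<exists>N m. h N * real m < q \<and> grid_stage c (\<lambda>i. x (h N * real i)) \<epsilon> n m"
    unfolding eventually_sequentially by blast
next
  assume "\<exists>N m. h N * real m < q \<and> grid_stage c (\<lambda>i. x (h N * real i)) \<epsilon> n m"
  then obtain N m where "h N * real m < q" "grid_stage c (\<lambda>i. x (h N * real i)) \<epsilon> n m"
    by blast
  from stage_le_grid[OF assms(1) h(1) this(2)] this(1)
  show "stage c x \<epsilon> n < ereal q"
    by (auto intro: le_less_trans)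
qed

lemma kill_exp_bounds:
  assumes "0 \<le> r" "0 \<le> \<tau>"
  shows "0 \<le> kill_exp r \<tau>" "kill_exp r \<tau> \<le> 1"
  using assms by (cases \<tau>; simp add: kill_exp_def)+

lemma kill_exp_add:
  assumes "0 \<le> a" "0 \<le> b"
  shows "kill_exp r (a + b) = kill_exp r a * kill_exp r b"
proof (cases "a = \<infinity> \<or> b = \<infinity>")
  case True
  then show ?thesis by (auto simp: kill_exp_def)
next
  case False
  then obtain x y where xy: "a = ereal x" "b = ereal y"
    using assms by (cases a; cases b) auto
  have "exp (- r * (x + y)) = exp (- r * x) * exp (- r * y)"
    by (subst exp_add[symmetric]) (simp only: distrib_left)
  then show ?thesis by (simp add: xy kill_exp_def)
qed

section \<open>Random walks embedded in a Levy process\<close>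

locale levy =
  fixes M :: "'a measure" and X :: "real \<Rightarrow> 'a \<Rightarrow> real"
  assumes levy: "levy_process M X"
begin

sublocale prob_space M
  using levy unfolding levy_process_def by blast

lemma X_measurable [measurable]: "0 \<le> s \<Longrightarrow> X s \<in> borel_measurable M"
  using levy unfolding levy_process_def by blast

lemma cadlag_path: "\<omega> \<in> space M \<Longrightarrow> cadlag (\<lambda>s. X s \<omega>)"
  using levy unfolding levy_process_def by blast

lemma stage_measurable [measurable]:
  assumes "0 < \<epsilon>"
  shows "(\<lambda>\<omega>. stage c (\<lambda>s. X s \<omega>) \<epsilon> n) \<in> borel_measurable M"
proof -
  have less: "{\<omega>\<in>space M. stage c (\<lambda>s. X s \<omega>) \<epsilon> n < ereal q} \<in> sets M" for q
  proof -
    have "{\<omega>\<in>space M. \<exists>N m. 1 / real (Suc N) * real m < q \<and>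
        grid_stage c (\<lambda>i. X (1 / real (Suc N) * real i) \<omega>) \<epsilon> n m} \<in> sets M"
      by measurable
    moreover have "{\<omega>\<in>space M. stage c (\<lambda>s. X s \<omega>) \<epsilon> n < ereal q} = {\<omega>\<in>space M. \<exists>N m. 1 / real (Suc N) * real m < q \<and>
        grid_stage c (\<lambda>i. X (1 / real (Suc N) * real i) \<omega>) \<epsilon> n m}"
      by (rule Collect_cong) (rule conj_cong[OF refl], rule stage_less_iff_grid[OF cadlag_path assms grid_size])
    ultimately show ?thesis by (simp only:)
  qed
  show ?thesis
  proof (rule borel_measurableI_less)
    fix y :: ereal
    show "{\<omega>\<in>space M. stage c (\<lambda>s. X s \<omega>) \<epsilon> n < y} \<in> sets M"
    proof (cases y)
      case PInf
      have "{\<omega>\<in>space M. stage c (\<lambda>s. X s \<omega>) \<epsilon> n < y} =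
          (\<Union>k::nat. {\<omega>\<in>space M. stage c (\<lambda>s. X s \<omega>) \<epsilon> n < ereal k})"
        unfolding PInf by (auto simp flip: less_PInf_Ex_of_nat)
      also have "\<dots> \<in> sets M" using less by (intro sets.countable_UN) auto
      finally show ?thesis .
    qed (use less in auto)
  qed
qed

definition inc :: "real \<Rightarrow> 'a \<Rightarrow> nat \<Rightarrow> real" where
  "inc h \<omega> i = X (h * real (Suc i)) \<omega> - X (h * real i) \<omega>"

lemma inc_measurable [measurable]: "0 \<le> h \<Longrightarrow> (\<lambda>\<omega>. inc h \<omega> i) \<in> borel_measurable M"
  unfolding inc_def by (intro borel_measurable_diff X_measurable) auto

lemma walk_inc: "walk (inc h \<omega>) i + X 0 \<omega> = X (h * real i) \<omega>"
  by (induction i) (auto simp: walk_def inc_def)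

text \<open>Independence of an infinite family is that of its finite subfamilies, and each of these
  sits inside an initial segment, for which \<open>levy_process\<close> provides it. The offset
  \<open>m\<close> is absorbed into the choice of the times.\<close>

lemma indep_inc:
  assumes "0 \<le> h"
  shows "indep_vars (\<lambda>_. borel) (\<lambda>i \<omega>. inc h \<omega> (m + i)) UNIV"
proof -
  have *: "indep_vars (\<lambda>_. borel) (\<lambda>i \<omega>. inc h \<omega> (m + i)) {..<n}" for n
  proof -
    define \<tau> where "\<tau> i = h * real (m + i)" for i
    have "0 \<le> \<tau> 0 \<and> mono \<tau>"
      using assms by (auto simp: \<tau>_def mono_def intro!: mult_left_mono)
    then have "indep_vars (\<lambda>_. borel) (\<lambda>i \<omega>. X (\<tau> (Suc i)) \<omega> - X (\<tau> i) \<omega>) {..<n}"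
      using levy unfolding levy_process_def by blast
    then show ?thesis by (simp add: inc_def \<tau>_def)
  qed
  show ?thesis
    unfolding indep_vars_def2
  proof (intro conjI ballI)
    show "indep_sets (\<lambda>i. {(\<lambda>\<omega>. inc h \<omega> (m + i)) -` A \<inter> space M |A. A \<in> sets borel}) UNIV"
    proof (subst indep_sets_finite_index_sets, intro allI impI)
      fix J :: "nat set" assume "finite J"
      then obtain n where "J \<subseteq> {..<n}" using finite_nat_bounded by blast
      then show "indep_sets (\<lambda>i. {(\<lambda>\<omega>. inc h \<omega> (m + i)) -` A \<inter> space M |A. A \<in> sets borel}) J"
        using *[of n] unfolding indep_vars_def2 by (blast intro: indep_sets_mono_index)
    qed
  qed (use assms in measurable)
qed

lemma distr_inc: "0 \<le> h \<Longrightarrow> distr M borel (\<lambda>\<omega>. inc h \<omega> i) = distr M borel (X h)"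
proof -
  assume "0 \<le> h"
  then have "distr M borel (\<lambda>\<omega>. X (h * real i + h) \<omega> - X (h * real i) \<omega>) = distr M borel (X h)"
    using levy unfolding levy_process_def by simp
  then show ?thesis by (simp add: inc_def algebra_simps)
qed

text \<open>By independence and stationarity the increments form an i.i.d. sequence whose law does
  not involve \<open>m\<close>, which is what allows a fresh start after \<open>m\<close>
  steps.\<close>

lemma distr_inc_shift:
  assumes h: "0 \<le> h"
  shows "distr M (PiM UNIV (\<lambda>_. borel)) (\<lambda>\<omega> i. inc h \<omega> (m + i)) =
    PiM UNIV (\<lambda>_. distr M borel (X h))"
proof -
  have "distr M (PiM UNIV (\<lambda>_. borel)) (\<lambda>\<omega>. \<lambda>i\<in>UNIV. inc h \<omega> (m + i)) =
      PiM UNIV (\<lambda>i. distr M borel (\<lambda>\<omega>. inc h \<omega> (m + i)))"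
    by (rule indep_vars_iff_distr_eq_PiM[THEN iffD1]) (use h indep_inc in auto)
  then show ?thesis by (simp add: distr_inc[OF h] restrict_UNIV)
qed

lemma inc_seq_measurable [measurable]:
  "0 \<le> h \<Longrightarrow> (\<lambda>\<omega> i. inc h \<omega> (m + i)) \<in> measurable M (PiM UNIV (\<lambda>_. borel))"
  by (rule measurable_PiM_single') auto

lemma prob_inc_shift:
  assumes h: "0 \<le> h" and Q [measurable]: "Measurable.pred (PiM UNIV (\<lambda>_. borel)) Q"
  shows "prob {\<omega>\<in>space M. Q (\<lambda>i. inc h \<omega> (m + i))} = prob {\<omega>\<in>space M. Q (inc h \<omega>)}"
proof -
  have *: "prob {\<omega>\<in>space M. Q (\<lambda>i. inc h \<omega> (m + i))} =
      measure (PiM UNIV (\<lambda>_. distr M borel (X h))) {d. Q d}" for m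
    unfolding distr_inc_shift[OF h, of m, symmetric]
    by (subst measure_distr) (use h Q in \<open>auto simp: vimage_def Int_def conj_commute
      space_PiM pred_def intro!: arg_cong[where f=prob]\<close>)
  show ?thesis using *[of m] *[of 0] by simp
qed

text \<open>The elementary Markov property at the fixed step \<open>m\<close>: the first
  \<open>m\<close> increments are independent of the later ones, and the later ones have the law of
  the whole sequence.\<close>

lemma prob_inc_indep:
  assumes h: "0 \<le> h"
    and P [measurable]: "Measurable.pred (PiM UNIV (\<lambda>_. borel)) P"
    and Q [measurable]: "Measurable.pred (PiM UNIV (\<lambda>_. borel)) Q"
    and past: "\<And>d d'. (\<And>i. i < m \<Longrightarrow> d i = d' i) \<Longrightarrow> P d = P d'"
  shows "prob {\<omega>\<in>space M. P (inc h \<omega>) \<and> Q (\<lambda>i. inc h \<omega> (m + i))} =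
    prob {\<omega>\<in>space M. P (inc h \<omega>)} * prob {\<omega>\<in>space M. Q (inc h \<omega>)}"
proof -
  let ?B = "\<lambda>_::nat. borel :: real measure"
  \<comment> \<open>\<open>P\<close> expects a full sequence, so the past is padded with zeros; by
    \<open>past\<close> the padding does not affect the value of \<open>P\<close>.\<close>
  define p where "p d = (\<lambda>i. if i < m then d i else 0)" for d :: "nat \<Rightarrow> real"
  define s where "s d = (\<lambda>i. d (m + i))" for d :: "nat \<Rightarrow> real"
  have "(\<lambda>d. if i < m then d i else 0) \<in> borel_measurable (PiM {..<m} ?B)" for i
    by (cases "i < m") (auto simp: measurable_component_singleton)
  then have [measurable]: "p \<in> measurable (PiM {..<m} ?B) (PiM UNIV ?B)"
    unfolding p_def by (intro measurable_PiM_single') auto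
  have [measurable]: "s \<in> measurable (PiM {m..} ?B) (PiM UNIV ?B)"
    unfolding s_def by (rule measurable_PiM_single') (auto simp: measurable_component_singleton)
  have "indep_vars ?B (\<lambda>i \<omega>. inc h \<omega> i) UNIV"
    using indep_inc[OF h, of 0] by simp
  then have "indep_var (PiM {..<m} ?B) (\<lambda>\<omega>. restrict (inc h \<omega>) {..<m})
      (PiM {m..} ?B) (\<lambda>\<omega>. restrict (inc h \<omega>) {m..})"
    by (rule indep_var_restrict) auto
  then have "indep_var (PiM UNIV ?B) (p \<circ> (\<lambda>\<omega>. restrict (inc h \<omega>) {..<m}))
      (PiM UNIV ?B) (s \<circ> (\<lambda>\<omega>. restrict (inc h \<omega>) {m..}))"
    by (rule indep_var_compose) auto
  from indep_varD[OF this, of "{d. P d}" "{d. Q d}"] P Q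
  have "prob ((\<lambda>\<omega>. (p (restrict (inc h \<omega>) {..<m}), s (restrict (inc h \<omega>) {m..}))) -` ({d. P d} \<times> {d. Q d}) \<inter> space M) =
     prob ((\<lambda>\<omega>. p (restrict (inc h \<omega>) {..<m})) -` {d. P d} \<inter> space M) *
     prob ((\<lambda>\<omega>. s (restrict (inc h \<omega>) {m..})) -` {d. Q d} \<inter> space M)"
    by (simp add: pred_def space_PiM comp_def)
  moreover have "P (p (restrict (inc h \<omega>) {..<m})) = P (inc h \<omega>)" for \<omega>
    by (rule past) (simp add: p_def)
  moreover have "s (restrict (inc h \<omega>) {m..}) = (\<lambda>i. inc h \<omega> (m + i))" for \<omega>
    by (auto simp: s_def)
  ultimately show ?thesis
    by (simp add: vimage_def Int_def conj_commute prob_inc_shift[OF h Q])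
qed

section \<open>The strong Markov property on a grid\<close>

definition grid_prob :: "(nat \<Rightarrow> real) \<Rightarrow> real \<Rightarrow> real \<Rightarrow> nat \<Rightarrow> nat \<Rightarrow> real" where
  "grid_prob c \<epsilon> h n m = prob {\<omega>\<in>space M. first_grid_stage c (\<lambda>i. X (h * real i) \<omega>) \<epsilon> n m}"

lemma first_grid_stage_walk:
  "first_grid_stage c (\<lambda>i. X (h * real i) \<omega>) \<epsilon> n m = first_grid_stage c (walk (inc h \<omega>)) \<epsilon> n m"
  unfolding walk_inc[symmetric] first_grid_stage_translate ..

lemma grid_X_measurable [measurable]:
  "0 \<le> h \<Longrightarrow> (\<lambda>\<omega>. X (h * real i) \<omega>) \<in> borel_measurable M"
  by simp

text \<open>For each possible first time \<open>m\<close> of stage \<open>n\<close>, that event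
  depends on the first \<open>m\<close> increments and the remaining wait on the later ones, so the
  probability factors. The events for different \<open>m\<close> are disjoint, which makes the law
  of the first time a convolution.\<close>

lemma grid_prob_Suc:
  assumes h: "0 \<le> h"
  shows "grid_prob c \<epsilon> h (Suc n) l =
    (\<Sum>m\<le>l. grid_prob c \<epsilon> h n m * grid_prob (\<lambda>_. c n) \<epsilon> h (Suc 0) (l - m))"
proof -
  note [measurable] = h
  let ?E = "\<lambda>m. {\<omega>\<in>space M. first_grid_stage c (walk (inc h \<omega>)) \<epsilon> n m \<and>
     first_grid_stage (\<lambda>_. c n) (walk (\<lambda>i. inc h \<omega> (m + i))) \<epsilon> (Suc 0) (l - m)}"
  have walk_shift: "first_grid_stage (\<lambda>_. c n) (\<lambda>i. walk d (m + i)) \<epsilon> (Suc 0) (l - m) =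
      first_grid_stage (\<lambda>_. c n) (walk (\<lambda>i. d (m + i))) \<epsilon> (Suc 0) (l - m)" for d m
    unfolding walk_add first_grid_stage_translate ..
  have [measurable]: "0 \<le> h \<Longrightarrow> (\<lambda>\<omega>. walk (\<lambda>i. inc h \<omega> (m + i)) j) \<in> borel_measurable M" for m j
    unfolding walk_def by measurable
  have [measurable]: "0 \<le> h \<Longrightarrow> (\<lambda>\<omega>. walk (inc h \<omega>) j) \<in> borel_measurable M" for j
    unfolding walk_def by measurable
  have E: "?E m \<in> sets M" for m
    by measurable
  have iff: "first_grid_stage c (walk (inc h \<omega>)) \<epsilon> (Suc n) l \<longleftrightarrow>
      (\<exists>m\<le>l. first_grid_stage c (walk (inc h \<omega>)) \<epsilon> n m \<and>
        first_grid_stage (\<lambda>_. c n) (walk (\<lambda>i. inc h \<omega> (m + i))) \<epsilon> (Suc 0) (l - m))" for \<omega>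
    by (rule trans[OF first_grid_stage_Suc]) (simp only: walk_shift)
  have "{\<omega>\<in>space M. first_grid_stage c (walk (inc h \<omega>)) \<epsilon> (Suc n) l} = (\<Union>m\<in>{..l}. ?E m)"
    using iff by auto
  moreover have "disjoint_family_on ?E {..l}"
    unfolding disjoint_family_on_def using first_grid_stage_unique by blast
  ultimately have "grid_prob c \<epsilon> h (Suc n) l = (\<Sum>m\<le>l. prob (?E m))"
    unfolding grid_prob_def first_grid_stage_walk
    using E by (simp add: finite_measure_finite_Union image_subset_iff)
  moreover have "prob (?E m) = grid_prob c \<epsilon> h n m * grid_prob (\<lambda>_. c n) \<epsilon> h (Suc 0) (l - m)" for m
    unfolding grid_prob_def first_grid_stage_walk
  proof (rule prob_inc_indep[OF h])
    fix d d' :: "nat \<Rightarrow> real" assume "\<And>i. i < m \<Longrightarrow> d i = d' i"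
    then show "first_grid_stage c (walk d) \<epsilon> n m = first_grid_stage c (walk d') \<epsilon> n m"
      by (intro first_grid_stage_cong) (auto simp: walk_def intro: sum.cong)
  qed measurable
  ultimately show ?thesis by simp
qed

definition grid_laplace :: "(nat \<Rightarrow> real) \<Rightarrow> real \<Rightarrow> real \<Rightarrow> nat \<Rightarrow> real \<Rightarrow> real" where
  "grid_laplace c \<epsilon> h n r = (\<Sum>m. grid_prob c \<epsilon> h n m * exp (- r * (h * real m)))"

lemma grid_prob_sums:
  assumes h: "0 \<le> h"
  shows "grid_prob c \<epsilon> h n sums prob (\<Union>m. {\<omega>\<in>space M. first_grid_stage c (\<lambda>i. X (h * real i) \<omega>) \<epsilon> n m})"
  unfolding grid_prob_def
proof (rule finite_measure_UNION)
  note [measurable] = h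
  show "range (\<lambda>m. {\<omega>\<in>space M. first_grid_stage c (\<lambda>i. X (h * real i) \<omega>) \<epsilon> n m}) \<subseteq> events"
    by (intro image_subsetI) (use h in measurable)
  show "disjoint_family (\<lambda>m. {\<omega>\<in>space M. first_grid_stage c (\<lambda>i. X (h * real i) \<omega>) \<epsilon> n m})"
    unfolding disjoint_family_on_def using first_grid_stage_unique by blast
qed

lemma grid_laplace_summable:
  assumes h: "0 \<le> h" and "0 \<le> r"
  shows "summable (\<lambda>m. norm (grid_prob c \<epsilon> h n m * exp (- r * (h * real m))))"
proof (rule summable_comparison_test'[OF sums_summable[OF grid_prob_sums[OF h]]])
  fix m :: nat
  have "0 \<le> grid_prob c \<epsilon> h n m" by (simp add: grid_prob_def)
  moreover have "exp (- r * (h * real m)) \<le> 1" using assms by simp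
  ultimately show "norm (norm (grid_prob c \<epsilon> h n m * exp (- r * (h * real m)))) \<le> grid_prob c \<epsilon> h n m"
    by (simp add: mult_left_le)
qed

text \<open>The exponential weights split along \<open>m + (l - m) = l\<close>, so the convolution
  becomes a Cauchy product of absolutely convergent series.\<close>

lemma grid_laplace_Suc:
  assumes h: "0 \<le> h" and r: "0 \<le> r"
  shows "grid_laplace c \<epsilon> h (Suc n) r =
    grid_laplace c \<epsilon> h n r * grid_laplace (\<lambda>_. c n) \<epsilon> h (Suc 0) r"
proof -
  let ?a = "\<lambda>m. grid_prob c \<epsilon> h n m * exp (- r * (h * real m))"
  let ?b = "\<lambda>m. grid_prob (\<lambda>_. c n) \<epsilon> h (Suc 0) m * exp (- r * (h * real m))"
  have "(\<lambda>l. \<Sum>m\<le>l. ?a m * ?b (l - m)) sums ((\<Sum>m. ?a m) * (\<Sum>m. ?b m))"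
    by (intro Cauchy_product_sums grid_laplace_summable assms)
  moreover have "(\<Sum>m\<le>l. ?a m * ?b (l - m)) = grid_prob c \<epsilon> h (Suc n) l * exp (- r * (h * real l))" for l
    unfolding grid_prob_Suc[OF h, of c _ n] sum_distrib_right
    by (rule sum.cong) (auto simp: of_nat_diff exp_add[symmetric] algebra_simps)
  ultimately have "(\<lambda>l. grid_prob c \<epsilon> h (Suc n) l * exp (- r * (h * real l))) sums
      ((\<Sum>m. ?a m) * (\<Sum>m. ?b m))"
    by (simp only:)
  then show ?thesis
    unfolding grid_laplace_def by (rule sums_unique[symmetric])
qed

text \<open>The pathwise integrand behind \<open>grid_laplace\<close>. At most one summand is
  nonzero, namely the one at the first grid time; the series form yields measurability and the
  exchange with the integral, with value 0 if the stage is never completed.\<close>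

definition grid_kill :: "(nat \<Rightarrow> real) \<Rightarrow> real \<Rightarrow> real \<Rightarrow> nat \<Rightarrow> real \<Rightarrow> 'a \<Rightarrow> real" where
  "grid_kill c \<epsilon> h n r \<omega> =
     (\<Sum>m. indicator {\<omega>\<in>space M. first_grid_stage c (\<lambda>i. X (h * real i) \<omega>) \<epsilon> n m} \<omega> * exp (- r * (h * real m)))"

lemma grid_kill_first:
  assumes "\<omega> \<in> space M" "first_grid_stage c (\<lambda>i. X (h * real i) \<omega>) \<epsilon> n m"
  shows "grid_kill c \<epsilon> h n r \<omega> = exp (- r * (h * real m))"
proof -
  have "first_grid_stage c (\<lambda>i. X (h * real i) \<omega>) \<epsilon> n i \<longleftrightarrow> i = m" for i
    using first_grid_stage_unique[OF _ assms(2)] assms(2) by blast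
  then have eq: "(\<lambda>i. indicator {\<omega>\<in>space M. first_grid_stage c (\<lambda>i. X (h * real i) \<omega>) \<epsilon> n i} \<omega> * exp (- r * (h * real i)))
     = (\<lambda>i. if i = m then exp (- r * (h * real i)) else 0)"
    using assms(1) by (simp add: indicator_def fun_eq_iff)
  show ?thesis
    unfolding grid_kill_def eq by (rule sums_unique[OF sums_single, symmetric])
qed

lemma grid_kill_none:
  assumes "\<And>m. \<not> grid_stage c (\<lambda>i. X (h * real i) \<omega>) \<epsilon> n m"
  shows "grid_kill c \<epsilon> h n r \<omega> = 0"
  using assms unfolding grid_kill_def first_grid_stage_def by simp

lemma grid_kill_bounds:
  assumes "0 \<le> h" "0 \<le> r" "\<omega> \<in> space M"
  shows "0 \<le> grid_kill c \<epsilon> h n r \<omega>" "grid_kill c \<epsilon> h n r \<omega> \<le> 1"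
proof -
  have "0 \<le> grid_kill c \<epsilon> h n r \<omega> \<and> grid_kill c \<epsilon> h n r \<omega> \<le> 1"
  proof (cases "\<exists>m. first_grid_stage c (\<lambda>i. X (h * real i) \<omega>) \<epsilon> n m")
    case True
    then show ?thesis using assms by (auto simp: grid_kill_first)
  next
    case False
    then have "grid_kill c \<epsilon> h n r \<omega> = 0"
      by (intro grid_kill_none) (use grid_stage_imp_first in blast)
    then show ?thesis by simp
  qed
  then show "0 \<le> grid_kill c \<epsilon> h n r \<omega>" "grid_kill c \<epsilon> h n r \<omega> \<le> 1" by auto
qed

lemma grid_kill_measurable [measurable]:
  assumes [measurable]: "0 \<le> h"
  shows "grid_kill c \<epsilon> h n r \<in> borel_measurable M"
  unfolding grid_kill_def by measurable

lemma grid_laplace_eq: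
  assumes h: "0 \<le> h" and r: "0 \<le> r"
  shows "(LINT \<omega>|M. grid_kill c \<epsilon> h n r \<omega>) = grid_laplace c \<epsilon> h n r"
proof -
  note [measurable] = h
  let ?E = "\<lambda>m. {\<omega>\<in>space M. first_grid_stage c (\<lambda>i. X (h * real i) \<omega>) \<epsilon> n m}"
  let ?f = "\<lambda>m \<omega>. indicator (?E m) \<omega> * exp (- r * (h * real m))"
  have E: "?E m \<in> sets M" for m by measurable
  have int: "(LINT \<omega>|M. ?f m \<omega>) = grid_prob c \<epsilon> h n m * exp (- r * (h * real m))" for m
    unfolding grid_prob_def using E by simp
  have "(LINT \<omega>|M. grid_kill c \<epsilon> h n r \<omega>) = (\<Sum>m. LINT \<omega>|M. ?f m \<omega>)"
    unfolding grid_kill_def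
  proof (rule integral_suminf)
    show "integrable M (?f m)" for m
      using E by (intro integrable_mult_left integrable_real_indicator) (auto simp: emeasure_eq_measure)
    show "AE \<omega> in M. summable (\<lambda>m. norm (?f m \<omega>))"
    proof (rule AE_I2)
      fix \<omega>
      have "finite {m. ?f m \<omega> \<noteq> 0}"
      proof (cases "\<exists>m. \<omega> \<in> ?E m")
        case True
        then obtain m where "\<omega> \<in> ?E m" by blast
        then have "{m. ?f m \<omega> \<noteq> 0} \<subseteq> {m}"
          using first_grid_stage_unique by (auto simp: indicator_def split: if_splits)
        then show ?thesis by (rule finite_subset) simp
      qed auto
      then show "summable (\<lambda>m. norm (?f m \<omega>))"
        by (intro summable_finite[of "{m. ?f m \<omega> \<noteq> 0}"]) auto
    qed
    have "norm (?f m \<omega>) = ?f m \<omega>" for m \<omega> by simp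
    then show "summable (\<lambda>m. LINT \<omega>|M. norm (?f m \<omega>))"
      using summable_norm_cancel[OF grid_laplace_summable[OF h r, of c \<epsilon> n]] by (simp only: int)
  qed
  then show ?thesis unfolding int grid_laplace_def .
qed

text \<open>The first grid time never precedes the true time \<open>s\<close> and eventually drops
  below every \<open>q > s\<close>, so it converges to \<open>s\<close> and the exponentials follow.
  If the true time is infinite, no grid completes the stage and both sides are 0.\<close>

lemma grid_kill_tendsto:
  assumes \<omega>: "\<omega> \<in> space M" and \<epsilon>: "0 < \<epsilon>" and h: "\<And>N. 0 < h N" "h \<longlonglongrightarrow> 0" and r: "0 \<le> r"
  shows "(\<lambda>N. grid_kill c \<epsilon> (h N) n r \<omega>) \<longlonglongrightarrow> kill_exp r (stage c (\<lambda>s. X s \<omega>) \<epsilon> n)"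
proof (cases "stage c (\<lambda>s. X s \<omega>) \<epsilon> n = \<infinity>")
  case True
  then have "\<not> grid_stage c (\<lambda>i. X (h N * real i) \<omega>) \<epsilon> n m" for N m
    using stage_le_grid[OF cadlag_path[OF \<omega>] h(1), of c N \<epsilon> n m] by auto
  then have "grid_kill c \<epsilon> (h N) n r \<omega> = 0" for N
    by (rule grid_kill_none)
  then show ?thesis using True by (simp add: kill_exp_def)
next
  case False
  then obtain s where s: "stage c (\<lambda>s. X s \<omega>) \<epsilon> n = ereal s"
    using stage_nonneg[of c "\<lambda>s. X s \<omega>" \<epsilon> n] by (cases "stage c (\<lambda>s. X s \<omega>) \<epsilon> n") auto
  define m where "m N = (LEAST m. grid_stage c (\<lambda>i. X (h N * real i) \<omega>) \<epsilon> n m)" for N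
  have ev: "\<forall>\<^sub>F N in sequentially. s \<le> h N * real (m N) \<and> h N * real (m N) < q \<and>
      grid_kill c \<epsilon> (h N) n r \<omega> = exp (- r * (h N * real (m N)))" if "s < q" for q
  proof -
    have "stage c (\<lambda>s. X s \<omega>) \<epsilon> n < ereal q" using s that by simp
    from stage_less_grid[OF cadlag_path[OF \<omega>] \<epsilon> h this] show ?thesis
    proof eventually_elim
      case (elim N)
      then obtain k where k: "h N * real k < q" "grid_stage c (\<lambda>i. X (h N * real i) \<omega>) \<epsilon> n k"
        by blast
      have mN: "grid_stage c (\<lambda>i. X (h N * real i) \<omega>) \<epsilon> n (m N)" "m N \<le> k"
        using k(2) unfolding m_def by (auto intro: LeastI Least_le)
      then have "first_grid_stage c (\<lambda>i. X (h N * real i) \<omega>) \<epsilon> n (m N)"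
        unfolding first_grid_stage_def m_def using not_less_Least by blast
      moreover have "h N * real (m N) \<le> h N * real k" using mN(2) h(1)[of N] by simp
      moreover have "s \<le> h N * real (m N)"
        using stage_le_grid[OF cadlag_path[OF \<omega>] h(1) mN(1)] s by simp
      ultimately show ?case using k(1) \<omega> by (auto simp: grid_kill_first)
    qed
  qed
  have "(\<lambda>N. h N * real (m N)) \<longlonglongrightarrow> s"
  proof (rule order_tendstoI)
    fix a assume "a < s"
    have "\<forall>\<^sub>F N in sequentially. s \<le> h N * real (m N)"
      using ev[of "s + 1"] by (auto elim: eventually_mono)
    then show "\<forall>\<^sub>F N in sequentially. a < h N * real (m N)"
      by (rule eventually_mono) (use \<open>a < s\<close> in linarith)
  next
    fix a assume "s < a"
    show "\<forall>\<^sub>F N in sequentially. h N * real (m N) < a"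
      using ev[OF \<open>s < a\<close>] by (auto elim: eventually_mono)
  qed
  then have "(\<lambda>N. exp (- r * (h N * real (m N)))) \<longlonglongrightarrow> exp (- r * s)"
    by (intro tendsto_intros)
  moreover have "\<forall>\<^sub>F N in sequentially. exp (- r * (h N * real (m N))) = grid_kill c \<epsilon> (h N) n r \<omega>"
    using ev[of "s + 1"] by (auto elim: eventually_mono)
  ultimately show ?thesis
    using s by (auto simp: kill_exp_def intro: Lim_transform_eventually)
qed

lemma grid_laplace_tendsto:
  assumes \<epsilon>: "0 < \<epsilon>" and h: "\<And>N. 0 < h N" "h \<longlonglongrightarrow> 0" and r: "0 \<le> r"
  shows "(\<lambda>N. grid_laplace c \<epsilon> (h N) n r) \<longlonglongrightarrow> laplace M (\<lambda>\<omega>. stage c (\<lambda>s. X s \<omega>) \<epsilon> n) r"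
proof -
  have "0 \<le> h N" for N using h(1)[of N] by simp
  note [measurable] = this \<epsilon>
  have "(\<lambda>N. LINT \<omega>|M. grid_kill c \<epsilon> (h N) n r \<omega>) \<longlonglongrightarrow>
      (LINT \<omega>|M. kill_exp r (stage c (\<lambda>s. X s \<omega>) \<epsilon> n))"
  proof (rule integral_dominated_convergence[where w="\<lambda>_. 1"])
    show "AE \<omega> in M. (\<lambda>N. grid_kill c \<epsilon> (h N) n r \<omega>) \<longlonglongrightarrow> kill_exp r (stage c (\<lambda>s. X s \<omega>) \<epsilon> n)"
      using grid_kill_tendsto[OF _ \<epsilon> h r] by (rule AE_I2)
    show "AE \<omega> in M. norm (grid_kill c \<epsilon> (h N) n r \<omega>) \<le> 1" for N
      using grid_kill_bounds[OF \<open>0 \<le> h N\<close> r] by (intro AE_I2) simp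
  qed (auto intro: measurable_compose[OF stage_measurable[OF \<epsilon>] kill_exp_measurable])
  then show ?thesis
    unfolding laplace_eq grid_laplace_eq[OF \<open>0 \<le> h _\<close> r] .
qed

text \<open>The strong Markov property in the one form that is used. The factorization is exact on
  every grid and survives the limit of vanishing mesh; each factor depends on its step only through
  the sign \<open>c i\<close>.\<close>

theorem laplace_stage:
  assumes \<epsilon>: "0 < \<epsilon>" and r: "0 \<le> r"
  shows "laplace M (\<lambda>\<omega>. stage c (\<lambda>s. X s \<omega>) \<epsilon> n) r =
    (\<Prod>i<n. laplace M (\<lambda>\<omega>. stage (\<lambda>_. c i) (\<lambda>s. X s \<omega>) \<epsilon> (Suc 0)) r)"
proof (induction n)
  case 0
  show ?case by (simp add: laplace_eq kill_exp_def prob_space)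
next
  case (Suc n)
  let ?L = "\<lambda>c n. laplace M (\<lambda>\<omega>. stage c (\<lambda>s. X s \<omega>) \<epsilon> n) r"
  define h where "h N = 1 / real (Suc N)" for N
  have h: "0 < h N" "h \<longlonglongrightarrow> 0" "0 \<le> h N" for N
    using grid_size unfolding h_def by (auto intro: less_imp_le)
  note lim = grid_laplace_tendsto[OF \<epsilon> h(1,2) r]
  have "(\<lambda>N. grid_laplace c \<epsilon> (h N) (Suc n) r) \<longlonglongrightarrow> ?L c n * ?L (\<lambda>_. c n) (Suc 0)"
    unfolding grid_laplace_Suc[OF h(3) r, of c \<epsilon> _ n] by (intro tendsto_mult lim)
  from LIMSEQ_unique[OF lim this] have "?L c (Suc n) = ?L c n * ?L (\<lambda>_. c n) (Suc 0)" .
  then show ?case using Suc.IH by simp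
qed

text \<open>A path without a crossing before \<open>n * q\<close> has none inside any of
  \<open>n\<close> successive blocks of length \<open>q\<close>, and on a grid the blocks are
  independent with equal law. The inequality is proved for grids and carried to the limit.\<close>

lemma prob_stage_ge_power:
  assumes \<epsilon>: "0 < \<epsilon>" and q: "0 < q"
  shows "prob {\<omega>\<in>space M. ereal (real n * q) \<le> stage c (\<lambda>s. X s \<omega>) \<epsilon> (Suc 0)} \<le>
    prob {\<omega>\<in>space M. ereal q \<le> stage c (\<lambda>s. X s \<omega>) \<epsilon> (Suc 0)} ^ n"
proof -
  \<comment> \<open>The mesh divides \<open>q\<close>, so a block of length \<open>q\<close>
    consists of exactly \<open>Suc N\<close> steps.\<close>
  define h where "h N = q / real (Suc N)" for N
  have h: "0 < h N" "h \<longlonglongrightarrow> 0" "0 \<le> h N" for N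
  proof -
    have "(\<lambda>N. q * (1 / real (Suc N))) \<longlonglongrightarrow> q * 0"
      by (intro tendsto_intros grid_size)
    then show "h \<longlonglongrightarrow> 0" unfolding h_def[abs_def] by simp
  qed (use q in \<open>auto simp: h_def\<close>)
  \<comment> \<open>The right end \<open>m\<close> is excluded, in accordance with the limit event,
    in which a crossing time equal to \<open>real k * q\<close> still counts as no crossing.\<close>
  define avoid where "avoid m w \<longleftrightarrow> (\<forall>i<m. \<not> grid_stage c w \<epsilon> (Suc 0) i)" for m w
  let ?A = "\<lambda>N m. {\<omega>\<in>space M. avoid m (\<lambda>i. X (h N * real i) \<omega>)}"
  have avoid_measurable: "Measurable.pred K (\<lambda>x. avoid m (w x))"
    if [measurable]: "\<And>i. (\<lambda>x. w x i) \<in> borel_measurable K" for m w and K :: "'b measure"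
    unfolding avoid_def by measurable
  have avoid_measurable': "Measurable.pred (PiM UNIV (\<lambda>_. borel)) (\<lambda>d. avoid m (walk d))" for m
    unfolding avoid_def by measurable
  have avoid_walk: "avoid m (\<lambda>i. X (a * real i) \<omega>) = avoid m (walk (inc a \<omega>))" for m a \<omega>
    unfolding avoid_def walk_inc[symmetric] grid_stage_translate ..
  have avoid_add: "avoid m w \<and> avoid m' (walk (\<lambda>i. d (m + i)))" if "avoid (m + m') w" "w = walk d" for m m' w d
  proof
    show "avoid m w" using that(1) unfolding avoid_def by (meson trans_less_add1)
    have "grid_stage c w \<epsilon> (Suc 0) (m + i)" if "grid_stage c (\<lambda>i. w (m + i)) \<epsilon> (Suc 0) i" for i
    proof -
      from that obtain v u where "v \<le> u" "u \<le> i" "\<epsilon> < c 0 * (w (m + v) - w (m + u))" by auto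
      then have "m + v \<le> m + u" "m + u \<le> m + i" "\<epsilon> < c 0 * (w (m + v) - w (m + u))" by auto
      then show ?thesis unfolding grid_stage.simps by blast
    qed
    then have "\<not> grid_stage c (\<lambda>i. w (m + i)) \<epsilon> (Suc 0) i" if "i < m'" for i
      using \<open>avoid (m + m') w\<close> that unfolding avoid_def by (meson nat_add_left_cancel_less)
    then show "avoid m' (walk (\<lambda>i. d (m + i)))"
      unfolding avoid_def \<open>w = walk d\<close> walk_add grid_stage_translate by blast
  qed
  have A: "?A N m \<in> sets M" for N m
    by (rule avoid_measurable[unfolded pred_def]) (simp add: h(3))
  have sub: "prob (?A N (m + m')) \<le> prob (?A N m) * prob (?A N m')" for N m m'
  proof -
    have "prob (?A N (m + m')) \<le>
        prob {\<omega>\<in>space M. avoid m (walk (inc (h N) \<omega>)) \<and> avoid m' (walk (\<lambda>i. inc (h N) \<omega> (m + i)))}"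
    proof (rule finite_measure_mono)
      show "?A N (m + m') \<subseteq>
          {\<omega>\<in>space M. avoid m (walk (inc (h N) \<omega>)) \<and> avoid m' (walk (\<lambda>i. inc (h N) \<omega> (m + i)))}"
        unfolding avoid_walk using avoid_add by blast
      have "Measurable.pred M (\<lambda>\<omega>. avoid m (walk (inc (h N) \<omega>)))"
        "Measurable.pred M (\<lambda>\<omega>. avoid m' (walk (\<lambda>i. inc (h N) \<omega> (m + i))))"
        using h(3) by (auto intro!: avoid_measurable simp: walk_def)
      then show "{\<omega>\<in>space M. avoid m (walk (inc (h N) \<omega>)) \<and> avoid m' (walk (\<lambda>i. inc (h N) \<omega> (m + i)))} \<in> events"
        by measurable
    qed
    also have "\<dots> = prob (?A N m) * prob (?A N m')"
      unfolding avoid_walk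
    proof (rule prob_inc_indep[OF h(3) avoid_measurable' avoid_measurable'])
      fix d d' :: "nat \<Rightarrow> real" assume eq: "\<And>i. i < m \<Longrightarrow> d i = d' i"
      have "grid_stage c (walk d) \<epsilon> (Suc 0) i = grid_stage c (walk d') \<epsilon> (Suc 0) i" if "i < m" for i
        using that eq by (intro grid_stage_cong) (auto simp: walk_def intro: sum.cong)
      then show "avoid m (walk d) = avoid m (walk d')" unfolding avoid_def by auto
    qed
    finally show ?thesis .
  qed
  have pow: "prob (?A N (k * m)) \<le> prob (?A N m) ^ k" for N m k
  proof (induction k)
    case (Suc k)
    have "prob (?A N (Suc k * m)) \<le> prob (?A N m) * prob (?A N (k * m))" 
      using sub[of m "k * m" N] by simp
    also have "\<dots> \<le> prob (?A N m) * prob (?A N m) ^ k" by (intro mult_left_mono Suc.IH) simp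
    finally show ?case by simp
  qed simp
  have lim: "(\<lambda>N. prob (?A N (k * Suc N))) \<longlonglongrightarrow>
      prob {\<omega>\<in>space M. ereal (real k * q) \<le> stage c (\<lambda>s. X s \<omega>) \<epsilon> (Suc 0)}" (is "_ \<longlonglongrightarrow> prob ?B") for k
  proof -
    have hk: "h N * real (k * Suc N) = real k * q" for N
      unfolding h_def of_nat_mult by (simp del: of_nat_Suc)
    have B: "?B \<in> sets M"
      using stage_measurable[OF \<epsilon>, of c "Suc 0"] by measurable
    have "(\<lambda>N. LINT \<omega>|M. indicator (?A N (k * Suc N)) \<omega> :: real) \<longlonglongrightarrow> (LINT \<omega>|M. indicator ?B \<omega>)"
    proof (rule integral_dominated_convergence[where w="\<lambda>_. 1"])
      show "AE \<omega> in M. (\<lambda>N. indicator (?A N (k * Suc N)) \<omega> :: real) \<longlonglongrightarrow> indicator ?B \<omega>"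
      proof (rule AE_I2)
        fix \<omega> assume \<omega>: "\<omega> \<in> space M"
        \<comment> \<open>For each path the events eventually agree. On \<open>?B\<close> a grid
          crossing before \<open>real k * q\<close> is impossible because grids only delay; off
          \<open>?B\<close> the strict inequality leaves room for a grid crossing once the mesh is
          small.\<close>
        have "\<forall>\<^sub>F N in sequentially. \<omega> \<in> ?A N (k * Suc N) \<longleftrightarrow> \<omega> \<in> ?B"
        proof (cases "\<omega> \<in> ?B")
          case True
          have "\<omega> \<in> ?A N (k * Suc N)" for N
          proof -
            have "\<not> grid_stage c (\<lambda>i. X (h N * real i) \<omega>) \<epsilon> (Suc 0) i" if "i < k * Suc N" for i
            proof
              assume "grid_stage c (\<lambda>i. X (h N * real i) \<omega>) \<epsilon> (Suc 0) i"
              have "ereal (real k * q) \<le> stage c (\<lambda>s. X s \<omega>) \<epsilon> (Suc 0)"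
                using True by blast
              also have "\<dots> \<le> ereal (h N * real i)"
                by (rule stage_le_grid[OF cadlag_path[OF \<omega>] h(1)]) fact
              finally have "real k * q \<le> h N * real i" by simp
              moreover have "h N * real i < h N * real (k * Suc N)"
                using that h(1)[of N] by (simp del: of_nat_mult)
              ultimately show False unfolding hk by simp
            qed
            then show ?thesis using \<omega> unfolding avoid_def by simp
          qed
          then show ?thesis using True by simp
        next
          case False
          then have "stage c (\<lambda>s. X s \<omega>) \<epsilon> (Suc 0) < ereal (real k * q)"
            using \<omega> by (simp add: not_le del: stage.simps)
          from stage_less_grid[OF cadlag_path[OF \<omega>] \<epsilon> h(1,2) this]
          show ?thesis
          proof eventually_elim
            case (elim N)
            then obtain m where m: "h N * real m < h N * real (k * Suc N)"
              "grid_stage c (\<lambda>i. X (h N * real i) \<omega>) \<epsilon> (Suc 0) m" unfolding hk by blast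
            then have "m < k * Suc N" using h(1)[of N] by (simp del: of_nat_mult)
            then have "\<omega> \<notin> ?A N (k * Suc N)" using m(2) unfolding avoid_def by blast
            then show ?case using False by blast
          qed
        qed
        then have "\<forall>\<^sub>F N in sequentially. (indicator ?B \<omega> :: real) = indicator (?A N (k * Suc N)) \<omega>"
          by (rule eventually_mono) (auto simp: indicator_def)
        then show "(\<lambda>N. indicator (?A N (k * Suc N)) \<omega> :: real) \<longlonglongrightarrow> indicator ?B \<omega>"
          by (rule Lim_transform_eventually[OF tendsto_const])
      qed
    qed (use A B in auto)
    then show ?thesis using A B by simp
  qed
  have "(\<lambda>N. prob (?A N (1 * Suc N)) ^ n) \<longlonglongrightarrow>
      prob {\<omega>\<in>space M. ereal (real 1 * q) \<le> stage c (\<lambda>s. X s \<omega>) \<epsilon> (Suc 0)} ^ n"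
    by (intro tendsto_power lim)
  then have "prob {\<omega>\<in>space M. ereal (real n * q) \<le> stage c (\<lambda>s. X s \<omega>) \<epsilon> (Suc 0)} \<le>
      prob {\<omega>\<in>space M. ereal (real 1 * q) \<le> stage c (\<lambda>s. X s \<omega>) \<epsilon> (Suc 0)} ^ n"
    by (rule LIMSEQ_le[OF lim]) (use pow in \<open>simp only: mult_1\<close>, blast)
  then show ?thesis by simp
qed

end

section \<open>Self-similarity and the law of a bar length\<close>

lemma ereal_eq_less_iff:
  fixes a b :: ereal
  assumes "\<And>q. a < ereal q \<longleftrightarrow> b < ereal q"
  shows "a = b"
  using assms by (intro antisym ereal_less_imp_le) auto

lemma stage_time_change:
  assumes x: "cadlag x" and a: "0 < a"
  shows "ereal a * stage c (\<lambda>s. x (a * s)) \<epsilon> n = stage c x \<epsilon> n"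
proof (induction n)
  case (Suc n)
  let ?y = "\<lambda>s. x (a * s)"
  have y: "cadlag ?y" using cadlag_rescale[OF x a] .
  have le: "ereal a * \<tau> \<le> ereal (a * v) \<longleftrightarrow> \<tau> \<le> ereal v" for \<tau> v
    using a by (cases \<tau>) auto
  have less: "ereal a * \<tau> < ereal q \<longleftrightarrow> \<tau> < ereal (q / a)" for \<tau> q
    using a by (cases \<tau>) (auto simp: field_simps)
  show ?case
  proof (rule ereal_eq_less_iff)
    fix q
    have "ereal a * stage c ?y \<epsilon> (Suc n) < ereal q \<longleftrightarrow>
        (\<exists>v u. stage c ?y \<epsilon> n \<le> ereal v \<and> v \<le> u \<and> u < q / a \<and> \<epsilon> < c n * (?y v - ?y u))"
      unfolding less stage_Suc_less_iff[OF y] ..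
    also have "\<dots> \<longleftrightarrow> (\<exists>v u. stage c x \<epsilon> n \<le> ereal (a * v) \<and> a * v \<le> a * u \<and> a * u < q \<and>
        \<epsilon> < c n * (x (a * v) - x (a * u)))"
      unfolding Suc.IH[symmetric] le using a by (simp add: field_simps)
    also have "\<dots> \<longleftrightarrow> (\<exists>v u. stage c x \<epsilon> n \<le> ereal v \<and> v \<le> u \<and> u < q \<and> \<epsilon> < c n * (x v - x u))"
    proof
      assume "\<exists>v u. stage c x \<epsilon> n \<le> ereal v \<and> v \<le> u \<and> u < q \<and> \<epsilon> < c n * (x v - x u)"
      then obtain v u where "stage c x \<epsilon> n \<le> ereal v" "v \<le> u" "u < q" "\<epsilon> < c n * (x v - x u)" by blast
      then show "\<exists>v u. stage c x \<epsilon> n \<le> ereal (a * v) \<and> a * v \<le> a * u \<and> a * u < q \<and>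
          \<epsilon> < c n * (x (a * v) - x (a * u))"
        using a by (intro exI[of _ "v / a"] exI[of _ "u / a"]) simp
    qed blast
    also have "\<dots> \<longleftrightarrow> stage c x \<epsilon> (Suc n) < ereal q"
      unfolding stage_Suc_less_iff[OF x] ..
    finally show "ereal a * stage c ?y \<epsilon> (Suc n) < ereal q \<longleftrightarrow> stage c x \<epsilon> (Suc n) < ereal q" .
  qed
qed simp

lemma stage_scale:
  assumes x: "cadlag x" and a: "0 < a"
  shows "stage c (\<lambda>s. a * x s) (a * \<epsilon>) n = stage c x \<epsilon> n"
proof (induction n)
  case (Suc n)
  have "a * \<epsilon> < c n * (a * x v - a * x u) \<longleftrightarrow> \<epsilon> < c n * (x v - x u)" for v u
  proof -
    have "c n * (a * x v - a * x u) = a * (c n * (x v - x u))" by (simp add: algebra_simps)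
    then show ?thesis using a by (simp only: mult_less_cancel_left_pos)
  qed
  then show ?case
    by (intro ereal_eq_less_iff) (simp only: stage_Suc_less_iff[OF cadlag_cmult[OF x]] stage_Suc_less_iff[OF x] Suc.IH)
qed simp

lemma stage_Suc_pos:
  assumes "cadlag x" "0 < \<epsilon>"
  shows "0 < stage c x \<epsilon> (Suc n)"
proof -
  have "0 < stage c x \<epsilon> (Suc 0)"
    using stage_less_Suc[OF assms, of c 0] by simp
  also have "\<dots> \<le> stage c x \<epsilon> (Suc n)" by (rule stage_mono) simp
  finally show ?thesis .
qed

text \<open>
  Only countably many coordinates enter, so that this is an event of the product \<open>\<sigma>\<close>-algebra.
  It describes ``\<open>stage c x \<epsilon> n \<le> q\<close>'' for cadlag \<open>x\<close> only.
\<close>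

definition stage_event :: "(nat \<Rightarrow> real) \<Rightarrow> real \<Rightarrow> nat \<Rightarrow> real \<Rightarrow> (real \<Rightarrow> real) set" where
  "stage_event c \<epsilon> n q = {f \<in> space (PiM {0..} (\<lambda>_. borel)). \<forall>k. \<exists>N m. 1 / real (Suc N) * real m < q + 1 / real (Suc k) \<and>
     grid_stage c (\<lambda>i. f (1 / real (Suc N) * real i)) \<epsilon> n m}"

lemma stage_event_measurable: "stage_event c \<epsilon> n q \<in> sets (PiM {0..} (\<lambda>_. borel))"
proof -
  have [measurable]: "(\<lambda>f. f (1 / real (Suc N) * real i)) \<in> borel_measurable (PiM {0..} (\<lambda>_. borel))" for N i
    by (rule measurable_component_singleton) simp
  show ?thesis unfolding stage_event_def by measurable
qed

text \<open>Only strict inequalities have a grid form, so \<open>\<le> q\<close> is reached as the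
  intersection over \<open>k\<close> of the events with
  \<open>< q + 1 / real (Suc k)\<close>.\<close>

lemma restrict_in_stage_event_iff:
  assumes x: "cadlag x" and \<epsilon>: "0 < \<epsilon>"
  shows "restrict x {0..} \<in> stage_event c \<epsilon> n q \<longleftrightarrow> stage c x \<epsilon> n \<le> ereal q"
proof -
  have "(\<lambda>i. restrict x {0..} (1 / real (Suc N) * real i)) = (\<lambda>i. x (1 / real (Suc N) * real i))" for N
    by (rule ext) simp
  then have "restrict x {0..} \<in> stage_event c \<epsilon> n q \<longleftrightarrow> (\<forall>k. stage c x \<epsilon> n < ereal (q + 1 / real (Suc k)))"
    unfolding stage_less_iff_grid[OF x \<epsilon> grid_size] stage_event_def
    by (simp add: space_PiM)
  also have "\<dots> \<longleftrightarrow> stage c x \<epsilon> n \<le> ereal q"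
  proof
    assume L: "\<forall>k. stage c x \<epsilon> n < ereal (q + 1 / real (Suc k))"
    show "stage c x \<epsilon> n \<le> ereal q"
    proof (rule ereal_less_imp_le)
      fix r assume "ereal q < ereal r"
      then obtain k where "1 / real (Suc k) < r - q"
        using nat_approx_posE[of "r - q"] by auto
      then have "ereal (q + 1 / real (Suc k)) < ereal r" by simp
      then show "stage c x \<epsilon> n < ereal r" using L less_trans by blast
    qed
  next
    assume R: "stage c x \<epsilon> n \<le> ereal q"
    show "\<forall>k. stage c x \<epsilon> n < ereal (q + 1 / real (Suc k))"
    proof
      fix k
      have "ereal q < ereal (q + 1 / real (Suc k))" by simp
      then show "stage c x \<epsilon> n < ereal (q + 1 / real (Suc k))" using R by (rule le_less_trans[rotated])
    qed
  qed
  finally show ?thesis .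
qed

context levy
begin

text \<open>Stability equates the laws of \<open>X (b powr \<alpha> * s)\<close> and
  \<open>b * X s\<close> as processes. In one and the same event at level \<open>b\<close>, the
  first process turns into a change of time for \<open>X\<close>, the second into a change of level
  from \<open>b\<close> to 1.\<close>

lemma prob_stage_scale:
  assumes stable: "stable_process \<alpha> M X" and b: "0 < b"
  shows "prob {\<omega>\<in>space M. stage c (\<lambda>s. X s \<omega>) b n \<le> ereal (b powr \<alpha> * q)} =
    prob {\<omega>\<in>space M. stage c (\<lambda>s. X s \<omega>) 1 n \<le> ereal q}"
proof -
  let ?P = "PiM {0..} (\<lambda>_. borel :: real measure)"
  let ?Y = "\<lambda>\<omega>. \<lambda>s\<in>{0..}. X (b powr \<alpha> * s) \<omega>" and ?Z = "\<lambda>\<omega>. \<lambda>s\<in>{0..}. b * X s \<omega>"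
  have a: "0 < b powr \<alpha>" using b by simp
  have meas: "?Y \<in> measurable M ?P" "?Z \<in> measurable M ?P"
    using a by (auto intro!: measurable_restrict)
  have "distr M ?P ?Y = distr M ?P ?Z"
    using stable b unfolding stable_process_def by blast
  then have "measure (distr M ?P ?Y) (stage_event c b n q) = measure (distr M ?P ?Z) (stage_event c b n q)"
    by simp
  then have "prob (?Y -` stage_event c b n q \<inter> space M) = prob (?Z -` stage_event c b n q \<inter> space M)"
    by (simp add: measure_distr[OF meas(1) stage_event_measurable] measure_distr[OF meas(2) stage_event_measurable])
  moreover have "?Y -` stage_event c b n q \<inter> space M =
      {\<omega>\<in>space M. stage c (\<lambda>s. X s \<omega>) b n \<le> ereal (b powr \<alpha> * q)}"
  proof -
    have "?Y \<omega> \<in> stage_event c b n q \<longleftrightarrow> stage c (\<lambda>s. X s \<omega>) b n \<le> ereal (b powr \<alpha> * q)"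
      if \<omega>: "\<omega> \<in> space M" for \<omega>
    proof -
      have "?Y \<omega> \<in> stage_event c b n q \<longleftrightarrow> stage c (\<lambda>s. X (b powr \<alpha> * s) \<omega>) b n \<le> ereal q"
        by (rule restrict_in_stage_event_iff[OF cadlag_rescale[OF cadlag_path[OF \<omega>] a] b])
      also have "\<dots> \<longleftrightarrow> ereal (b powr \<alpha>) * stage c (\<lambda>s. X (b powr \<alpha> * s) \<omega>) b n \<le> ereal (b powr \<alpha> * q)"
        using a by (cases "stage c (\<lambda>s. X (b powr \<alpha> * s) \<omega>) b n") auto
      finally show ?thesis unfolding stage_time_change[OF cadlag_path[OF \<omega>] a] .
    qed
    then show ?thesis by blast
  qed
  moreover have "?Z -` stage_event c b n q \<inter> space M = {\<omega>\<in>space M. stage c (\<lambda>s. X s \<omega>) 1 n \<le> ereal q}"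
  proof -
    have "?Z \<omega> \<in> stage_event c b n q \<longleftrightarrow> stage c (\<lambda>s. X s \<omega>) 1 n \<le> ereal q"
      if \<omega>: "\<omega> \<in> space M" for \<omega>
      using restrict_in_stage_event_iff[OF cadlag_cmult[OF cadlag_path[OF \<omega>]] b]
        stage_scale[OF cadlag_path[OF \<omega>] b, of c 1 n] by simp
    then show ?thesis by blast
  qed
  ultimately show ?thesis by simp
qed

section \<open>The law of a bar length\<close>

lemma stage_le_sets:
  assumes "0 < \<epsilon>"
  shows "{\<omega>\<in>space M. stage c (\<lambda>s. X s \<omega>) \<epsilon> n \<le> a} \<in> sets M"
proof -
  note [measurable] = stage_measurable[OF assms, of c n]
  show ?thesis by measurable
qed

lemma bar_length_greater:
  assumes t: "0 \<le> t" and k: "2 \<le> k" and e: "0 \<le> e"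
  shows "{\<omega>\<in>space M. e < bar_length (\<lambda>s. X s \<omega>) t k} =
    (\<Union>N. {\<omega>\<in>space M. stage alternating (\<lambda>s. X s \<omega>) (e + 1 / real (Suc N)) (2 * (k - 1)) \<le> ereal t})"
    (is "?L = (\<Union>N. ?R N)")
proof (intro set_eqI iffI)
  fix \<omega> assume "\<omega> \<in> ?L"
  then have \<omega>: "\<omega> \<in> space M" and "e < bar_length (\<lambda>s. X s \<omega>) t k" by auto
  then obtain \<epsilon> where \<epsilon>: "e < \<epsilon>" "stage alternating (\<lambda>s. X s \<omega>) \<epsilon> (2 * (k - 1)) \<le> ereal t"
    using less_bar_length_iff[OF cadlag_path[OF \<omega>] t k e] by blast
  then obtain N where "1 / real (Suc N) < \<epsilon> - e"
    using nat_approx_posE[of "\<epsilon> - e"] by auto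
  then have "stage alternating (\<lambda>s. X s \<omega>) (e + 1 / real (Suc N)) (2 * (k - 1)) \<le>
      stage alternating (\<lambda>s. X s \<omega>) \<epsilon> (2 * (k - 1))"
    by (intro stage_mono_level cadlag_path \<omega>) simp
  then show "\<omega> \<in> (\<Union>N. ?R N)" using \<epsilon>(2) \<omega> by (auto intro: order_trans)
next
  fix \<omega> assume "\<omega> \<in> (\<Union>N. ?R N)"
  then obtain N where \<omega>: "\<omega> \<in> space M"
    and N: "stage alternating (\<lambda>s. X s \<omega>) (e + 1 / real (Suc N)) (2 * (k - 1)) \<le> ereal t"
    by blast
  have "e < e + 1 / real (Suc N)" by simp
  then show "\<omega> \<in> ?L"
    using N \<omega> less_bar_length_iff[OF cadlag_path[OF \<omega>] t k e] by blast
qed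

lemma bar_length_measurable [measurable]:
  assumes t: "0 \<le> t" and k: "2 \<le> k"
  shows "(\<lambda>\<omega>. bar_length (\<lambda>s. X s \<omega>) t k) \<in> borel_measurable M"
  unfolding borel_measurable_iff_greater
proof
  fix e
  show "{\<omega>\<in>space M. e < bar_length (\<lambda>s. X s \<omega>) t k} \<in> sets M"
  proof (cases "0 \<le> e")
    case True
    have "0 < e + 1 / real (Suc N)" for N using True by (intro add_nonneg_pos) auto
    then show ?thesis
      unfolding bar_length_greater[OF t k True] by (intro sets.countable_UN image_subsetI stage_le_sets)
  next
    case False
    then have "{\<omega>\<in>space M. e < bar_length (\<lambda>s. X s \<omega>) t k} = space M"
      using bar_length_nonneg[OF cadlag_path t k] by force
    then show ?thesis by simp
  qed
qed

text \<open>By scaling, level \<open>b\<close> is crossed by time \<open>t\<close> with the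
  probability that \<open>b powr \<alpha> * \<tau> \<le> t\<close>; this is the largest
  \<open>b\<close> satisfying that inequality, and 0 if \<open>\<tau>\<close> is infinite. It is
  used for \<open>n > 0\<close> only, where \<open>\<tau>\<close> is strictly positive.\<close>

definition stage_radius :: "real \<Rightarrow> real \<Rightarrow> nat \<Rightarrow> 'a \<Rightarrow> real" where
  "stage_radius \<alpha> t n \<omega> = (let \<tau> = stage alternating (\<lambda>s. X s \<omega>) 1 n in
     if \<tau> = \<infinity> then 0 else (t / real_of_ereal \<tau>) powr (1 / \<alpha>))"

lemma stage_radius_measurable [measurable]: "stage_radius \<alpha> t n \<in> borel_measurable M"
proof -
  note [measurable] = stage_measurable[of 1 alternating n, simplified]
  show ?thesis unfolding stage_radius_def Let_def by measurable
qed

lemma le_stage_radius_iff: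
  assumes \<omega>: "\<omega> \<in> space M" and "0 < \<alpha>" "0 < t" "0 < b"
  shows "b \<le> stage_radius \<alpha> t (Suc n) \<omega> \<longleftrightarrow> stage alternating (\<lambda>s. X s \<omega>) 1 (Suc n) \<le> ereal (t / b powr \<alpha>)"
proof (cases "stage alternating (\<lambda>s. X s \<omega>) 1 (Suc n)")
  case (real s)
  then have s: "0 < s" using stage_Suc_pos[OF cadlag_path[OF \<omega>], of 1 alternating n] by simp
  have "b \<le> (t / s) powr (1 / \<alpha>) \<longleftrightarrow> b powr \<alpha> \<le> ((t / s) powr (1 / \<alpha>)) powr \<alpha>"
    using assms powr_less_mono2[of \<alpha> "(t / s) powr (1 / \<alpha>)" b] powr_mono2[of \<alpha> b "(t / s) powr (1 / \<alpha>)"]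
    by (auto simp: not_less[symmetric])
  also have "((t / s) powr (1 / \<alpha>)) powr \<alpha> = t / s"
    using assms s by (simp add: powr_powr)
  also have "b powr \<alpha> \<le> t / s \<longleftrightarrow> s \<le> t / b powr \<alpha>"
    using assms s by (simp add: field_simps)
  finally show ?thesis using real by (simp add: stage_radius_def Let_def del: stage.simps)
next
  case PInf
  then show ?thesis using assms by (simp add: stage_radius_def Let_def del: stage.simps)
next
  case MInf
  then show ?thesis using stage_nonneg[of alternating "\<lambda>s. X s \<omega>" 1 "Suc n"] by simp
qed

text \<open>Scaling equates probabilities one level at a time and says nothing about joint events.
  Both tail events are therefore written as increasing unions over levels decreasing to
  \<open>e\<close>, and the probabilities are compared in the limit.\<close>

lemma prob_bar_length_greater:
  assumes stable: "stable_process \<alpha> M X" and \<alpha>: "0 < \<alpha>" and t: "0 < t" and k: "2 \<le> k" and e: "0 \<le> e"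
  shows "prob {\<omega>\<in>space M. e < bar_length (\<lambda>s. X s \<omega>) t k} =
    prob {\<omega>\<in>space M. e < stage_radius \<alpha> t (2 * (k - 1)) \<omega>}"
proof -
  let ?b = "\<lambda>N. e + 1 / real (Suc N)"
  let ?R = "\<lambda>N. {\<omega>\<in>space M. stage alternating (\<lambda>s. X s \<omega>) (?b N) (2 * (k - 1)) \<le> ereal t}"
  let ?W = "\<lambda>N. {\<omega>\<in>space M. stage alternating (\<lambda>s. X s \<omega>) 1 (2 * (k - 1)) \<le> ereal (t / ?b N powr \<alpha>)}"
  have b: "0 < ?b N" for N using e by (intro add_nonneg_pos) auto
  have b_dec: "?b N' \<le> ?b N" if "N \<le> N'" for N N' using that by (simp add: frac_le)
  obtain j where j: "2 * (k - 1) = Suc j" using k by (cases "2 * (k - 1)") auto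
  have "?R N \<subseteq> ?R N'" if "N \<le> N'" for N N'
    using stage_mono_level[OF cadlag_path b_dec[OF that]] by (blast intro: order_trans)
  then have "(\<lambda>N. prob (?R N)) \<longlonglongrightarrow> prob (\<Union>N. ?R N)"
    using b by (intro finite_Lim_measure_incseq) (auto simp: mono_def intro!: stage_le_sets simp del: of_nat_Suc)
  then have lim1: "(\<lambda>N. prob (?R N)) \<longlonglongrightarrow> prob {\<omega>\<in>space M. e < bar_length (\<lambda>s. X s \<omega>) t k}"
    unfolding bar_length_greater[OF less_imp_le[OF t] k e] .
  have eq: "prob (?R N) = prob (?W N)" for N
    using prob_stage_scale[OF stable b[of N], of alternating "2 * (k - 1)" "t / ?b N powr \<alpha>"] b[of N]
    by simp
  have lim2: "(\<lambda>N. prob (?W N)) \<longlonglongrightarrow> prob (\<Union>N. ?W N)"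
  proof (rule finite_Lim_measure_incseq)
    have "?W N \<subseteq> ?W N'" if "N \<le> N'" for N N'
    proof -
      have "?b N' powr \<alpha> \<le> ?b N powr \<alpha>"
        using \<alpha> b[of N'] by (intro powr_mono2 b_dec that) (auto intro: less_imp_le)
      then have "t / ?b N powr \<alpha> \<le> t / ?b N' powr \<alpha>"
        using t b[of N] b[of N'] by (intro divide_left_mono mult_pos_pos) (simp_all only: powr_gt_zero less_imp_neq[symmetric] less_imp_le not_False_eq_True)
      then show ?thesis by (auto intro: order_trans simp del: of_nat_Suc)
    qed
    then show "incseq ?W" by (simp add: mono_def)
    show "range ?W \<subseteq> events" using stage_le_sets[of 1] by auto
  qed
  have W: "(\<Union>N. ?W N) = {\<omega>\<in>space M. e < stage_radius \<alpha> t (2 * (k - 1)) \<omega>}"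
  proof -
    have "(\<exists>N. ?b N \<le> w) \<longleftrightarrow> e < w" for w
    proof
      assume "e < w"
      then obtain N where "1 / real (Suc N) < w - e"
        using nat_approx_posE[of "w - e"] by auto
      then show "\<exists>N. ?b N \<le> w" by (intro exI[of _ N]) simp
    next
      assume "\<exists>N. ?b N \<le> w"
      then obtain N where "?b N \<le> w" by blast
      moreover have "e < ?b N" by simp
      ultimately show "e < w" by (rule less_le_trans[rotated])
    qed
    moreover have "?W N = {\<omega>\<in>space M. ?b N \<le> stage_radius \<alpha> t (2 * (k - 1)) \<omega>}" for N
      unfolding j
      by (rule Collect_cong, rule conj_cong[OF refl], rule le_stage_radius_iff[OF _ \<alpha> t b, symmetric])
    moreover have "(\<Union>N. {\<omega>\<in>space M. ?b N \<le> f \<omega>}) = {\<omega>\<in>space M. \<exists>N. ?b N \<le> f \<omega>}" for f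
      by blast
    ultimately show ?thesis by (simp only:)
  qed
  show ?thesis
    using LIMSEQ_unique[OF _ lim2] lim1 unfolding eq W by blast
qed

lemma distr_bar_length:
  assumes stable: "stable_process \<alpha> M X" and \<alpha>: "0 < \<alpha>" and t: "0 < t" and k: "2 \<le> k"
  shows "distr M borel (\<lambda>\<omega>. bar_length (\<lambda>s. X s \<omega>) t k) = distr M borel (stage_radius \<alpha> t (2 * (k - 1)))"
    (is "?D = ?E")
proof (rule measure_eqI_lessThan)
  have meas: "(\<lambda>\<omega>. bar_length (\<lambda>s. X s \<omega>) t k) \<in> borel_measurable M"
    using t k by (intro bar_length_measurable) auto
  fix e :: real
  have D: "emeasure ?D {e<..} = prob {\<omega>\<in>space M. e < bar_length (\<lambda>s. X s \<omega>) t k}"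
    using meas by (simp add: emeasure_distr emeasure_eq_measure vimage_def Int_def conj_commute)
  then show "emeasure ?D {e<..} < \<infinity>" by simp
  have E: "emeasure ?E {e<..} = prob {\<omega>\<in>space M. e < stage_radius \<alpha> t (2 * (k - 1)) \<omega>}"
    by (simp add: emeasure_distr emeasure_eq_measure vimage_def Int_def conj_commute)
  show "emeasure ?D {e<..} = emeasure ?E {e<..}"
  proof (cases "0 \<le> e")
    case True
    then show ?thesis unfolding D E using prob_bar_length_greater[OF assms] by simp
  next
    case False
    have "{\<omega>\<in>space M. e < bar_length (\<lambda>s. X s \<omega>) t k} = space M"
      using False bar_length_nonneg[OF cadlag_path _ k, of _ t] t by force
    moreover have "0 \<le> stage_radius \<alpha> t n \<omega>" for n \<omega>
      by (simp add: stage_radius_def Let_def)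
    then have "{\<omega>\<in>space M. e < stage_radius \<alpha> t (2 * (k - 1)) \<omega>} = space M"
      using False by (auto simp: not_le intro: less_le_trans[of e 0])
    ultimately show ?thesis unfolding D E by simp
  qed
qed auto

text \<open>Splitting the expectation at \<open>v\<close> bounds it by the probability of a crossing
  before \<open>v\<close> plus \<open>exp (- (r * v))\<close>. For \<open>v = u / real n\<close> the
  first term is at most \<open>1 / real n\<close>, and \<open>n\<close> of order
  \<open>sqrt r\<close> makes both terms \<open>O(1 / sqrt r)\<close>. Decay of any power order
  opens a strip to the right of 0 for the Mellin transform.\<close>

lemma laplace_stage_bound:
  assumes \<epsilon>: "0 < \<epsilon>"
  shows "\<exists>C\<ge>0. \<forall>r\<ge>1. laplace M (\<lambda>\<omega>. stage c (\<lambda>s. X s \<omega>) \<epsilon> (Suc 0)) r \<le> C / sqrt r"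
proof -
  let ?T = "\<lambda>\<omega>. stage c (\<lambda>s. X s \<omega>) \<epsilon> (Suc 0)"
  have T: "?T \<in> borel_measurable M" by (rule stage_measurable[OF \<epsilon>])
  let ?A = "\<lambda>v. {\<omega>\<in>space M. ereal v \<le> ?T \<omega>}"
  have A: "?A v \<in> sets M" for v using T by measurable
  \<comment> \<open>Crossing times are strictly positive, so for some \<open>u > 0\<close> the event
    of no crossing before \<open>u\<close> has probability above \<open>1 / 2\<close>.\<close>
  have "(\<Union>N. ?A (1 / real (Suc N))) = space M"
  proof -
    have "\<exists>N. ereal (1 / real (Suc N)) \<le> ?T \<omega>" if \<omega>: "\<omega> \<in> space M" for \<omega>
    proof -
      obtain q where q: "0 < ereal q" "ereal q < ?T \<omega>"
        using ereal_dense2[OF stage_Suc_pos[OF cadlag_path[OF \<omega>] \<epsilon>]] by blast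
      then obtain N where "1 / real (Suc N) < q" using nat_approx_posE[of q] by auto
      then have "ereal (1 / real (Suc N)) \<le> ereal q" by simp
      then show ?thesis using q(2) by (meson less_imp_le order_trans)
    qed
    then show ?thesis by blast
  qed
  moreover have "(\<lambda>N. prob (?A (1 / real (Suc N)))) \<longlonglongrightarrow> prob (\<Union>N. ?A (1 / real (Suc N)))"
  proof (rule finite_Lim_measure_incseq)
    have "ereal (1 / real (Suc N')) \<le> ereal (1 / real (Suc N))" if "N \<le> N'" for N N'
      using that by (simp add: frac_le)
    then show "incseq (\<lambda>N. ?A (1 / real (Suc N)))"
      unfolding mono_def le_fun_def by (blast intro: order_trans)
  qed (use A in auto)
  ultimately have "(\<lambda>N. prob (?A (1 / real (Suc N)))) \<longlonglongrightarrow> 1" by (simp add: prob_space)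
  then have "\<forall>\<^sub>F N in sequentially. 1 / 2 < prob (?A (1 / real (Suc N)))"
    by (rule order_tendstoD) simp
  then obtain N where N: "1 / 2 < prob (?A (1 / real (Suc N)))"
    by (auto simp: eventually_sequentially)
  define u where "u = 1 / real (Suc N)"
  have u: "0 < u" "1 / 2 < prob (?A u)" using N by (simp_all add: u_def)
  \<comment> \<open>\<open>n\<close> blocks of length \<open>u / real n\<close> fill
    \<open>u\<close>, so
    \<open>1 / 2 < (1 - \<delta>) ^ n \<le> exp (- (real n * \<delta>))\<close>. Then
    \<open>exp (real n * \<delta>) < 2\<close>, and \<open>1 + y \<le> exp y\<close> gives
    \<open>real n * \<delta> < 1\<close>.\<close>
  have small: "1 - prob (?A (u / real n)) \<le> 1 / real n" if n: "0 < n" for n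
  proof -
    define \<delta> where "\<delta> = 1 - prob (?A (u / real n))"
    have "1 / 2 < prob (?A (u / real n)) ^ n"
      using prob_stage_ge_power[OF \<epsilon>, of "u / real n" n c] u n by simp
    also have "prob (?A (u / real n)) = 1 - \<delta>" by (simp add: \<delta>_def)
    also have "(1 - \<delta>) ^ n \<le> exp (- \<delta>) ^ n"
      using exp_ge_add_one_self[of "- \<delta>"] by (intro power_mono) (auto simp: \<delta>_def)
    also have "\<dots> = exp (- (real n * \<delta>))" by (simp add: exp_of_nat_mult[symmetric])
    finally have "exp (real n * \<delta>) < 2" by (simp add: exp_minus field_simps)
    then have "real n * \<delta> < 1" using exp_ge_add_one_self[of "real n * \<delta>"] by linarith
    then show ?thesis using n unfolding \<delta>_def[symmetric] by (simp add: field_simps)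
  qed
  have bound: "laplace M ?T r \<le> (1 - prob (?A v)) + exp (- (r * v))" if r: "0 \<le> r" and v: "0 < v" for r v
  proof -
    have "laplace M ?T r \<le> (LINT \<omega>|M. (1 - indicator (?A v) \<omega>) + exp (- (r * v)))"
      unfolding laplace_eq
    proof (rule integral_mono)
      have int: "integrable M (\<lambda>\<omega>. indicator (?A v) \<omega> :: real)"
        using A by (intro integrable_real_indicator) (auto simp: emeasure_eq_measure)
      show "integrable M (\<lambda>\<omega>. (1 - indicator (?A v) \<omega>) + exp (- (r * v)))"
        using int by (intro Bochner_Integration.integrable_add Bochner_Integration.integrable_diff) auto
      have "norm (kill_exp r (?T \<omega>)) \<le> 1" for \<omega>
        using stage_nonneg[of c "\<lambda>s. X s \<omega>" \<epsilon> "Suc 0"] r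
        by (cases "?T \<omega>") (auto simp: kill_exp_def simp del: stage.simps)
      then show "integrable M (\<lambda>\<omega>. kill_exp r (?T \<omega>))"
        using measurable_compose[OF T kill_exp_measurable] by (intro integrable_const_bound[of _ 1]) auto
      fix \<omega> assume \<omega>: "\<omega> \<in> space M"
      show "kill_exp r (?T \<omega>) \<le> (1 - indicator (?A v) \<omega>) + exp (- (r * v))"
      proof (cases "\<omega> \<in> ?A v")
        case True
        then have "kill_exp r (?T \<omega>) \<le> exp (- (r * v))"
          using r by (cases "?T \<omega>") (auto simp: kill_exp_def intro!: mult_left_mono simp del: stage.simps)
        then show ?thesis using True by simp
      next
        case False
        then show ?thesis using \<open>norm (kill_exp r (?T \<omega>)) \<le> 1\<close>
          by (simp add: add_increasing2 abs_le_iff del: stage.simps)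
      qed
    qed
    also have "\<dots> = (1 - prob (?A v)) + exp (- (r * v))"
      using A by (simp add: prob_space emeasure_eq_measure)
    finally show ?thesis .
  qed
  have "laplace M ?T r \<le> (1 + 2 / u) / sqrt r" if r: "1 \<le> r" for r
  proof -
    \<comment> \<open>Since \<open>sqrt r \<ge> 1\<close>, the ceiling lies between
      \<open>sqrt r\<close> and \<open>2 * sqrt r\<close>. The lower bound controls
      \<open>1 / real n\<close>; the upper one keeps the exponent at least
      \<open>sqrt r * u / 2\<close>, where \<open>exp (- y) \<le> 1 / y\<close> is enough.\<close>
    define n where "n = nat \<lceil>sqrt r\<rceil>"
    have s: "1 \<le> sqrt r" using r by simp
    have n: "sqrt r \<le> real n" "real n \<le> 2 * sqrt r" using s unfolding n_def by linarith+
    then have "0 < n" using s by (cases n) auto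
    note n = n this
    have "0 < real n" using n(3) by simp
    have "laplace M ?T r \<le> (1 - prob (?A (u / real n))) + exp (- (r * (u / real n)))"
      using r u n by (intro bound) auto
    also have "\<dots> \<le> 1 / real n + exp (- (r * (u / real n)))" using small[OF n(3)] by simp
    also have "1 / real n \<le> 1 / sqrt r" using n(1) s by (intro frac_le) auto
    also have "exp (- (r * (u / real n))) \<le> 2 / (u * sqrt r)"
    proof -
      have "sqrt r * u / 2 = r * (u / (2 * sqrt r))"
        using s r by (simp add: field_simps real_sqrt_mult_self flip: power2_eq_square)
      also have "\<dots> \<le> r * (u / real n)"
        using n(2) s r less_imp_le[OF u(1)] \<open>0 < real n\<close> by (intro mult_left_mono frac_le) simp_all
      finally have "exp (- (r * (u / real n))) \<le> exp (- (sqrt r * u / 2))" by simp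
      also have "\<dots> = inverse (exp (sqrt r * u / 2))" by (simp add: exp_minus)
      also have "\<dots> \<le> inverse (sqrt r * u / 2)"
        using u s exp_ge_add_one_self[of "sqrt r * u / 2"] by (intro le_imp_inverse_le) (linarith, simp)
      also have "\<dots> = 2 / (u * sqrt r)" by (simp add: field_simps)
      finally show ?thesis .
    qed
    also have "1 / sqrt r + 2 / (u * sqrt r) = (1 + 2 / u) / sqrt r"
      by (simp add: add_divide_distrib)
    finally show ?thesis by simp
  qed
  then show ?thesis using u by (intro exI[of _ "1 + 2 / u"]) auto
qed

lemma laplace_stage_pos:
  assumes stable: "stable_process \<alpha> M X" and t: "0 < t"
    and mono: "AE \<omega> in M. \<not> monotone_on_some_interval t (\<lambda>s. X s \<omega>)"
    and c: "\<bar>c\<bar> = 1" and r: "0 \<le> r"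
  shows "0 < laplace M (\<lambda>\<omega>. stage (\<lambda>_. c) (\<lambda>s. X s \<omega>) 1 (Suc 0)) r"
proof (rule ccontr)
  let ?T = "\<lambda>b \<omega>. stage (\<lambda>_. c) (\<lambda>s. X s \<omega>) b (Suc 0)"
  have T: "?T b \<in> borel_measurable M" if "0 < b" for b using that by (rule stage_measurable)
  assume *: "\<not> ?thesis"
  have bounds: "0 \<le> kill_exp r (?T 1 \<omega>)" "kill_exp r (?T 1 \<omega>) \<le> 1" for \<omega>
    by (rule kill_exp_bounds[OF r stage_nonneg])+
  then have "0 \<le> laplace M (?T 1) r"
    unfolding laplace_eq by (intro Bochner_Integration.integral_nonneg)
  with * have "(LINT \<omega>|M. kill_exp r (?T 1 \<omega>)) = 0" unfolding laplace_eq by linarith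
  moreover have "integrable M (\<lambda>\<omega>. kill_exp r (?T 1 \<omega>))"
    using measurable_compose[OF T[of 1] kill_exp_measurable] bounds
    by (intro integrable_const_bound[of _ 1]) (auto simp del: stage.simps)
  ultimately have "AE \<omega> in M. kill_exp r (?T 1 \<omega>) = 0"
    using integral_nonneg_eq_0_iff_AE[of M "\<lambda>\<omega>. kill_exp r (?T 1 \<omega>)"] bounds by (simp del: stage.simps)
  then have AE1: "AE \<omega> in M. ?T 1 \<omega> = \<infinity>"
    by (rule AE_mp) (auto simp: kill_exp_def simp del: stage.simps split: if_splits)
  \<comment> \<open>By self-similarity, if level 1 is almost surely never crossed, neither is any
    other positive level.\<close>
  have "AE \<omega> in M. \<not> ?T b \<omega> \<le> ereal q" if b: "0 < b" for b q
  proof -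
    have "prob {\<omega>\<in>space M. ?T 1 \<omega> \<le> ereal (q / b powr \<alpha>)} = 0"
      using AE1 stage_le_sets[of 1 "\<lambda>_. c" "Suc 0"] by (subst prob_eq_0) (auto simp del: stage.simps)
    then have "prob {\<omega>\<in>space M. ?T b \<omega> \<le> ereal q} = 0"
      using prob_stage_scale[OF stable b, of "\<lambda>_. c" "Suc 0" "q / b powr \<alpha>"] b by (simp del: stage.simps)
    then show ?thesis
      using stage_le_sets[OF b, of "\<lambda>_. c" "Suc 0"] by (subst (asm) prob_eq_0) (auto simp del: stage.simps)
  qed
  \<comment> \<open>Countably many levels and horizons are taken so that a single null set serves
    them all.\<close>
  then have "AE \<omega> in M. \<forall>i j. \<not> ?T (1 / real (Suc i)) \<omega> \<le> ereal (real j)"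
    unfolding AE_all_countable by simp
  with mono have "AE \<omega> in M. \<not> monotone_on_some_interval t (\<lambda>s. X s \<omega>) \<and>
      (\<forall>i j. \<not> ?T (1 / real (Suc i)) \<omega> \<le> ereal (real j))"
    by eventually_elim blast
  then have "\<exists>\<omega>\<in>space M. \<not> monotone_on_some_interval t (\<lambda>s. X s \<omega>) \<and>
      (\<forall>i j. \<not> ?T (1 / real (Suc i)) \<omega> \<le> ereal (real j))"
  proof (rule contrapos_pp)
    assume "\<not> (\<exists>\<omega>\<in>space M. \<not> monotone_on_some_interval t (\<lambda>s. X s \<omega>) \<and>
      (\<forall>i j. \<not> ?T (1 / real (Suc i)) \<omega> \<le> ereal (real j)))" (is "\<not> (\<exists>\<omega>\<in>space M. ?Q \<omega>)")
    then have "(AE \<omega> in M. ?Q \<omega>) \<longleftrightarrow> (AE \<omega> in M. False)"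
      by (intro AE_cong) blast
    then show "\<not> (AE \<omega> in M. ?Q \<omega>)" by (simp add: AE_False)
  qed
  then obtain \<omega> where \<omega>: "\<omega> \<in> space M" "\<not> monotone_on_some_interval t (\<lambda>s. X s \<omega>)"
    and never: "\<And>i j. \<not> ?T (1 / real (Suc i)) \<omega> \<le> ereal (real j)"
    by blast
  \<comment> \<open>A positive value would exceed some \<open>1 / real (Suc i)\<close> and produce a
    crossing of that level before \<open>u + 1\<close>.\<close>
  have le: "c * (X v \<omega> - X u \<omega>) \<le> 0" if "0 \<le> v" "v \<le> u" for v u
  proof (rule ccontr)
    assume "\<not> ?thesis"
    then obtain i where "1 / real (Suc i) < c * (X v \<omega> - X u \<omega>)"
      using nat_approx_posE[of "c * (X v \<omega> - X u \<omega>)"] by (auto simp: not_le)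
    then have "?T (1 / real (Suc i)) \<omega> < ereal (u + 1)"
      unfolding stage_Suc_less_iff[OF cadlag_path[OF \<omega>(1)]] using that
      by (intro exI[of _ v] exI[of _ u]) (simp add: zero_ereal_def)
    also have "\<dots> \<le> ereal (real (nat \<lceil>u + 1\<rceil>))" unfolding ereal_less_eq(3) by (rule real_nat_ceiling_ge)
    finally show False using never[of i "nat \<lceil>u + 1\<rceil>"] by (simp del: stage.simps)
  qed
  have "c = 1 \<or> c = -1" using c by linarith
  then have "mono_on {0..t} (\<lambda>s. X s \<omega>) \<or> antimono_on {0..t} (\<lambda>s. X s \<omega>)"
    using le by (auto simp: monotone_on_def)
  then show False
    using \<omega>(2) t unfolding monotone_on_some_interval_def by blast
qed

end

section \<open>Mellin transforms\<close>

lemma cpowr_measurable [measurable]: "(\<lambda>x. complex_of_real x powr s) \<in> borel_measurable borel"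
proof -
  have "(\<lambda>x. complex_of_real x powr s) = (\<lambda>x. if x = 0 then 0 else if 0 < x then exp (s * complex_of_real (ln x))
      else exp (s * (complex_of_real (ln (- x)) + pi * \<i>)))"
    by (rule ext) (simp add: powr_def Ln_of_real')
  also have "\<dots> \<in> borel_measurable borel" by measurable
  finally show ?thesis .
qed

text \<open>Euler's integral after the substitution of \<open>x * \<epsilon>\<close>: the Jacobian
  \<open>x\<close> and the power of order \<open>s - 1\<close> combine to \<open>x powr s\<close>,
  which moves to the other side.\<close>

lemma gamma_integral_scaled:
  assumes s: "0 < Re s" and x: "0 < x"
  shows "(LINT \<epsilon>:{0<..}|lborel. complex_of_real \<epsilon> powr (s - 1) * of_real (exp (- \<epsilon> * x))) =
    Gamma s * complex_of_real x powr (- s)"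
proof -
  let ?f = "\<lambda>\<epsilon>. indicator {0<..} \<epsilon> *\<^sub>R (complex_of_real \<epsilon> powr (s - 1) / of_real (exp \<epsilon>))"
  have [measurable]: "?f \<in> borel_measurable borel" by measurable
  have "integrable lebesgue ?f"
    using absolutely_integrable_Gamma_integral'[OF s] unfolding set_integrable_def .
  then have int: "set_integrable lborel {0<..} (\<lambda>\<epsilon>. complex_of_real \<epsilon> powr (s - 1) / of_real (exp \<epsilon>))"
    unfolding set_integrable_def by (subst (asm) integrable_completion) auto
  have "Gamma s = (LINT \<epsilon>:{0<..}|lborel. complex_of_real \<epsilon> powr (s - 1) / of_real (exp \<epsilon>))"
    using set_borel_integral_eq_integral(2)[OF int] Gamma_integral_complex'[OF s]
    by (simp add: integral_unique)
  also have "\<dots> = \<bar>x\<bar> *\<^sub>R (LINT \<epsilon>|lborel. ?f (0 + x * \<epsilon>))"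
    unfolding set_lebesgue_integral_def by (rule lborel_integral_real_affine) (use x in simp)
  also have "(LINT \<epsilon>|lborel. ?f (0 + x * \<epsilon>)) =
      (LINT \<epsilon>|lborel. complex_of_real x powr (s - 1) * (indicator {0<..} \<epsilon> *\<^sub>R (complex_of_real \<epsilon> powr (s - 1) * of_real (exp (- \<epsilon> * x)))))"
  proof (rule Bochner_Integration.integral_cong[OF refl])
    fix \<epsilon> :: real
    show "?f (0 + x * \<epsilon>) = complex_of_real x powr (s - 1) * (indicator {0<..} \<epsilon> *\<^sub>R (complex_of_real \<epsilon> powr (s - 1) * of_real (exp (- \<epsilon> * x))))"
      using x by (cases "0 < \<epsilon>")
        (simp_all add: indicator_def zero_less_mult_iff powr_times_real exp_minus field_simps)
  qed
  finally have "Gamma s = complex_of_real x * complex_of_real x powr (s - 1) *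
      (LINT \<epsilon>:{0<..}|lborel. complex_of_real \<epsilon> powr (s - 1) * of_real (exp (- \<epsilon> * x)))"
    using x unfolding set_lebesgue_integral_def by (simp add: scaleR_conv_of_real)
  moreover have "complex_of_real x * complex_of_real x powr (s - 1) * complex_of_real x powr (- s) = 1"
  proof -
    have "complex_of_real x powr (1 + (s - 1) + (- s)) = complex_of_real x powr 1 * complex_of_real x powr (s - 1) * complex_of_real x powr (- s)"
      unfolding powr_add ..
    then show ?thesis using x by simp
  qed
  ultimately show ?thesis by (simp add: mult_ac)
qed

lemma Gamma_nonzero: "0 < Re s \<Longrightarrow> Gamma s \<noteq> 0" for s :: complex
  by (auto simp: Gamma_eq_zero_iff nonpos_Ints_def)

text \<open>The kernel has absolute value \<open>\<epsilon> powr (Re s - 1)\<close> times a killed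
  exponential, so \<open>int\<close> is the Tonelli condition for exchanging the integrals.
  Integrating over \<open>\<epsilon>\<close> first gives a Gamma factor times a power of
  \<open>\<tau>\<close>, and the existence of the moment comes along with its value. Where
  \<open>\<tau>\<close> is infinite the kernel vanishes, hence the value 0 there.\<close>

lemma (in prob_space) mellin_laplace:
  assumes \<tau> [measurable]: "\<tau> \<in> borel_measurable M" and pos: "\<And>\<omega>. \<omega> \<in> space M \<Longrightarrow> 0 < \<tau> \<omega>"
    and s: "0 < Re s"
    and int: "set_integrable lborel {0<..} (\<lambda>\<epsilon>. \<epsilon> powr (Re s - 1) * laplace M \<tau> \<epsilon>)"
  shows "integrable M (\<lambda>\<omega>. if \<tau> \<omega> = \<infinity> then 0 else complex_of_real (real_of_ereal (\<tau> \<omega>)) powr (- s))"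
      (is "integrable M ?g")
    and "mellin (\<lambda>\<epsilon>. of_real (laplace M \<tau> \<epsilon>)) s =
      Gamma s * (LINT \<omega>|M. (if \<tau> \<omega> = \<infinity> then 0 else complex_of_real (real_of_ereal (\<tau> \<omega>)) powr (- s)))"
proof -
  interpret P: pair_sigma_finite lborel M ..
  let ?F = "\<lambda>\<epsilon> \<omega>. indicator {0<..} \<epsilon> *\<^sub>R (complex_of_real \<epsilon> powr (s - 1) * of_real (kill_exp \<epsilon> (\<tau> \<omega>)))"
  have kill_pair [measurable]: "(\<lambda>(\<epsilon>, \<omega>). kill_exp \<epsilon> (\<tau> \<omega>)) \<in> borel_measurable (lborel \<Otimes>\<^sub>M M)"
    unfolding kill_exp_def by measurable
  have F_meas: "case_prod ?F \<in> borel_measurable (lborel \<Otimes>\<^sub>M M)"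
    using kill_pair by measurable
  have kill_int: "integrable M (\<lambda>\<omega>. kill_exp \<epsilon> (\<tau> \<omega>))" if "0 < \<epsilon>" for \<epsilon>
  proof (rule integrable_const_bound[of _ 1])
    show "AE \<omega> in M. norm (kill_exp \<epsilon> (\<tau> \<omega>)) \<le> 1"
      using kill_exp_bounds[of \<epsilon>] that pos by (intro AE_I2) (simp add: less_imp_le)
  qed (use \<tau> in measurable)
  have norm_F: "norm (?F \<epsilon> \<omega>) = indicator {0<..} \<epsilon> * (\<epsilon> powr (Re s - 1) * kill_exp \<epsilon> (\<tau> \<omega>))" for \<epsilon> \<omega>
    by (simp add: indicator_def norm_mult norm_powr_real_powr kill_exp_def)
  have "integrable (lborel \<Otimes>\<^sub>M M) (case_prod ?F)"
  proof (rule P.Fubini_integrable[OF F_meas])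
    have "(LINT \<omega>|M. norm (?F \<epsilon> \<omega>)) = indicator {0<..} \<epsilon> *\<^sub>R (\<epsilon> powr (Re s - 1) * laplace M \<tau> \<epsilon>)" for \<epsilon>
      unfolding norm_F laplace_eq by simp
    then show "integrable lborel (\<lambda>\<epsilon>. LINT \<omega>|M. norm (case_prod ?F (\<epsilon>, \<omega>)))"
      using int unfolding set_integrable_def by (simp only: split)
    show "AE \<epsilon> in lborel. integrable M (\<lambda>\<omega>. case_prod ?F (\<epsilon>, \<omega>))"
    proof (rule AE_I2)
      fix \<epsilon> :: real
      show "integrable M (\<lambda>\<omega>. case_prod ?F (\<epsilon>, \<omega>))"
        using kill_int[of \<epsilon>] by (cases "0 < \<epsilon>") (auto intro!: integrable_of_real)
    qed
  qed
  note fub = P.integrable_snd[OF this] P.Fubini_integral[OF this]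
  have inner: "(LINT \<epsilon>|lborel. ?F \<epsilon> \<omega>) = Gamma s * ?g \<omega>" if \<omega>: "\<omega> \<in> space M" for \<omega>
  proof (cases "\<tau> \<omega>")
    case (real x)
    then show ?thesis
      using gamma_integral_scaled[OF s, of x] pos[OF \<omega>]
      by (simp add: kill_exp_def set_lebesgue_integral_def)
  qed (use pos[OF \<omega>] in \<open>auto simp: kill_exp_def\<close>)
  have g_int: "integrable M (\<lambda>\<omega>. Gamma s * ?g \<omega>)"
    using fub(1) by (rule Bochner_Integration.integrable_cong[THEN iffD1, OF refl inner, rotated])
  have "Gamma s \<noteq> 0" by (rule Gamma_nonzero[OF s])
  have "integrable M (\<lambda>\<omega>. inverse (Gamma s) * (Gamma s * ?g \<omega>))"
    by (rule Bochner_Integration.integrable_mult_right) (rule g_int)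
  moreover have "inverse (Gamma s) * (Gamma s * ?g \<omega>) = ?g \<omega>" for \<omega>
    using \<open>Gamma s \<noteq> 0\<close> by (simp add: mult.assoc[symmetric])
  ultimately show "integrable M ?g" by (simp only:)
  have "mellin (\<lambda>\<epsilon>. of_real (laplace M \<tau> \<epsilon>)) s = (LINT \<epsilon>|lborel. LINT \<omega>|M. ?F \<epsilon> \<omega>)"
    unfolding mellin_def set_lebesgue_integral_def laplace_eq
    by (intro Bochner_Integration.integral_cong refl) simp
  also have "\<dots> = (LINT \<omega>|M. LINT \<epsilon>|lborel. ?F \<epsilon> \<omega>)"
    by (rule fub(2)[symmetric])
  also have "\<dots> = (LINT \<omega>|M. Gamma s * ?g \<omega>)"
    by (intro Bochner_Integration.integral_cong refl inner)
  finally show "mellin (\<lambda>\<epsilon>. of_real (laplace M \<tau> \<epsilon>)) s = Gamma s * (LINT \<omega>|M. ?g \<omega>)" by simp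
qed

text \<open>For \<open>a \<le> 0\<close> the function dominates \<open>1 / \<epsilon>\<close> on the
  unit interval, whose integral from \<open>d\<close> to 1 is \<open>- ln d\<close> and hence
  unbounded as \<open>d\<close> tends to 0.\<close>

lemma not_integrable_powr_at_0:
  fixes a :: real
  assumes "set_integrable lborel {0<..1} (\<lambda>\<epsilon>::real. \<epsilon> powr (a - 1))"
  shows "0 < a"
proof (rule ccontr)
  assume "\<not> 0 < a"
  have int: "set_integrable lborel {0<..1} (\<lambda>\<epsilon>::real. 1 / \<epsilon>)"
  proof (rule set_integrable_bound[OF assms])
    show "set_borel_measurable lborel {0<..1} (\<lambda>\<epsilon>::real. 1 / \<epsilon>)"
      unfolding set_borel_measurable_def by measurable
    have "1 / \<epsilon> \<le> \<epsilon> powr (a - 1)" if "0 < \<epsilon>" "\<epsilon> \<le> 1" for \<epsilon> :: real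
      using powr_mono'[of "a - 1" "-1" \<epsilon>] that \<open>\<not> 0 < a\<close> by (simp add: powr_minus_divide)
    then show "AE \<epsilon> in lborel. \<epsilon> \<in> {0<..1} \<longrightarrow> norm (1 / \<epsilon>) \<le> norm (\<epsilon> powr (a - 1))"
      by simp
  qed
  define I :: real where "I = (LINT \<epsilon>:{0<..1}|lborel. 1 / \<epsilon>)"
  have bound: "- ln d \<le> I" if d: "0 < d" "d \<le> 1" for d :: real
  proof -
    have "(LINT \<epsilon>:{d..1}|lborel. 1 / \<epsilon>) = ln 1 - ln d"
      unfolding set_lebesgue_integral_def
      by (rule integral_FTC_Icc[where F=ln])
        (use d in \<open>auto intro!: derivative_eq_intros continuous_intros simp: has_real_derivative_iff_has_vector_derivative[symmetric]\<close>)
    moreover have "(LINT \<epsilon>:{d..1}|lborel. 1 / \<epsilon>) \<le> I"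
      unfolding I_def set_lebesgue_integral_def
    proof (rule integral_mono)
      show "integrable lborel (\<lambda>\<epsilon>. indicator {d..1} \<epsilon> *\<^sub>R (1 / \<epsilon>))"
        using set_integrable_subset[OF int, of "{d..1}"] d unfolding set_integrable_def
        by (auto simp: subset_iff)
      show "integrable lborel (\<lambda>\<epsilon>. indicator {0<..1} \<epsilon> *\<^sub>R (1 / \<epsilon> :: real))"
        using int unfolding set_integrable_def .
    qed (use d in \<open>auto simp: indicator_def\<close>)
    ultimately show ?thesis by simp
  qed
  \<comment> \<open>With this number as \<open>d\<close> the bound would read
    \<open>\<bar>I\<bar> + 1 \<le> I\<close>.\<close>
  have "exp (- \<bar>I\<bar> - 1) \<le> 1" unfolding exp_le_one_iff by linarith
  from bound[OF exp_gt_zero this] show False by simp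
qed

lemma mellin_integrable_iff_norm:
  assumes "f \<in> borel_measurable borel"
  shows "mellin_integrable f s \<longleftrightarrow> set_integrable lborel {0<..} (\<lambda>\<epsilon>. \<epsilon> powr (Re s - 1) * norm (f \<epsilon>))"
proof -
  have "mellin_integrable f s \<longleftrightarrow> integrable lborel (\<lambda>\<epsilon>. norm (indicator {0<..} \<epsilon> *\<^sub>R (complex_of_real \<epsilon> powr (s - 1) * f \<epsilon>)))"
    unfolding mellin_integrable_def set_integrable_def
    by (rule integrable_norm_iff[symmetric]) (use assms in measurable)
  also have "(\<lambda>\<epsilon>. norm (indicator {0<..} \<epsilon> *\<^sub>R (complex_of_real \<epsilon> powr (s - 1) * f \<epsilon>))) =
      (\<lambda>\<epsilon>. indicator {0<..} \<epsilon> *\<^sub>R (\<epsilon> powr (Re s - 1) * norm (f \<epsilon>)))"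
    by (rule ext) (simp add: indicator_def norm_mult norm_powr_real_powr)
  finally show ?thesis unfolding set_integrable_def .
qed

section \<open>Convergence and power series of \<open>G\<close>\<close>

lemma G_integrand_eq:
  assumes "0 < \<phi> \<epsilon>" "\<phi> \<epsilon> \<le> 1" "norm z < 1"
  shows "G_integrand \<phi> z \<epsilon> = z\<^sup>2 * of_real (\<phi> \<epsilon>) / (1 - z * of_real (\<phi> \<epsilon>))"
    and "norm (z * of_real (\<phi> \<epsilon>)) \<le> norm z"
proof -
  show le: "norm (z * of_real (\<phi> \<epsilon>)) \<le> norm z"
    using assms by (simp add: norm_mult mult_left_le)
  show "G_integrand \<phi> z \<epsilon> = z\<^sup>2 * of_real (\<phi> \<epsilon>) / (1 - z * of_real (\<phi> \<epsilon>))"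
  proof (cases "z = 0")
    case False
    have "z * of_real (\<phi> \<epsilon>) \<noteq> 1" using le assms(3) by auto
    then show ?thesis
      using False assms(1) by (simp add: G_integrand_def field_simps power2_eq_square)
  qed (simp add: G_integrand_def)
qed

text \<open>Collects the properties of a Laplace transform from which \<open>G\<close> is analysed.
  Together, \<open>\<phi>_ge\<close> and \<open>\<phi>_pos\<close> keep \<open>\<phi>\<close> away
  from 0 near the origin, which is what forces \<open>Re p > 0\<close>.\<close>

locale laplace_like =
  fixes \<phi> :: "real \<Rightarrow> real"
  assumes \<phi>_measurable [measurable]: "\<phi> \<in> borel_measurable borel"
    and \<phi>_pos: "\<And>r. 0 < r \<Longrightarrow> 0 < \<phi> r"
    and \<phi>_le_1: "\<And>r. 0 < r \<Longrightarrow> \<phi> r \<le> 1"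
    and \<phi>_ge: "\<And>r. 0 < r \<Longrightarrow> r \<le> 1 \<Longrightarrow> \<phi> 1 \<le> \<phi> r"
begin

lemma G_integrand_measurable [measurable]: "G_integrand \<phi> z \<in> borel_measurable borel"
  unfolding G_integrand_def by measurable

text \<open>For \<open>norm z \<le> 1 / 2\<close> the denominator \<open>1 - z * \<phi>\<close> has
  norm between \<open>1 / 2\<close> and 2, so for a fixed nonzero \<open>z\<close> the integrand is
  comparable with \<open>\<phi>\<close>. Convergence therefore depends on \<open>Re p\<close> alone,
  so the admissible exponents fill whole vertical lines.\<close>

lemma set_integrable_iff_G_defined:
  "G_defined \<alpha> \<phi> p \<longleftrightarrow> set_integrable lborel {0<..} (\<lambda>\<epsilon>. \<epsilon> powr (Re (p / of_real \<alpha>) - 1) * \<phi> \<epsilon>)"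
proof
  let ?s = "p / of_real \<alpha>"
  assume "G_defined \<alpha> \<phi> p"
  then obtain d where d: "0 < d" "\<And>z. dist z 0 < d \<Longrightarrow> mellin_integrable (G_integrand \<phi> z) ?s"
    unfolding G_defined_def eventually_nhds_metric by blast
  \<comment> \<open>At \<open>z = 0\<close> the integrand vanishes and carries no information on
    \<open>\<phi>\<close>, so a nonzero point of the neighbourhood is chosen.\<close>
  define z where "z = complex_of_real (min (d / 2) (1 / 2))"
  have z: "dist z 0 < d" "norm z < 1" "z \<noteq> 0" using d(1) by (auto simp: z_def)
  have int: "set_integrable lborel {0<..} (\<lambda>\<epsilon>. \<epsilon> powr (Re ?s - 1) * norm (G_integrand \<phi> z \<epsilon>))"
    using d(2)[OF z(1)] unfolding mellin_integrable_iff_norm[OF G_integrand_measurable] .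
  show "set_integrable lborel {0<..} (\<lambda>\<epsilon>. \<epsilon> powr (Re ?s - 1) * \<phi> \<epsilon>)"
  proof (rule set_integrable_bound)
    show "set_integrable lborel {0<..} (\<lambda>\<epsilon>. 2 / (norm z)\<^sup>2 * (\<epsilon> powr (Re ?s - 1) * norm (G_integrand \<phi> z \<epsilon>)))"
      using int by (rule set_integrable_mult_right)
    show "set_borel_measurable lborel {0<..} (\<lambda>\<epsilon>. \<epsilon> powr (Re ?s - 1) * \<phi> \<epsilon>)"
      unfolding set_borel_measurable_def by measurable
    have "\<phi> \<epsilon> \<le> 2 / (norm z)\<^sup>2 * norm (G_integrand \<phi> z \<epsilon>)" if \<epsilon>: "0 < \<epsilon>" for \<epsilon>
    proof -
      note G = G_integrand_eq[of \<phi>, OF \<phi>_pos[OF \<epsilon>] \<phi>_le_1[OF \<epsilon>] z(2)]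
      have "norm (1 - z * of_real (\<phi> \<epsilon>)) \<le> 1 + norm (z * of_real (\<phi> \<epsilon>))"
        by (metis norm_one norm_triangle_ineq4)
      then have le: "norm (1 - z * of_real (\<phi> \<epsilon>)) \<le> 2" using G(2) z(2) by linarith
      have "1 - z * of_real (\<phi> \<epsilon>) \<noteq> 0" using G(2) z(2) by auto
      then have pos: "0 < norm (1 - z * of_real (\<phi> \<epsilon>))" by simp
      have "2 / (norm z)\<^sup>2 * norm (G_integrand \<phi> z \<epsilon>) = 2 * \<phi> \<epsilon> / norm (1 - z * of_real (\<phi> \<epsilon>))"
        unfolding G(1) using z(3) \<phi>_pos[OF \<epsilon>] by (simp add: norm_divide norm_mult norm_power)
      moreover have "\<phi> \<epsilon> \<le> 2 * \<phi> \<epsilon> / norm (1 - z * of_real (\<phi> \<epsilon>))"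
        using le pos \<phi>_pos[OF \<epsilon>] by (simp add: field_simps)
      ultimately show ?thesis by simp
    qed
    then have "\<epsilon> powr (Re ?s - 1) * \<phi> \<epsilon> \<le> \<epsilon> powr (Re ?s - 1) * (2 / (norm z)\<^sup>2 * norm (G_integrand \<phi> z \<epsilon>))"
      if "0 < \<epsilon>" for \<epsilon>
      using that by (intro mult_left_mono) auto
    then have "\<epsilon> powr (Re ?s - 1) * \<phi> \<epsilon> \<le> 2 / (norm z)\<^sup>2 * (\<epsilon> powr (Re ?s - 1) * norm (G_integrand \<phi> z \<epsilon>))"
      if "0 < \<epsilon>" for \<epsilon>
      using that by (simp add: mult_ac)
    then show "AE \<epsilon> in lborel. \<epsilon> \<in> {0<..} \<longrightarrow> norm (\<epsilon> powr (Re ?s - 1) * \<phi> \<epsilon>) \<le>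
        norm (2 / (norm z)\<^sup>2 * (\<epsilon> powr (Re ?s - 1) * norm (G_integrand \<phi> z \<epsilon>)))"
      using \<phi>_pos by (intro AE_I2) (auto simp: less_imp_le)
  qed
next
  let ?s = "p / of_real \<alpha>"
  assume int: "set_integrable lborel {0<..} (\<lambda>\<epsilon>. \<epsilon> powr (Re ?s - 1) * \<phi> \<epsilon>)"
  have "mellin_integrable (G_integrand \<phi> z) ?s" if z: "norm z < 1 / 2" for z
    unfolding mellin_integrable_iff_norm[OF G_integrand_measurable]
  proof (rule set_integrable_bound[OF int])
    show "set_borel_measurable lborel {0<..} (\<lambda>\<epsilon>. \<epsilon> powr (Re ?s - 1) * norm (G_integrand \<phi> z \<epsilon>))"
      unfolding set_borel_measurable_def by measurable
    have "norm (G_integrand \<phi> z \<epsilon>) \<le> \<phi> \<epsilon>" if \<epsilon>: "0 < \<epsilon>" for \<epsilon>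
    proof -
      have "norm z < 1" using z by simp
      note G = G_integrand_eq[of \<phi>, OF \<phi>_pos[OF \<epsilon>] \<phi>_le_1[OF \<epsilon>] this]
      have "1 - norm (z * of_real (\<phi> \<epsilon>)) \<le> norm (1 - z * of_real (\<phi> \<epsilon>))"
        by (metis norm_one norm_triangle_ineq2)
      then have ge: "1 / 2 \<le> norm (1 - z * of_real (\<phi> \<epsilon>))" using G(2) z by linarith
      have "(norm z)\<^sup>2 \<le> (1 / 2)\<^sup>2" using z by (intro power_mono) auto
      then have "(norm z)\<^sup>2 \<le> 1 / 2" by (simp add: power2_eq_square)
      then have "(norm z)\<^sup>2 \<le> norm (1 - z * of_real (\<phi> \<epsilon>))" using ge by linarith
      then have "(norm z)\<^sup>2 * \<phi> \<epsilon> \<le> norm (1 - z * of_real (\<phi> \<epsilon>)) * \<phi> \<epsilon>"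
        using \<phi>_pos[OF \<epsilon>] by simp
      then show ?thesis
        unfolding G(1) using ge \<phi>_pos[OF \<epsilon>]
        by (simp add: norm_divide norm_mult norm_power divide_le_eq mult.commute)
    qed
    then show "AE \<epsilon> in lborel. \<epsilon> \<in> {0<..} \<longrightarrow> norm (\<epsilon> powr (Re ?s - 1) * norm (G_integrand \<phi> z \<epsilon>)) \<le>
        norm (\<epsilon> powr (Re ?s - 1) * \<phi> \<epsilon>)"
      using \<phi>_pos by (intro AE_I2) (auto simp: less_imp_le intro!: mult_left_mono)
  qed
  then show "G_defined \<alpha> \<phi> p"
    unfolding G_defined_def eventually_nhds_metric by (intro exI[of _ "1 / 2"]) auto
qed

text \<open>Near 0 the factor \<open>\<phi>\<close> is at least \<open>\<phi> 1 > 0\<close>, so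
  integrability passes to the bare power.\<close>

lemma Re_pos:
  fixes a :: real
  assumes int: "set_integrable lborel {0<..} (\<lambda>\<epsilon>. \<epsilon> powr (a - 1) * \<phi> \<epsilon>)"
  shows "0 < a"
proof (rule not_integrable_powr_at_0)
  have "set_integrable lborel {0<..1} (\<lambda>\<epsilon>. 1 / \<phi> 1 * (\<epsilon> powr (a - 1) * \<phi> \<epsilon>))"
    by (rule set_integrable_mult_right[OF set_integrable_subset[OF int]]) auto
  then show "set_integrable lborel {0<..1} (\<lambda>\<epsilon>. \<epsilon> powr (a - 1))"
  proof (rule set_integrable_bound)
    show "set_borel_measurable lborel {0<..1} (\<lambda>\<epsilon>. \<epsilon> powr (a - 1))"
      unfolding set_borel_measurable_def by measurable
    have "\<epsilon> powr (a - 1) \<le> 1 / \<phi> 1 * (\<epsilon> powr (a - 1) * \<phi> \<epsilon>)" if "0 < \<epsilon>" "\<epsilon> \<le> 1" for \<epsilon>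
      using mult_right_mono[OF \<phi>_ge[OF that], of "\<epsilon> powr (a - 1)"] \<phi>_pos[of 1] by (simp add: field_simps)
    then show "AE \<epsilon> in lborel. \<epsilon> \<in> {0<..1} \<longrightarrow> norm (\<epsilon> powr (a - 1)) \<le> norm (1 / \<phi> 1 * (\<epsilon> powr (a - 1) * \<phi> \<epsilon>))"
      using \<phi>_pos by (intro AE_I2) (auto simp: less_imp_le)
  qed
qed

lemma set_integrable_power:
  assumes int: "set_integrable lborel {0<..} (\<lambda>\<epsilon>. \<epsilon> powr a * \<phi> \<epsilon>)"
  shows "set_integrable lborel {0<..} (\<lambda>\<epsilon>. \<epsilon> powr a * \<phi> \<epsilon> ^ Suc m)"
proof (rule set_integrable_bound[OF int])
  show "set_borel_measurable lborel {0<..} (\<lambda>\<epsilon>. \<epsilon> powr a * \<phi> \<epsilon> ^ Suc m)"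
    unfolding set_borel_measurable_def by measurable
  have "\<phi> \<epsilon> ^ Suc m \<le> \<phi> \<epsilon>" if "0 < \<epsilon>" for \<epsilon>
    using \<phi>_pos[OF that] \<phi>_le_1[OF that] by (simp add: mult_left_le power_le_one)
  then show "AE \<epsilon> in lborel. \<epsilon> \<in> {0<..} \<longrightarrow> norm (\<epsilon> powr a * \<phi> \<epsilon> ^ Suc m) \<le> norm (\<epsilon> powr a * \<phi> \<epsilon>)"
    using \<phi>_pos by (intro AE_I2) (auto simp: less_imp_le abs_mult power_abs intro!: mult_left_mono simp del: power_Suc)
qed

text \<open>Because \<open>\<phi> \<le> 1\<close>, the norms of the terms of the geometric series
  integrate to at most \<open>?I * norm z ^ (m + 2)\<close>, which is summable; this justifies
  integration term by term.\<close>

lemma mellin_G_integrand_sums: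
  assumes int: "set_integrable lborel {0<..} (\<lambda>\<epsilon>. \<epsilon> powr (Re s - 1) * \<phi> \<epsilon>)" and z: "norm z < 1"
  shows "(\<lambda>m. mellin (\<lambda>\<epsilon>. of_real (\<phi> \<epsilon> ^ Suc m)) s * z ^ (m + 2)) sums mellin (G_integrand \<phi> z) s"
proof -
  let ?f = "\<lambda>m \<epsilon>. indicator {0<..} \<epsilon> *\<^sub>R (complex_of_real \<epsilon> powr (s - 1) * (of_real (\<phi> \<epsilon> ^ Suc m) * z ^ (m + 2)))"
  let ?I = "LINT \<epsilon>:{0<..}|lborel. \<epsilon> powr (Re s - 1) * \<phi> \<epsilon>"
  have norm_f: "norm (?f m \<epsilon>) = indicator {0<..} \<epsilon> *\<^sub>R (\<epsilon> powr (Re s - 1) * \<phi> \<epsilon> ^ Suc m) * norm z ^ (m + 2)" for m \<epsilon>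
    using \<phi>_pos[of \<epsilon>] by (simp add: indicator_def norm_mult norm_power norm_powr_real_powr abs_mult power_abs less_imp_le del: power_Suc)
  have pow_int: "integrable lborel (\<lambda>\<epsilon>. indicator {0<..} \<epsilon> *\<^sub>R (\<epsilon> powr (Re s - 1) * \<phi> \<epsilon> ^ Suc m))" for m
    using set_integrable_power[OF int] unfolding set_integrable_def .
  have f_meas [measurable]: "?f m \<in> borel_measurable lborel" for m by measurable
  have norm_int: "integrable lborel (\<lambda>\<epsilon>. norm (?f m \<epsilon>))" for m
    unfolding norm_f using pow_int by (rule integrable_mult_left)
  then have f_int: "integrable lborel (?f m)" for m
    using integrable_norm_iff[OF f_meas] by blast
  have sum_eq: "?f m \<epsilon> = indicator {0<..} \<epsilon> *\<^sub>R (complex_of_real \<epsilon> powr (s - 1) * z\<^sup>2 * of_real (\<phi> \<epsilon>)) * (z * of_real (\<phi> \<epsilon>)) ^ m" for m \<epsilon>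
    by (simp add: power_mult_distrib power_add power2_eq_square mult_ac)
  have zphi: "norm (z * of_real (\<phi> \<epsilon>)) < 1" if "0 < \<epsilon>" for \<epsilon>
    using G_integrand_eq(2)[of \<phi>, OF \<phi>_pos[OF that] \<phi>_le_1[OF that] z] z by linarith
  have ptwise: "(\<lambda>m. ?f m \<epsilon>) sums (indicator {0<..} \<epsilon> *\<^sub>R (complex_of_real \<epsilon> powr (s - 1) * G_integrand \<phi> z \<epsilon>))" for \<epsilon>
  proof (cases "0 < \<epsilon>")
    case True
    have "(\<lambda>m. ?f m \<epsilon>) sums (indicator {0<..} \<epsilon> *\<^sub>R (complex_of_real \<epsilon> powr (s - 1) * z\<^sup>2 * of_real (\<phi> \<epsilon>)) * (1 / (1 - z * of_real (\<phi> \<epsilon>))))"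
      unfolding sum_eq using zphi[OF True] by (intro sums_mult geometric_sums)
    then show ?thesis
      unfolding G_integrand_eq(1)[of \<phi>, OF \<phi>_pos[OF True] \<phi>_le_1[OF True] z]
      using True by (simp add: indicator_def mult.assoc)
  qed simp
  have "AE \<epsilon> in lborel. summable (\<lambda>m. norm (?f m \<epsilon>))"
  proof (rule AE_I2)
    fix \<epsilon> :: real
    show "summable (\<lambda>m. norm (?f m \<epsilon>))"
    proof (cases "0 < \<epsilon>")
      case True
      show ?thesis
        unfolding sum_eq norm_mult norm_power using zphi[OF True]
        by (intro summable_mult summable_geometric) (simp add: norm_mult)
    qed simp
  qed
  moreover have "summable (\<lambda>m. LINT \<epsilon>|lborel. norm (?f m \<epsilon>))"
  proof (rule summable_comparison_test')
    show "summable (\<lambda>m. ?I * norm z ^ 2 * norm z ^ m)"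
      using z by (intro summable_mult summable_geometric) simp
    fix m :: nat
    have "(LINT \<epsilon>|lborel. norm (?f m \<epsilon>)) = (LINT \<epsilon>|lborel. indicator {0<..} \<epsilon> *\<^sub>R (\<epsilon> powr (Re s - 1) * \<phi> \<epsilon> ^ Suc m)) * norm z ^ (m + 2)"
      unfolding norm_f by simp
    also have "\<dots> \<le> ?I * norm z ^ (m + 2)"
      unfolding set_lebesgue_integral_def
    proof (intro mult_right_mono integral_mono pow_int)
      show "integrable lborel (\<lambda>\<epsilon>. indicator {0<..} \<epsilon> *\<^sub>R (\<epsilon> powr (Re s - 1) * \<phi> \<epsilon>))"
        using int unfolding set_integrable_def .
      have "\<phi> \<epsilon> ^ Suc m \<le> \<phi> \<epsilon>" if "0 < \<epsilon>" for \<epsilon>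
        using \<phi>_pos[OF that] \<phi>_le_1[OF that] by (simp add: mult_left_le power_le_one)
      then show "indicator {0<..} \<epsilon> *\<^sub>R (\<epsilon> powr (Re s - 1) * \<phi> \<epsilon> ^ Suc m) \<le> indicator {0<..} \<epsilon> *\<^sub>R (\<epsilon> powr (Re s - 1) * \<phi> \<epsilon>)" for \<epsilon>
        by (auto simp: indicator_def intro!: mult_left_mono simp del: power_Suc)
    qed simp
    finally show "norm (LINT \<epsilon>|lborel. norm (?f m \<epsilon>)) \<le> ?I * norm z ^ 2 * norm z ^ m"
      by (simp add: power_add mult_ac power2_eq_square)
  qed
  ultimately have "(\<lambda>m. LINT \<epsilon>|lborel. ?f m \<epsilon>) sums (LINT \<epsilon>|lborel. (\<Sum>m. ?f m \<epsilon>))"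
    using f_int by (intro sums_integral)
  moreover have "(\<Sum>m. ?f m \<epsilon>) = indicator {0<..} \<epsilon> *\<^sub>R (complex_of_real \<epsilon> powr (s - 1) * G_integrand \<phi> z \<epsilon>)" for \<epsilon>
    using ptwise by (rule sums_unique[symmetric])
  moreover have "(LINT \<epsilon>|lborel. ?f m \<epsilon>) = mellin (\<lambda>\<epsilon>. of_real (\<phi> \<epsilon> ^ Suc m)) s * z ^ (m + 2)" for m
  proof -
    have "(LINT \<epsilon>|lborel. ?f m \<epsilon>) = (LINT \<epsilon>|lborel. indicator {0<..} \<epsilon> *\<^sub>R (complex_of_real \<epsilon> powr (s - 1) * of_real (\<phi> \<epsilon> ^ Suc m)) * z ^ (m + 2))"
      by (intro Bochner_Integration.integral_cong refl) (simp add: mult_ac)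
    also have "\<dots> = mellin (\<lambda>\<epsilon>. of_real (\<phi> \<epsilon> ^ Suc m)) s * z ^ (m + 2)"
      unfolding mellin_def set_lebesgue_integral_def by (rule integral_mult_left_zero)
    finally show ?thesis .
  qed
  ultimately show ?thesis unfolding mellin_def set_lebesgue_integral_def by simp
qed

lemma
  assumes "G_defined \<alpha> \<phi> p" and k: "2 \<le> k"
  shows G_analytic: "(\<lambda>z. G \<alpha> t \<phi> z p) analytic_on {0}"
    and G_deriv: "1 / fact k * (deriv ^^ k) (\<lambda>z. G \<alpha> t \<phi> z p) 0 =
      complex_of_real t powr (p / of_real \<alpha>) / Gamma (p / of_real \<alpha>) *
      mellin (\<lambda>\<epsilon>. of_real (\<phi> \<epsilon> ^ (k - 1))) (p / of_real \<alpha>)"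
proof -
  let ?s = "p / of_real \<alpha>"
  let ?K = "complex_of_real t powr ?s / Gamma ?s"
  have int: "set_integrable lborel {0<..} (\<lambda>\<epsilon>. \<epsilon> powr (Re ?s - 1) * \<phi> \<epsilon>)"
    using assms(1) unfolding set_integrable_iff_G_defined .
  \<comment> \<open>The series starts at \<open>z\<^sup>2\<close>, so the coefficients of index 0
    and 1 are filled with 0; the shift by 2 then pairs \<open>z ^ n\<close> with the power
    \<open>n - 1\<close> of \<open>\<phi>\<close>.\<close>
  define a where "a n = (if n < 2 then 0 else ?K * mellin (\<lambda>\<epsilon>. of_real (\<phi> \<epsilon> ^ (n - 1))) ?s)" for n :: nat
  have sums: "(\<lambda>n. a n * z ^ n) sums G \<alpha> t \<phi> z p" if z: "norm z < 1" for z
  proof -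
    have "(\<lambda>m. ?K * (mellin (\<lambda>\<epsilon>. of_real (\<phi> \<epsilon> ^ Suc m)) ?s * z ^ (m + 2))) sums G \<alpha> t \<phi> z p"
      unfolding G_def by (intro sums_mult mellin_G_integrand_sums int z)
    also have "(\<lambda>m. ?K * (mellin (\<lambda>\<epsilon>. of_real (\<phi> \<epsilon> ^ Suc m)) ?s * z ^ (m + 2))) = (\<lambda>m. a (m + 2) * z ^ (m + 2))"
      by (simp add: a_def mult.assoc)
    finally have "(\<lambda>n. a n * z ^ n) sums (G \<alpha> t \<phi> z p + (\<Sum>n<2. a n * z ^ n))"
      by (rule sums_iff_shift[THEN iffD1])
    moreover have "(\<Sum>n<2. a n * z ^ n) = 0"
      by (rule sum.neutral) (simp add: a_def)
    ultimately show ?thesis by simp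
  qed
  have exp: "(\<lambda>z. G \<alpha> t \<phi> z p) has_fps_expansion Abs_fps a"
    unfolding has_fps_expansion_def
  proof
    have "summable (\<lambda>n. a n * (1 / 2) ^ n)"
      using sums[of "1 / 2"] by (auto simp: sums_iff)
    then have "norm (1 / 2 :: complex) \<le> fps_conv_radius (Abs_fps a)"
      unfolding fps_conv_radius_def by (intro conv_radius_geI) simp
    then show "0 < fps_conv_radius (Abs_fps a)"
      by (rule less_le_trans[rotated]) (simp add: zero_ereal_def)
    show "\<forall>\<^sub>F z in nhds 0. eval_fps (Abs_fps a) z = G \<alpha> t \<phi> z p"
      unfolding eventually_nhds_metric
    proof (intro exI[of _ 1] conjI allI impI)
      fix z :: complex assume "dist z 0 < 1"
      then show "eval_fps (Abs_fps a) z = G \<alpha> t \<phi> z p"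
        using sums[of z] by (simp add: eval_fps_def sums_iff)
    qed simp
  qed
  show "(\<lambda>z. G \<alpha> t \<phi> z p) analytic_on {0}"
    by (rule has_fps_expansion_imp_analytic_0[OF exp])
  have "a k = (deriv ^^ k) (\<lambda>z. G \<alpha> t \<phi> z p) 0 / fact k"
    using fps_nth_fps_expansion[OF exp, of k] by simp
  then show "1 / fact k * (deriv ^^ k) (\<lambda>z. G \<alpha> t \<phi> z p) 0 = ?K * mellin (\<lambda>\<epsilon>. of_real (\<phi> \<epsilon> ^ (k - 1))) ?s"
    using k by (simp add: a_def)
qed

end

section \<open>Laws on the half line determined by moments on a vertical line\<close>

lemma Complex_0: "Complex a 0 = complex_of_real a"
  by (simp add: complex_of_real_def)

text \<open>The law of \<open>ln x\<close> under \<open>\<mu>\<close> reweighted by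
  \<open>x powr c\<close>, i.e. an exponential tilt of the logarithm. The indicator discards an atom
  at 0, and \<open>m\<close> is the normalising constant, the moment of order
  \<open>c\<close>.\<close>

definition log_tilt :: "real measure \<Rightarrow> real \<Rightarrow> real \<Rightarrow> real measure" where
  "log_tilt \<mu> c m = distr (density \<mu> (\<lambda>x. ennreal (indicator {0<..} x * x powr c / m))) borel ln"

text \<open>On the positive half line \<open>x powr Complex c y\<close> is \<open>x powr c\<close>
  times \<open>iexp (y * ln x)\<close>, and at 0 everything vanishes; so the moments of real part
  \<open>c\<close> are, up to \<open>m\<close>, the characteristic function of the tilted law. The
  last claim undoes the tilt.\<close>

lemma
  fixes \<mu> :: "real measure"
  assumes \<mu>: "prob_space \<mu>" "sets \<mu> = sets borel" and nonneg: "AE x in \<mu>. 0 \<le> x"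
    and int: "\<And>y. integrable \<mu> (\<lambda>x. complex_of_real x powr Complex c y)"
    and m: "m = Re (LINT x|\<mu>. complex_of_real x powr of_real c)" "0 < m"
  shows real_distribution_log_tilt: "real_distribution (log_tilt \<mu> c m)"
    and char_log_tilt: "char (log_tilt \<mu> c m) y = (LINT x|\<mu>. complex_of_real x powr Complex c y) / of_real m"
    and emeasure_log_tilt: "B \<in> sets borel \<Longrightarrow> emeasure \<mu> (B \<inter> {0<..}) =
      (\<integral>\<^sup>+l. ennreal (m * exp (- c * l)) * indicator B (exp l) \<partial>log_tilt \<mu> c m)"
proof -
  note [measurable_cong] = \<mu>(2)
  have [measurable]: "(ln :: real \<Rightarrow> real) \<in> borel_measurable borel"
    using borel_measurable_ln[of "\<lambda>x. x" borel] by simp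
  have [measurable]: "(\<lambda>x. complex_of_real x powr s) \<in> borel_measurable \<mu>" for s
    by measurable
  let ?g = "\<lambda>x. indicator {0<..} x * x powr c / m"
  have [measurable]: "?g \<in> borel_measurable \<mu>" by measurable
  have g0: "0 \<le> ?g x" for x using m(2) by simp
  have tilt: "AE x in \<mu>. ?g x *\<^sub>R iexp (y * ln x) = complex_of_real x powr Complex c y / of_real m" for y
    using nonneg
  proof eventually_elim
    case (elim x)
    show ?case
    proof (cases "x = 0")
      case False
      then have "0 < x" using elim by simp
      then have "complex_of_real x powr Complex c y = exp (Complex c y * of_real (ln x))"
        by (simp add: powr_def Ln_of_real)
      also have "\<dots> = exp (of_real (c * ln x)) * iexp (y * ln x)"
        unfolding exp_add[symmetric] by (simp add: Complex_eq algebra_simps)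
      also have "exp (of_real (c * ln x)) = complex_of_real (x powr c)"
        using \<open>0 < x\<close> by (simp add: powr_def flip: exp_of_real)
      finally show ?thesis using \<open>0 < x\<close> by (simp add: scaleR_conv_of_real)
    qed simp
  qed
  have tilt0: "AE x in \<mu>. complex_of_real (?g x) = complex_of_real x powr of_real c / of_real m"
    using tilt[of 0] by eventually_elim (simp add: scaleR_conv_of_real Complex_0)
  have "integrable \<mu> (\<lambda>x. complex_of_real x powr of_real c / of_real m)"
    using int[of 0] by (simp add: Complex_0)
  then have "integrable \<mu> (\<lambda>x. complex_of_real (?g x))"
    using tilt0 by (subst integrable_cong_AE) auto
  then have g_int: "integrable \<mu> ?g" by (simp only: complex_of_real_integrable_eq)
  have "complex_of_real (LINT x|\<mu>. ?g x) = (LINT x|\<mu>. complex_of_real (?g x))"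
    by (rule integral_complex_of_real[symmetric])
  also have "\<dots> = (LINT x|\<mu>. complex_of_real x powr of_real c / of_real m)"
    by (rule integral_cong_AE) (use tilt0 in auto)
  also have "\<dots> = (LINT x|\<mu>. complex_of_real x powr of_real c) / of_real m" by simp
  finally have "Re (complex_of_real (LINT x|\<mu>. ?g x)) = Re ((LINT x|\<mu>. complex_of_real x powr of_real c) / of_real m)"
    by (simp only:)
  then have g_1: "(LINT x|\<mu>. ?g x) = 1"
    using m by (simp add: Re_divide_of_real)
  have "prob_space (density \<mu> (\<lambda>x. ennreal (?g x)))"
  proof (rule prob_spaceI)
    have "(\<integral>\<^sup>+x. ennreal (?g x) \<partial>\<mu>) = ennreal 1"
      using nn_integral_eq_integral[OF g_int] g0 g_1 by simp
    then show "emeasure (density \<mu> (\<lambda>x. ennreal (?g x))) (space (density \<mu> (\<lambda>x. ennreal (?g x)))) = 1"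
      by (simp add: emeasure_density nn_integral_set_ennreal cong: nn_integral_cong)
  qed
  then have "prob_space (log_tilt \<mu> c m)"
    unfolding log_tilt_def by (rule prob_space.prob_space_distr) simp
  then show "real_distribution (log_tilt \<mu> c m)"
    unfolding real_distribution_def real_distribution_axioms_def by (simp add: log_tilt_def)
  have "char (log_tilt \<mu> c m) y = (LINT x|\<mu>. ?g x *\<^sub>R iexp (y * ln x))"
    unfolding char_def log_tilt_def using g0
    by (subst integral_distr) (auto simp: integral_density)
  also have "\<dots> = (LINT x|\<mu>. complex_of_real x powr Complex c y / of_real m)"
    by (rule integral_cong_AE) (use tilt[of y] in auto)
  finally show "char (log_tilt \<mu> c m) y = (LINT x|\<mu>. complex_of_real x powr Complex c y) / of_real m"
    by simp
  assume [measurable]: "B \<in> sets borel"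
  have "(\<integral>\<^sup>+l. ennreal (m * exp (- c * l)) * indicator B (exp l) \<partial>log_tilt \<mu> c m) =
      (\<integral>\<^sup>+x. ennreal (?g x) * (ennreal (m * exp (- c * ln x)) * indicator B (exp (ln x))) \<partial>\<mu>)"
    unfolding log_tilt_def by (subst nn_integral_distr) (auto simp: nn_integral_density)
  also have "\<dots> = (\<integral>\<^sup>+x. indicator (B \<inter> {0<..}) x \<partial>\<mu>)"
  proof (rule nn_integral_cong)
    fix x
    show "ennreal (?g x) * (ennreal (m * exp (- c * ln x)) * indicator B (exp (ln x))) = indicator (B \<inter> {0<..}) x"
    proof (cases "0 < x")
      case True
      have "ennreal (?g x) * ennreal (m * exp (- c * ln x)) = ennreal (?g x * (m * exp (- c * ln x)))"
        using m(2) by (intro ennreal_mult'[symmetric]) simp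
      also have "?g x * (m * exp (- c * ln x)) = 1"
        using True m(2) by (simp add: powr_def exp_minus field_simps)
      finally show ?thesis using True by (simp add: mult.assoc[symmetric] indicator_def)
    qed simp
  qed
  also have "\<dots> = emeasure \<mu> (B \<inter> {0<..})"
    by (rule nn_integral_indicator) (simp add: \<mu>(2))
  finally show "emeasure \<mu> (B \<inter> {0<..}) = (\<integral>\<^sup>+l. ennreal (m * exp (- c * l)) * indicator B (exp l) \<partial>log_tilt \<mu> c m)"
    by (rule sym)
qed

text \<open>Equal moments on the line make the tilted laws equal by Levy's uniqueness theorem, and
  undoing the tilt gives equality on the positive half line. Any mass at 0 is invisible to the
  moments but is fixed by the total mass.\<close>

theorem nonneg_measure_eqI_moments_on_line:
  fixes \<mu> \<nu> :: "real measure"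
  assumes \<mu>: "prob_space \<mu>" "sets \<mu> = sets borel" "AE x in \<mu>. 0 \<le> x"
    and \<nu>: "prob_space \<nu>" "sets \<nu> = sets borel" "AE x in \<nu>. 0 \<le> x"
    and int_\<mu>: "\<And>y. integrable \<mu> (\<lambda>x. complex_of_real x powr Complex c y)"
    and int_\<nu>: "\<And>y. integrable \<nu> (\<lambda>x. complex_of_real x powr Complex c y)"
    and eq: "\<And>y. (LINT x|\<mu>. complex_of_real x powr Complex c y) = (LINT x|\<nu>. complex_of_real x powr Complex c y)"
  shows "\<mu> = \<nu>"
proof -
  define mass where "mass \<rho> = Re (LINT x|\<rho>. complex_of_real x powr of_real c)" for \<rho> :: "real measure"
  have mass_eq: "mass \<mu> = mass \<nu>"
    using eq[of 0] by (simp add: mass_def Complex_0)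
  have mass_real: "mass \<rho> = (LINT x|\<rho>. indicator {0<..} x * x powr c)"
      "integrable \<rho> (\<lambda>x. indicator {0<..} x * x powr c)"
    if \<rho>: "sets \<rho> = sets borel" "AE x in \<rho>. 0 \<le> x"
      "\<And>y. integrable \<rho> (\<lambda>x. complex_of_real x powr Complex c y)" for \<rho> :: "real measure"
  proof -
    note [measurable_cong] = \<rho>(1)
    have [measurable]: "(\<lambda>x. complex_of_real x powr s) \<in> borel_measurable \<rho>" for s by measurable
    have AE: "AE x in \<rho>. complex_of_real x powr of_real c = of_real (indicator {0<..} x * x powr c)"
      using \<rho>(2)
    proof eventually_elim
      case (elim x)
      then show ?case by (cases "x = 0") (simp_all add: powr_of_real)
    qed
    have "integrable \<rho> (\<lambda>x. complex_of_real x powr of_real c)"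
      using \<rho>(3)[of 0] by (simp add: Complex_0)
    then have "integrable \<rho> (\<lambda>x. complex_of_real (indicator {0<..} x * x powr c))"
      using AE by (subst (asm) integrable_cong_AE) auto
    then show "integrable \<rho> (\<lambda>x. indicator {0<..} x * x powr c)"
      by (simp only: complex_of_real_integrable_eq)
    have "(LINT x|\<rho>. complex_of_real x powr of_real c) = (LINT x|\<rho>. of_real (indicator {0<..} x * x powr c))"
      by (rule integral_cong_AE) (use AE in auto)
    then show "mass \<rho> = (LINT x|\<rho>. indicator {0<..} x * x powr c)"
      unfolding mass_def by (simp only: integral_complex_of_real Re_complex_of_real)
  qed
  have positive: "emeasure \<mu> (B \<inter> {0<..}) = emeasure \<nu> (B \<inter> {0<..})" if B: "B \<in> sets borel" for B
  proof (cases "0 < mass \<mu>")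
    case True
    note m = mass_def[of \<mu>] True and m' = mass_eq[unfolded mass_def[of \<nu>]] True
    have "char (log_tilt \<mu> c (mass \<mu>)) = char (log_tilt \<nu> c (mass \<mu>))"
      using char_log_tilt[OF \<mu> int_\<mu> m] char_log_tilt[OF \<nu> int_\<nu> m'] eq by (simp add: fun_eq_iff)
    then have "log_tilt \<mu> c (mass \<mu>) = log_tilt \<nu> c (mass \<mu>)"
      by (intro Levy_uniqueness real_distribution_log_tilt[OF \<mu> int_\<mu> m] real_distribution_log_tilt[OF \<nu> int_\<nu> m'])
    then show ?thesis
      using emeasure_log_tilt[OF \<mu> int_\<mu> m B] emeasure_log_tilt[OF \<nu> int_\<nu> m' B] by simp
  next
    case False
    \<comment> \<open>If the moment of order \<open>c\<close> is 0 there is nothing to normalise; it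
      then forces each of the two measures to put no mass on the positive half line.\<close>
    have "emeasure \<rho> (B \<inter> {0<..}) = 0"
      if \<rho>: "sets \<rho> = sets borel" "AE x in \<rho>. 0 \<le> x"
        "\<And>y. integrable \<rho> (\<lambda>x. complex_of_real x powr Complex c y)" and "mass \<rho> = mass \<mu>" for \<rho> :: "real measure"
    proof -
      note [measurable_cong] = \<rho>(1)
      note mr = mass_real[OF \<rho>]
      have "0 \<le> mass \<rho>" unfolding mr(1) by (rule Bochner_Integration.integral_nonneg) simp
      then have "(LINT x|\<rho>. indicator {0<..} x * x powr c) = 0"
        using False \<open>mass \<rho> = mass \<mu>\<close> mr(1) by simp
      then have "AE x in \<rho>. indicator {0<..} x * x powr c = 0"
        using integral_nonneg_eq_0_iff_AE[OF mr(2)] by simp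
      then have "AE x in \<rho>. x \<notin> B \<inter> {0<..}"
        by eventually_elim (auto simp: indicator_def)
      then show ?thesis
        using AE_iff_null_sets[of "B \<inter> {0<..}" \<rho>] B \<rho>(1) by auto
    qed
    then show ?thesis using \<mu> \<nu> int_\<mu> int_\<nu> mass_eq by simp
  qed
  show ?thesis
  proof (rule measure_eqI_lessThan)
    fix a :: real
    interpret \<mu>: prob_space \<mu> by (rule \<mu>(1))
    interpret \<nu>: prob_space \<nu> by (rule \<nu>(1))
    show "emeasure \<mu> {a<..} < \<infinity>" by (simp add: \<mu>.emeasure_eq_measure)
    show "emeasure \<mu> {a<..} = emeasure \<nu> {a<..}"
    proof (cases "0 \<le> a")
      case True
      then have "{a<..} \<inter> {0<..} = {a<..}" by auto
      then show ?thesis using positive[of "{a<..}"] by simp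
    next
      case False
      \<comment> \<open>For negative \<open>a\<close> the tail contains the nonnegative half line,
        so it has mass 1 under both measures.\<close>
      have "AE x in \<mu>. x \<in> {a<..}" using \<mu>(3) False by (auto elim: eventually_mono)
      moreover have "AE x in \<nu>. x \<in> {a<..}" using \<nu>(3) False by (auto elim: eventually_mono)
      ultimately show ?thesis
        using \<mu>.emeasure_eq_1_AE[of "{a<..}"] \<nu>.emeasure_eq_1_AE[of "{a<..}"] \<mu>(2) \<nu>(2) by simp
    qed
  qed (use \<mu> \<nu> in auto)
qed

section \<open>The Mellin transform of a bar length\<close>

lemma (in prob_space) kill_exp_integrable:
  assumes "U \<in> borel_measurable M" "AE \<omega> in M. 0 \<le> U \<omega>" "0 \<le> r"
  shows "integrable M (\<lambda>\<omega>. kill_exp r (U \<omega>))"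
proof (rule integrable_const_bound[of _ 1])
  show "AE \<omega> in M. norm (kill_exp r (U \<omega>)) \<le> 1"
    using assms(2) by eventually_elim (use kill_exp_bounds[OF assms(3)] in simp)
qed (use assms(1) in measurable)

lemma (in prob_space) laplace_indep_sum:
  assumes indep: "indep_var borel S borel T"
    and nonneg: "AE \<omega> in M. 0 \<le> S \<omega>" "AE \<omega> in M. 0 \<le> T \<omega>" and r: "0 \<le> r"
  shows "laplace M (\<lambda>\<omega>. S \<omega> + T \<omega>) r = laplace M S r * laplace M T r"
proof -
  have [measurable]: "S \<in> borel_measurable M" "T \<in> borel_measurable M"
    using indep_var_rv1[OF indep] indep_var_rv2[OF indep] by auto
  have "laplace M (\<lambda>\<omega>. S \<omega> + T \<omega>) r = (LINT \<omega>|M. kill_exp r (S \<omega>) * kill_exp r (T \<omega>))"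
    unfolding laplace_eq
  proof (rule integral_cong_AE)
    show "AE \<omega> in M. kill_exp r (S \<omega> + T \<omega>) = kill_exp r (S \<omega>) * kill_exp r (T \<omega>)"
      using nonneg by eventually_elim (rule kill_exp_add)
  qed measurable
  also have "\<dots> = laplace M S r * laplace M T r"
    unfolding laplace_eq
  proof (rule indep_var_lebesgue_integral)
    show "indep_var borel (\<lambda>\<omega>. kill_exp r (S \<omega>)) borel (\<lambda>\<omega>. kill_exp r (T \<omega>))"
      using indep_var_compose[OF indep kill_exp_measurable kill_exp_measurable] by (simp add: comp_def)
  qed (use nonneg r in \<open>auto intro: kill_exp_integrable\<close>)
  finally show ?thesis .
qed

lemma laplace_distr_cong:
  assumes "S \<in> borel_measurable N" "D \<in> borel_measurable M" "distr N borel S = distr M borel D"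
  shows "laplace N S r = laplace M D r"
proof -
  have "laplace K V r = (LINT \<tau>|distr K borel V. kill_exp r \<tau>)" if "V \<in> borel_measurable K" for K :: "'c measure" and V
    unfolding laplace_eq by (rule integral_distr[symmetric]) (use that in auto)
  note this[OF assms(1)]
  moreover have "laplace K V r = (LINT \<tau>|distr K borel V. kill_exp r \<tau>)" if "V \<in> borel_measurable K" for K :: "'b measure" and V
    unfolding laplace_eq by (rule integral_distr[symmetric]) (use that in auto)
  note this[OF assms(2)]
  ultimately show ?thesis using assms(3) by simp
qed

lemma AE_nonneg_distr_cong:
  fixes S :: "'b \<Rightarrow> ereal"
  assumes "S \<in> borel_measurable N" "D \<in> borel_measurable M" "distr N borel S = distr M borel D"
    and "\<And>\<omega>. 0 \<le> D \<omega>"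
  shows "AE \<omega> in N. 0 \<le> S \<omega>"
proof -
  have "AE \<tau> in distr M borel D. 0 \<le> \<tau>"
    using assms(2,4) by (subst AE_distr_iff) auto
  then show ?thesis
    unfolding assms(3)[symmetric] using assms(1) by (subst (asm) AE_distr_iff) auto
qed

lemma (in prob_space) laplace_like_laplace:
  assumes U [measurable]: "U \<in> borel_measurable M" and nonneg: "AE \<omega> in M. 0 \<le> U \<omega>"
    and pos: "\<And>r. 0 < r \<Longrightarrow> 0 < laplace M U r"
  shows "laplace_like (laplace M U)"
proof
  have "(\<lambda>(r, \<omega>). kill_exp r (U \<omega>)) \<in> borel_measurable (borel \<Otimes>\<^sub>M M)"
    unfolding kill_exp_def by measurable
  then have "(\<lambda>r. LINT \<omega>|M. kill_exp r (U \<omega>)) \<in> borel_measurable borel"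
    by (rule borel_measurable_lebesgue_integral)
  then show "laplace M U \<in> borel_measurable borel"
    by (simp add: laplace_eq[abs_def])
  fix r :: real assume r: "0 < r"
  note int = kill_exp_integrable[OF U nonneg]
  show "0 < laplace M U r" by (rule pos) fact
  have "laplace M U r \<le> (LINT \<omega>|M. 1)"
    unfolding laplace_eq
  proof (rule integral_mono_AE)
    show "AE \<omega> in M. kill_exp r (U \<omega>) \<le> 1"
      using nonneg by eventually_elim (use r kill_exp_bounds in simp)
  qed (use int r in auto)
  then show "laplace M U r \<le> 1" by (simp add: prob_space)
  assume r1: "r \<le> 1"
  show "laplace M U 1 \<le> laplace M U r"
    unfolding laplace_eq
  proof (rule integral_mono_AE)
    show "AE \<omega> in M. kill_exp 1 (U \<omega>) \<le> kill_exp r (U \<omega>)"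
      using nonneg
    proof eventually_elim
      case (elim \<omega>)
      then show ?case using r r1 by (cases "U \<omega>") (auto simp: kill_exp_def mult_left_le_one_le intro: mult_right_mono)
    qed
  qed (use int r in auto)
qed

text \<open>Near 0 the bound \<open>\<phi> \<le> 1\<close> leaves the integrable power
  \<open>- 3 / 4\<close>; at infinity the decay improves it to
  \<open>- 3 / 4 - 1 / 2 = - 5 / 4\<close>, integrable there.\<close>

lemma set_integrable_powr_bound:
  fixes \<phi> :: "real \<Rightarrow> real"
  assumes [measurable]: "\<phi> \<in> borel_measurable borel"
    and \<phi>: "\<And>r. 0 < r \<Longrightarrow> 0 \<le> \<phi> r" "\<And>r. 0 < r \<Longrightarrow> \<phi> r \<le> 1" "\<And>r. 1 \<le> r \<Longrightarrow> \<phi> r \<le> C / sqrt r"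
  shows "set_integrable lborel {0<..} (\<lambda>\<epsilon>. \<epsilon> powr (1 / 4 - 1) * \<phi> \<epsilon>)"
proof -
  have lborelI: "set_integrable lborel A f"
    if "f integrable_on A" "A \<in> sets borel" "f \<in> borel_measurable borel" "\<And>x. 0 \<le> f x" for f :: "real \<Rightarrow> real" and A
  proof -
    have "f absolutely_integrable_on A"
      using that by (intro nonnegative_absolutely_integrable_1) auto
    then have "integrable lebesgue (\<lambda>x. indicator A x *\<^sub>R f x)" unfolding set_integrable_def .
    then show ?thesis
      unfolding set_integrable_def using that(2,3) by (subst (asm) integrable_completion) auto
  qed
  have 1: "set_integrable lborel {0..1} (\<lambda>\<epsilon>::real. \<epsilon> powr (- 3 / 4))"
    by (rule lborelI) (auto intro!: integrable_on_powr_from_0)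
  have 2: "set_integrable lborel {1..} (\<lambda>\<epsilon>::real. \<epsilon> powr (- 5 / 4))"
    by (rule lborelI) (use has_integral_powr_to_inf[of "- 5 / 4" 1] in \<open>auto simp: has_integral_iff\<close>)
  have "integrable lborel (\<lambda>\<epsilon>. indicator {0..1} \<epsilon> *\<^sub>R (\<epsilon> powr (- 3 / 4)) + C * (indicator {1..} \<epsilon> *\<^sub>R (\<epsilon> powr (- 5 / 4))))"
    using 1 2 unfolding set_integrable_def by (intro Bochner_Integration.integrable_add integrable_mult_right)
  then show ?thesis
    unfolding set_integrable_def
  proof (rule Bochner_Integration.integrable_bound)
    have "1 \<le> r \<Longrightarrow> 0 \<le> C" for r :: real
      using \<phi>(1)[of r] \<phi>(3)[of r] by (auto simp: zero_le_divide_iff dest: order_trans)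
    then have C: "0 \<le> C" using order_refl[of "1::real"] by blast
    have "\<epsilon> powr (1 / 4 - 1) * \<phi> \<epsilon> \<le> indicator {0..1} \<epsilon> *\<^sub>R (\<epsilon> powr (- 3 / 4)) + C * (indicator {1..} \<epsilon> *\<^sub>R (\<epsilon> powr (- 5 / 4)))"
      if \<epsilon>: "0 < \<epsilon>" for \<epsilon>
    proof (cases "\<epsilon> \<le> 1")
      case True
      have "\<epsilon> powr (1 / 4 - 1) * \<phi> \<epsilon> \<le> \<epsilon> powr (- 3 / 4)"
        using \<phi>(2)[OF \<epsilon>] by (simp add: mult_left_le)
      moreover have "0 \<le> C * (indicator {1..} \<epsilon> *\<^sub>R (\<epsilon> powr (- 5 / 4)))" using C by simp
      moreover have "indicator {0..1} \<epsilon> *\<^sub>R (\<epsilon> powr (- 3 / 4)) = \<epsilon> powr (- 3 / 4)"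
        using True \<epsilon> by simp
      ultimately show ?thesis by linarith
    next
      case False
      have "\<epsilon> powr (1 / 4 - 1) * \<phi> \<epsilon> \<le> \<epsilon> powr (1 / 4 - 1) * (C / sqrt \<epsilon>)"
        using False by (intro mult_left_mono \<phi>(3)) auto
      also have "\<dots> = C * (\<epsilon> powr (1 / 4 - 1) / \<epsilon> powr (1 / 2))"
        using \<epsilon> by (simp add: powr_half_sqrt)
      also have "\<epsilon> powr (1 / 4 - 1) / \<epsilon> powr (1 / 2) = \<epsilon> powr (- 5 / 4)"
        unfolding powr_diff[symmetric] by simp
      finally show ?thesis using False by simp
    qed
    then show "AE \<epsilon> in lborel. norm (indicator {0<..} \<epsilon> *\<^sub>R (\<epsilon> powr (1 / 4 - 1) * \<phi> \<epsilon>)) \<le>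
        norm (indicator {0..1} \<epsilon> *\<^sub>R (\<epsilon> powr (- 3 / 4)) + C * (indicator {1..} \<epsilon> *\<^sub>R (\<epsilon> powr (- 5 / 4))))"
      using \<phi>(1) C by (intro AE_I2) (auto simp: indicator_def abs_of_nonneg)
  qed measurable
qed

context levy
begin

lemma laplace_alternating_stage:
  assumes "0 < \<epsilon>" "0 \<le> r"
  shows "laplace M (\<lambda>\<omega>. stage alternating (\<lambda>s. X s \<omega>) \<epsilon> (2 * j)) r =
    (laplace M (\<lambda>\<omega>. drawup_time (\<lambda>s. X s \<omega>) \<epsilon> 0) r * laplace M (\<lambda>\<omega>. drawdown_time (\<lambda>s. X s \<omega>) \<epsilon> 0) r) ^ j"
proof -
  let ?L = "\<lambda>c. laplace M (\<lambda>\<omega>. stage (\<lambda>_. c) (\<lambda>s. X s \<omega>) \<epsilon> (Suc 0)) r"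
  \<comment> \<open>Even steps wait for a drawdown and odd ones for a drawup, so each pair of steps
    contributes one factor of either kind.\<close>
  have "(\<Prod>i<2 * j. ?L ((- 1) ^ i)) = (?L (- 1) * ?L 1) ^ j"
  proof (induction j)
    case (Suc j)
    have "(\<Prod>i<2 * Suc j. ?L ((- 1) ^ i)) = (\<Prod>i<2 * j. ?L ((- 1) ^ i)) * ?L ((- 1) ^ (2 * j)) * ?L ((- 1) ^ Suc (2 * j))"
      by (simp only: mult_Suc_right add_2_eq_Suc prod.lessThan_Suc)
    also have "(- 1 :: real) ^ (2 * j) = 1" by simp
    also have "(- 1 :: real) ^ Suc (2 * j) = - 1" by simp
    finally show ?case unfolding Suc.IH by (simp only: power_Suc mult_ac)
  qed (simp only: mult_0_right lessThan_0 prod.empty power_0)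
  with laplace_stage[OF assms, of alternating "2 * j"] show ?thesis
    unfolding drawdown_time_eq_stage drawup_time_eq_stage by (rule trans)
qed

lemma stage_radius_powr:
  assumes \<omega>: "\<omega> \<in> space M" and "0 < \<alpha>" "0 < t"
  shows "complex_of_real (stage_radius \<alpha> t (Suc n) \<omega>) powr p =
    complex_of_real t powr (p / of_real \<alpha>) *
    (if stage alternating (\<lambda>s. X s \<omega>) 1 (Suc n) = \<infinity> then 0
     else complex_of_real (real_of_ereal (stage alternating (\<lambda>s. X s \<omega>) 1 (Suc n))) powr (- (p / of_real \<alpha>)))"
proof (cases "stage alternating (\<lambda>s. X s \<omega>) 1 (Suc n) = \<infinity>")
  case False
  define x where "x = real_of_ereal (stage alternating (\<lambda>s. X s \<omega>) 1 (Suc n))"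
  have x: "0 < x"
    using stage_Suc_pos[OF cadlag_path[OF \<omega>], of 1 alternating n] False
    unfolding x_def by (cases "stage alternating (\<lambda>s. X s \<omega>) 1 (Suc n)") auto
  have "complex_of_real ((t / x) powr (1 / \<alpha>)) powr p = exp (p * of_real ((ln t - ln x) / \<alpha>))"
    using assms x by (simp add: powr_def Ln_of_real ln_div flip: exp_of_real)
  also have "p * of_real ((ln t - ln x) / \<alpha>) = p / of_real \<alpha> * of_real (ln t) + - (p / of_real \<alpha>) * of_real (ln x)"
    by (simp add: diff_divide_distrib algebra_simps)
  also have "exp \<dots> = complex_of_real t powr (p / of_real \<alpha>) * complex_of_real x powr (- (p / of_real \<alpha>))"
    unfolding exp_add using assms x by (simp add: powr_def Ln_of_real)
  finally show ?thesis
    using False by (simp add: stage_radius_def Let_def x_def del: stage.simps)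
next
  \<comment> \<open>An infinite crossing time means radius 0, and
    \<open>0 powr p = 0\<close>.\<close>
  case True
  then show ?thesis by (simp add: stage_radius_def del: stage.simps)
qed

end

theorem proposition3p26:
  fixes M :: "'a measure" and X :: "real \<Rightarrow> 'a \<Rightarrow> real" and \<alpha> t :: real
    and N :: "'b measure" and S T U :: "'b \<Rightarrow> ereal" and k :: nat
  assumes "0 < \<alpha>" and "0 < t"
    and "levy_process M X" and "stable_process \<alpha> M X"
    and "AE \<omega> in M. \<not> monotone_on_some_interval t (\<lambda>s. X s \<omega>)"
    and "prob_space N" and "prob_space.indep_var N borel S borel T"
    and "distr N borel S = distr M borel (\<lambda>\<omega>. drawup_time (\<lambda>s. X s \<omega>) 1 0)"
    and "distr N borel T = distr M borel (\<lambda>\<omega>. drawdown_time (\<lambda>s. X s \<omega>) 1 0)"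
    and "U = (\<lambda>\<omega>. S \<omega> + T \<omega>)"
    and "2 \<le> k"
  shows "(\<forall>p :: complex. G_defined \<alpha> (laplace N U) p \<longrightarrow>
            integrable M (\<lambda>\<omega>. complex_of_real (bar_length (\<lambda>s. X s \<omega>) t k) powr p) \<and>
            (\<lambda>z. G \<alpha> t (laplace N U) z p) analytic_on {0} \<and>
            (LINT \<omega>|M. complex_of_real (bar_length (\<lambda>s. X s \<omega>) t k) powr p) =
              1 / fact k * (deriv ^^ k) (\<lambda>z. G \<alpha> t (laplace N U) z p) 0)
       \<and> (\<forall>\<nu> :: real measure.
            prob_space \<nu> \<and> sets \<nu> = sets borel \<and> (AE x in \<nu>. 0 \<le> x) \<and>
            (\<forall>p :: complex. G_defined \<alpha> (laplace N U) p \<longrightarrow>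
               integrable \<nu> (\<lambda>x. complex_of_real x powr p) \<and>
               (LINT x|\<nu>. complex_of_real x powr p) =
                 1 / fact k * (deriv ^^ k) (\<lambda>z. G \<alpha> t (laplace N U) z p) 0)
            \<longrightarrow> \<nu> = distr M borel (\<lambda>\<omega>. bar_length (\<lambda>s. X s \<omega>) t k))"
proof -
  interpret levy M X by unfold_locales fact
  interpret N: prob_space N by fact
  note \<alpha> = \<open>0 < \<alpha>\<close> and t = \<open>0 < t\<close> and k = \<open>2 \<le> k\<close>
  let ?up = "\<lambda>\<omega>. drawup_time (\<lambda>s. X s \<omega>) 1 0" and ?down = "\<lambda>\<omega>. drawdown_time (\<lambda>s. X s \<omega>) 1 0"
  let ?\<phi> = "laplace N U" and ?l = "\<lambda>\<omega>. bar_length (\<lambda>s. X s \<omega>) t k"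
  have meas: "?up \<in> borel_measurable M" "?down \<in> borel_measurable M"
    unfolding drawdown_time_eq_stage drawup_time_eq_stage by (rule stage_measurable, simp)+
  have [measurable]: "S \<in> borel_measurable N" "T \<in> borel_measurable N"
    using N.indep_var_rv1[OF assms(7)] N.indep_var_rv2[OF assms(7)] by auto
  have "AE \<omega> in N. 0 \<le> S \<omega>"
    by (rule AE_nonneg_distr_cong[OF _ meas(1) assms(8)])
      (simp_all add: drawup_time_eq_stage stage_nonneg del: stage.simps)
  moreover have "AE \<omega> in N. 0 \<le> T \<omega>"
    by (rule AE_nonneg_distr_cong[OF _ meas(2) assms(9)])
      (simp_all add: drawdown_time_eq_stage stage_nonneg del: stage.simps)
  ultimately have ST: "AE \<omega> in N. 0 \<le> S \<omega>" "AE \<omega> in N. 0 \<le> T \<omega>" by auto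
  then have U_nonneg: "AE \<omega> in N. 0 \<le> U \<omega>"
    unfolding assms(10) by eventually_elim simp
  have \<phi>_eq: "?\<phi> r = laplace M ?up r * laplace M ?down r" if "0 \<le> r" for r
    unfolding assms(10) N.laplace_indep_sum[OF assms(7) ST that]
    using laplace_distr_cong[OF _ meas(1) assms(8)] laplace_distr_cong[OF _ meas(2) assms(9)] by simp
  have pos: "0 < laplace M ?up r" "0 < laplace M ?down r" if "0 \<le> r" for r
    unfolding drawdown_time_eq_stage drawup_time_eq_stage
    by (rule laplace_stage_pos[OF assms(4) t assms(5) _ that]; simp)+
  have U: "U \<in> borel_measurable N" unfolding assms(10) by measurable
  have "0 < ?\<phi> r" if "0 < r" for r
    using \<phi>_eq[of r] pos[of r] that by simp
  then interpret laplace_like ?\<phi>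
    by (rule N.laplace_like_laplace[OF U U_nonneg])
  \<comment> \<open>Decay of the drawdown factor is enough, since the drawup factor is at most
    1.\<close>
  obtain C where C: "\<And>r. 1 \<le> r \<Longrightarrow> laplace M ?down r \<le> C / sqrt r"
    using laplace_stage_bound[of 1 "\<lambda>_. 1"] unfolding drawdown_time_eq_stage by auto
  have "AE \<omega> in M. 0 \<le> ?up \<omega>"
    unfolding drawup_time_eq_stage by (intro AE_I2 stage_nonneg)
  then interpret up: laplace_like "laplace M ?up"
    by (rule laplace_like_laplace[OF meas(1)]) (rule pos(1), simp)
  have up_le: "laplace M ?up r \<le> 1" if "0 < r" for r
    using up.\<phi>_le_1[OF that] .
  have \<phi>_bound: "?\<phi> r \<le> C / sqrt r" if "1 \<le> r" for r
  proof -
    have "?\<phi> r \<le> laplace M ?down r"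
      using \<phi>_eq[of r] up_le[of r] pos[of r] that by (simp add: mult_left_le_one_le)
    then show ?thesis using C[OF that] by simp
  qed
  \<comment> \<open>\<open>k \<ge> 2\<close> makes the stage number a successor, so the crossing
    time is strictly positive, and leaves at least one factor \<open>\<phi>\<close> for
    convergence.\<close>
  obtain j where j: "2 * (k - 1) = Suc j" using k by (cases "2 * (k - 1)") auto
  obtain i where i: "k - 1 = Suc i" using k by (cases "k - 1") auto
  let ?\<tau> = "\<lambda>\<omega>. stage alternating (\<lambda>s. X s \<omega>) 1 (2 * (k - 1))"
  have \<tau>: "?\<tau> \<in> borel_measurable M" by (rule stage_measurable) simp
  have laplace_\<tau>: "laplace M ?\<tau> r = ?\<phi> r ^ (k - 1)" if "0 < r" for r
    using laplace_alternating_stage[of 1 r "k - 1"] \<phi>_eq[of r] that by simp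
  have moments: "integrable M (\<lambda>\<omega>. complex_of_real (?l \<omega>) powr p) \<and>
      (LINT \<omega>|M. complex_of_real (?l \<omega>) powr p) = 1 / fact k * (deriv ^^ k) (\<lambda>z. G \<alpha> t ?\<phi> z p) 0"
    if p: "G_defined \<alpha> ?\<phi> p" for p
  proof -
    let ?s = "p / of_real \<alpha>"
    let ?g = "\<lambda>\<omega>. if ?\<tau> \<omega> = \<infinity> then 0 else complex_of_real (real_of_ereal (?\<tau> \<omega>)) powr (- ?s)"
    have int: "set_integrable lborel {0<..} (\<lambda>\<epsilon>. \<epsilon> powr (Re ?s - 1) * ?\<phi> \<epsilon>)"
      using p unfolding set_integrable_iff_G_defined .
    have s: "0 < Re ?s" by (rule Re_pos[OF int])
    then have Gamma_nonzero: "Gamma ?s \<noteq> 0" by (rule Gamma_nonzero)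
    have "set_integrable lborel {0<..} (\<lambda>\<epsilon>. \<epsilon> powr (Re ?s - 1) * ?\<phi> \<epsilon> ^ (k - 1))"
      unfolding i by (rule set_integrable_power[OF int])
    then have int_\<tau>: "set_integrable lborel {0<..} (\<lambda>\<epsilon>. \<epsilon> powr (Re ?s - 1) * laplace M ?\<tau> \<epsilon>)"
      using laplace_\<tau> by (subst set_integrable_cong[OF refl refl]) simp_all
    have \<tau>_pos: "0 < ?\<tau> \<omega>" if "\<omega> \<in> space M" for \<omega>
      unfolding j by (rule stage_Suc_pos[OF cadlag_path[OF that]]) simp
    note ml = mellin_laplace[OF \<tau> \<tau>_pos s int_\<tau>]
    have "mellin (\<lambda>\<epsilon>. of_real (?\<phi> \<epsilon> ^ (k - 1))) ?s = mellin (\<lambda>\<epsilon>. of_real (laplace M ?\<tau> \<epsilon>)) ?s"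
      unfolding mellin_def using laplace_\<tau> by (intro set_lebesgue_integral_cong) auto
    then have mellin: "mellin (\<lambda>\<epsilon>. of_real (?\<phi> \<epsilon> ^ (k - 1))) ?s = Gamma ?s * (LINT \<omega>|M. ?g \<omega>)"
      using ml(2) by simp
    have radius: "complex_of_real (stage_radius \<alpha> t (2 * (k - 1)) \<omega>) powr p = complex_of_real t powr ?s * ?g \<omega>"
      if "\<omega> \<in> space M" for \<omega>
      unfolding j by (rule stage_radius_powr[OF that \<alpha> t])
    have "integrable M (\<lambda>\<omega>. complex_of_real t powr ?s * ?g \<omega>)"
      by (rule Bochner_Integration.integrable_mult_right) (rule ml(1))
    then have int_R: "integrable M (\<lambda>\<omega>. complex_of_real (stage_radius \<alpha> t (2 * (k - 1)) \<omega>) powr p)"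
      using radius by (subst Bochner_Integration.integrable_cong[OF refl]) auto
    have "(LINT \<omega>|M. complex_of_real (stage_radius \<alpha> t (2 * (k - 1)) \<omega>) powr p) = (LINT \<omega>|M. complex_of_real t powr ?s * ?g \<omega>)"
      by (intro Bochner_Integration.integral_cong refl radius)
    also have "\<dots> = complex_of_real t powr ?s * (LINT \<omega>|M. ?g \<omega>)" by simp
    also have "\<dots> = complex_of_real t powr ?s / Gamma ?s * mellin (\<lambda>\<epsilon>. of_real (?\<phi> \<epsilon> ^ (k - 1))) ?s"
      unfolding mellin using Gamma_nonzero by simp
    also have "\<dots> = 1 / fact k * (deriv ^^ k) (\<lambda>z. G \<alpha> t ?\<phi> z p) 0"
      by (rule G_deriv[OF p k, symmetric])
    finally have val: "(LINT \<omega>|M. complex_of_real (stage_radius \<alpha> t (2 * (k - 1)) \<omega>) powr p) = \<dots>" .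
    have l: "?l \<in> borel_measurable M" using t k by (intro bar_length_measurable) auto
    \<comment> \<open>The moments found so far belong to \<open>stage_radius\<close>, a different
      random variable; equality of the laws transfers both integrability and value to the bar
      length.\<close>
    note law = distr_bar_length[OF assms(4) \<alpha> t k]
    have "integrable M (\<lambda>\<omega>. complex_of_real (?l \<omega>) powr p) \<longleftrightarrow>
        integrable M (\<lambda>\<omega>. complex_of_real (stage_radius \<alpha> t (2 * (k - 1)) \<omega>) powr p)"
      using integrable_distr_eq[OF l cpowr_measurable, of p] integrable_distr_eq[OF stage_radius_measurable cpowr_measurable, of \<alpha> t "2 * (k - 1)" p]
      unfolding law by simp
    moreover have "(LINT \<omega>|M. complex_of_real (?l \<omega>) powr p) =
        (LINT \<omega>|M. complex_of_real (stage_radius \<alpha> t (2 * (k - 1)) \<omega>) powr p)"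
      using integral_distr[OF l cpowr_measurable, of p] integral_distr[OF stage_radius_measurable cpowr_measurable, of \<alpha> t "2 * (k - 1)" p]
      unfolding law by simp
    ultimately show ?thesis using int_R val by simp
  qed
  \<comment> \<open>Dividing \<open>p\<close> by \<open>\<alpha>\<close> gives real part
    \<open>1 / 4\<close> for every \<open>y\<close>, so the whole vertical line is admissible and
    the uniqueness theorem applies with \<open>c = \<alpha> / 4\<close>.\<close>
  have line: "G_defined \<alpha> ?\<phi> (Complex (\<alpha> / 4) y)" for y
  proof -
    have "Re (Complex (\<alpha> / 4) y / of_real \<alpha>) = 1 / 4"
      using \<alpha> by (simp add: Re_divide_of_real)
    moreover have "set_integrable lborel {0<..} (\<lambda>\<epsilon>. \<epsilon> powr (1 / 4 - 1) * ?\<phi> \<epsilon>)"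
      by (rule set_integrable_powr_bound[OF \<phi>_measurable _ \<phi>_le_1 \<phi>_bound]) (use \<phi>_pos in \<open>auto intro: less_imp_le\<close>)
    ultimately show ?thesis unfolding set_integrable_iff_G_defined by (simp only:)
  qed
  have l: "?l \<in> borel_measurable M" using t k by (intro bar_length_measurable) auto
  have unique: "\<nu> = distr M borel ?l"
    if \<nu>: "prob_space \<nu>" "sets \<nu> = sets borel" "AE x in \<nu>. 0 \<le> x"
      and mom: "\<And>p. G_defined \<alpha> ?\<phi> p \<Longrightarrow> integrable \<nu> (\<lambda>x. complex_of_real x powr p) \<and>
        (LINT x|\<nu>. complex_of_real x powr p) = 1 / fact k * (deriv ^^ k) (\<lambda>z. G \<alpha> t ?\<phi> z p) 0"
    for \<nu> :: "real measure"
  proof (rule nonneg_measure_eqI_moments_on_line[OF \<nu>, where c="\<alpha> / 4"])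
    show "prob_space (distr M borel ?l)" by (rule prob_space_distr[OF l])
    have "0 \<le> ?l \<omega>" if "\<omega> \<in> space M" for \<omega>
      using bar_length_nonneg[OF cadlag_path[OF that]] t k by simp
    then show "AE x in distr M borel ?l. 0 \<le> x"
      using l by (subst AE_distr_iff) auto
    fix y
    show "integrable \<nu> (\<lambda>x. complex_of_real x powr Complex (\<alpha> / 4) y)"
      using mom[OF line] by blast
    show "integrable (distr M borel ?l) (\<lambda>x. complex_of_real x powr Complex (\<alpha> / 4) y)"
      using moments[OF line[of y]] l by (subst integrable_distr_eq) auto
    show "(LINT x|\<nu>. complex_of_real x powr Complex (\<alpha> / 4) y) =
        (LINT x|distr M borel ?l. complex_of_real x powr Complex (\<alpha> / 4) y)"
      using mom[OF line[of y]] moments[OF line[of y]] l by (subst integral_distr) auto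
  qed simp
  show ?thesis
    using moments unique G_analytic[OF _ k] by blast
qed

end
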